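(* Let $d\ge n$. If $H$ is a Grosshans subgroup of $GL_n$, then ${}^Hk[M_{n,d}]$ is contained in the $p$-root closure of $GL_d*j({}^Hk[M_{n,n}])$. If $H$ is a Grosshans subgroup of $SL_n$, then ${}^Hk[M_{n,d}]$ is the $p$-root closure of $GL_d*j({}^Hk[M_{n,n}])$ in its quotient field.
   Context: $k$ is an algebraically closed field of characteristic $p\ge 0$; $GL_m=GL_m(k)$, $SL_n=SL_n(k)$; $M_{n,d}$ is the space of $n\times d$ matrices over $k$, with $d\ge n$, and $x=(x_1,\dots,x_d)\in M_{n,d}$ has $i$th column $x_i$. $H\subset GL_n$ acts on $k[M_{n,d}]$ by $(hF)(x)=F(h^{-1}x)$, with algebra of invariants ${}^Hk[M_{n,d}]$. $GL_d$ acts on $k[M_{n,d}]$ by $(g*F)(x)=F(xg)$. The map $j:k[M_{n,n}]\to k[M_{n,d}]$ is $(jF)(x_1,\dots,x_d)=F(x_1,\dots,x_n)$. $GL_d*j({}^Hk[M_{n,n}])$ is the $k$-algebra generated by all $g*jf$ with $g\in GL_d$, $f\in{}^Hk[M_{n,n}]$. A Grosshans subgroup of a linear algebraic group $G$ is a closed subgroup $H$ that is observable in $G$ (i.e. $G/H$ is quasi-affine) and such that $k[G/H]=k[G]^H$ (invariants under right translation by $H$) is a finitely generated $k$-algebra. For $k$-algebras $R\subset S$: if $p>0$, $S$ is contained in the $p$-root closure of $R$ if for every $s\in S$ there is an integer $m\ge 0$ with $s^{p^m}\in R$; if $p=0$, this means $R=S$. For a domain $R$ with quotient field $K$, the $p$-root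 closure of $R$ in $K$ is $\{s\in K: s^{p^m}\in R\text{ for some }m\ge 0\}$ if $p>0$, and $R$ if $p=0$. *)

theory Defs
  imports
    "Jordan_Normal_Form.Determinant"
    "HOL-Algebra.Generated_Rings"
    "HOL-Algebra.Left_Coset"
    "HOL-Analysis.Abstract_Topology"
begin

section \<open>Algebras of functions\<close>

text \<open>
  Since an algebraically closed field \<open>k\<close> is infinite, \<open>k[M\<^bsub>n,d\<^esub>]\<close> is the algebra of polynomial
  functions on \<open>M\<^bsub>n,d\<^esub> = carrier_mat n d\<close>. Functions on \<open>X\<close> are kept \<^const>\<open>undefined\<close> outside \<open>X\<close>,
  so that equality of functions is equality on \<open>X\<close>.
\<close>

definition fun_ring :: "'x set \<Rightarrow> ('x \<Rightarrow> 'a::field) ring" where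
  "fun_ring X = \<lparr>carrier = X \<rightarrow>\<^sub>E UNIV,
     mult = (\<lambda>f g. \<lambda>x\<in>X. f x * g x), one = (\<lambda>x\<in>X. 1),
     zero = (\<lambda>x\<in>X. 0), add = (\<lambda>f g. \<lambda>x\<in>X. f x + g x)\<rparr>"

definition generated_alg :: "'x set \<Rightarrow> ('x \<Rightarrow> 'a::field) set \<Rightarrow> ('x \<Rightarrow> 'a) set" where
  "generated_alg X B = generate_ring (fun_ring X) (range (\<lambda>c. \<lambda>x\<in>X. c) \<union> B)"

definition finitely_generated_alg :: "'x set \<Rightarrow> ('x \<Rightarrow> 'a::field) set \<Rightarrow> bool" where
  "finitely_generated_alg X A \<longleftrightarrow> (\<exists>B. finite B \<and> B \<subseteq> A \<and> A = generated_alg X B)"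

definition mat_polys :: "nat \<Rightarrow> nat \<Rightarrow> ('a::field mat \<Rightarrow> 'a) set" where
  "mat_polys n d = generated_alg (carrier_mat n d)
     {\<lambda>x\<in>carrier_mat n d. x $$ (i, j) | i j. i < n \<and> j < d}"

definition vec_polys :: "nat \<Rightarrow> ('a::field vec \<Rightarrow> 'a) set" where
  "vec_polys m = generated_alg (carrier_vec m) {\<lambda>v\<in>carrier_vec m. v $ i | i. i < m}"

definition mat_poly_ring :: "nat \<Rightarrow> nat \<Rightarrow> ('a::field mat \<Rightarrow> 'a) ring" where
  "mat_poly_ring n d = (fun_ring (carrier_mat n d))\<lparr>carrier := mat_polys n d\<rparr>"

lemma fun_ring_cring: "cring (fun_ring X :: ('x \<Rightarrow> 'a::field) ring)"
proof (rule cringI)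
  show "abelian_group (fun_ring X :: ('x \<Rightarrow> 'a) ring)"
  proof (rule abelian_groupI)
    fix f :: "'x \<Rightarrow> 'a" assume "f \<in> carrier (fun_ring X)"
    then show "\<exists>g\<in>carrier (fun_ring X). g \<oplus>\<^bsub>fun_ring X\<^esub> f = \<zero>\<^bsub>fun_ring X\<^esub>"
      by (intro bexI[of _ "\<lambda>x\<in>X. - f x"]) (auto simp: fun_ring_def)
  qed (auto simp: fun_ring_def fun_eq_iff restrict_def PiE_def extensional_def algebra_simps)
  show "comm_monoid (fun_ring X :: ('x \<Rightarrow> 'a) ring)"
    by (rule comm_monoidI)
      (auto simp: fun_ring_def fun_eq_iff restrict_def PiE_def extensional_def algebra_simps)
qed (auto simp: fun_ring_def fun_eq_iff restrict_def algebra_simps)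

lemma generated_alg_subring:
  assumes "B \<subseteq> X \<rightarrow>\<^sub>E UNIV"
  shows "subring (generated_alg X B) (fun_ring X)"
  unfolding generated_alg_def
  by (rule ring.generate_ring_is_subring[OF cring.axioms(1)[OF fun_ring_cring]])
    (use assms in \<open>auto simp: fun_ring_def\<close>)

lemma mat_polys_subring: "subring (mat_polys n d) (fun_ring (carrier_mat n d))"
  unfolding mat_polys_def by (rule generated_alg_subring) auto

lemma vec_polys_subring: "subring (vec_polys m) (fun_ring (carrier_vec m))"
  unfolding vec_polys_def by (rule generated_alg_subring) auto

lemma alg_closed_field_infinite: "infinite (UNIV :: 'a::alg_closed_field set)"
proof
  assume fin: "finite (UNIV :: 'a set)"
  define p :: "'a poly" where "p = (\<Prod>a\<in>UNIV. [:-a, 1:]) + 1"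
  have "poly p x = 1" for x
    using fin by (auto simp: p_def poly_prod prod_zero_iff)
  moreover have "degree (\<Prod>a\<in>(UNIV::'a set). [:-a, 1:]) = card (UNIV :: 'a set)"
    by (subst degree_prod_eq_sum_degree) auto
  then have "degree p > 0"
    using fin by (simp add: p_def degree_add_eq_left finite_UNIV_card_ge_0)
  ultimately show False using alg_closed_imp_poly_has_root[of p] by auto
qed

lemma mat_polys_line:
  assumes "f \<in> mat_polys n d" and x: "x \<in> carrier_mat n d" and y: "y \<in> carrier_mat n d"
  shows "\<exists>p. \<forall>t. f (x + t \<cdot>\<^sub>m (y - x)) = poly p (t::'a::field)"
proof -
  have line: "x + t \<cdot>\<^sub>m (y - x) \<in> carrier_mat n d" for t
    using x y by (intro add_carrier_mat smult_carrier_mat minus_carrier_mat)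
  show ?thesis
  using assms(1) unfolding mat_polys_def generated_alg_def
proof (induction f rule: generate_ring.induct)
  case one
  show ?case using line by (intro exI[of _ 1]) (simp add: fun_ring_def)
next
  case (incl h)
  then consider c where "h = (\<lambda>x\<in>carrier_mat n d. c)"
    | i j where "h = (\<lambda>x\<in>carrier_mat n d. x $$ (i, j))" "i < n" "j < d" by blast
  then show ?case
  proof cases
    case 1
    then show ?thesis using line by (intro exI[of _ "[:c:]"]) simp
  next
    case 2
    then show ?thesis using x y line
      by (intro exI[of _ "[:x $$ (i,j), y $$ (i,j) - x $$ (i,j):]"]) simp
  qed
next
  case (a_inv h)
  then obtain p where p: "\<And>t. h (x + t \<cdot>\<^sub>m (y - x)) = poly p t" by blast
  let ?R = "fun_ring (carrier_mat n d) :: ('a mat \<Rightarrow> 'a) ring"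
  interpret cring ?R by (rule fun_ring_cring)
  have "h \<in> carrier ?R"
    by (rule generate_ring_in_carrier[OF _ a_inv(1)]) (auto simp: fun_ring_def)
  then have "\<ominus>\<^bsub>?R\<^esub> h = (\<lambda>x\<in>carrier_mat n d. - h x)"
    by (intro minus_equality) (auto simp: fun_ring_def)
  then show ?case using line p by (intro exI[of _ "-p"]) simp
next
  case (eng_add f g)
  then obtain p q where "\<And>t. f (x + t \<cdot>\<^sub>m (y - x)) = poly p t" "\<And>t. g (x + t \<cdot>\<^sub>m (y - x)) = poly q t"
    by blast
  then show ?case using line by (intro exI[of _ "p + q"]) (simp add: fun_ring_def)
next
  case (eng_mult f g)
  then obtain p q where "\<And>t. f (x + t \<cdot>\<^sub>m (y - x)) = poly p t" "\<And>t. g (x + t \<cdot>\<^sub>m (y - x)) = poly q t"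
    by blast
  then show ?case using line by (intro exI[of _ "p * q"]) (simp add: fun_ring_def)
qed
qed

lemma mat_poly_ring_domain: "domain (mat_poly_ring n d :: ('a::alg_closed_field mat \<Rightarrow> 'a) ring)"
proof -
  let ?X = "carrier_mat n d :: 'a mat set"
  let ?R = "mat_poly_ring n d :: ('a mat \<Rightarrow> 'a) ring"
  have "subcring (mat_polys n d) (fun_ring ?X)"
    using cring.subcringI'[OF fun_ring_cring mat_polys_subring] .
  then interpret cring ?R
    unfolding mat_poly_ring_def
    by (rule iffD1[OF ring.subcring_iff[OF cring.axioms(1)[OF fun_ring_cring]
          subringE(1)[OF mat_polys_subring]]])
  show ?thesis
  proof (intro domainI is_cring)
    have "0\<^sub>m n d \<in> ?X" by simp
    then show "\<one>\<^bsub>?R\<^esub> \<noteq> \<zero>\<^bsub>?R\<^esub>"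
      by (auto simp: mat_poly_ring_def fun_ring_def fun_eq_iff restrict_def)
  next
    fix f g assume fg: "f \<otimes>\<^bsub>?R\<^esub> g = \<zero>\<^bsub>?R\<^esub>" "f \<in> carrier ?R" "g \<in> carrier ?R"
    then have A: "f \<in> mat_polys n d" "g \<in> mat_polys n d"
      and prod: "\<And>x. x \<in> ?X \<Longrightarrow> f x * g x = 0"
      by (auto simp: mat_poly_ring_def fun_ring_def fun_eq_iff restrict_def split: if_splits)
    have ext: "f \<in> ?X \<rightarrow>\<^sub>E UNIV" "g \<in> ?X \<rightarrow>\<^sub>E UNIV"
      using A subringE(1)[OF mat_polys_subring[of n d]] by (auto simp: fun_ring_def)
    have zero: "h = \<zero>\<^bsub>?R\<^esub>" if "h \<in> ?X \<rightarrow>\<^sub>E UNIV" "\<forall>x\<in>?X. h x = 0" for h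
      using that by (auto simp: mat_poly_ring_def fun_ring_def fun_eq_iff PiE_def extensional_def)
    show "f = \<zero>\<^bsub>?R\<^esub> \<or> g = \<zero>\<^bsub>?R\<^esub>"
    proof (rule ccontr)
      assume "\<not> ?thesis"
      then have nz: "f \<noteq> \<zero>\<^bsub>?R\<^esub>" "g \<noteq> \<zero>\<^bsub>?R\<^esub>" by simp_all
      have "\<not> (\<forall>x\<in>?X. f x = 0)" using zero[OF ext(1)] nz(1) by argo
      then obtain x where x: "x \<in> ?X" "f x \<noteq> 0" unfolding ball_simps by (rule bexE)
      have "\<not> (\<forall>x\<in>?X. g x = 0)" using zero[OF ext(2)] nz(2) by argo
      then obtain y where y: "y \<in> ?X" "g y \<noteq> 0" unfolding ball_simps by (rule bexE)
      obtain p where "\<forall>t. f (x + t \<cdot>\<^sub>m (y - x)) = poly p t"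
        using mat_polys_line[OF A(1) x(1) y(1)] by (rule exE)
      then have p: "f (x + t \<cdot>\<^sub>m (y - x)) = poly p t" for t by (rule spec)
      obtain q where "\<forall>t. g (x + t \<cdot>\<^sub>m (y - x)) = poly q t"
        using mat_polys_line[OF A(2) x(1) y(1)] by (rule exE)
      then have q: "g (x + t \<cdot>\<^sub>m (y - x)) = poly q t" for t by (rule spec)
      have "x + 0 \<cdot>\<^sub>m (y - x) = x" "x + 1 \<cdot>\<^sub>m (y - x) = y"
        using x(1) y(1) by (auto intro!: eq_matI)
      then have "poly p 0 \<noteq> 0" "poly q 1 \<noteq> 0" using p[of 0] q[of 1] x y by auto
      then have "p * q \<noteq> 0" by auto
      then have "finite {t. poly (p * q) t = 0}" by (rule poly_roots_finite)
      moreover have "x + t \<cdot>\<^sub>m (y - x) \<in> ?X" for t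
        using x(1) y(1) by (intro add_carrier_mat smult_carrier_mat minus_carrier_mat)
      then have "poly (p * q) t = 0" for t
        using prod[of "x + t \<cdot>\<^sub>m (y - x)"] by (simp add: p q)
      ultimately show False
        using alg_closed_field_infinite[where 'a='a] by (simp only: Collect_const if_True simp_thms)
    qed
  qed
qed

section \<open>Zariski topology and spaces with functions\<close>

text \<open>\<open>A\<close> is the algebra of polynomial functions on the affine space \<open>X\<close>.\<close>

definition zariski :: "'x set \<Rightarrow> ('x \<Rightarrow> 'a::field) set \<Rightarrow> 'x topology" where
  "zariski X A = topology (\<lambda>U. \<exists>B\<subseteq>A. U = {x\<in>X. \<exists>f\<in>B. f x \<noteq> 0})"

lemma openin_zariski:
  assumes "subring A (fun_ring X)"
  shows "openin (zariski X A) U \<longleftrightarrow> (\<exists>B\<subseteq>A. U = {x\<in>X. \<exists>f\<in>B. f x \<noteq> 0})"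
proof -
  let ?L = "\<lambda>U. \<exists>B\<subseteq>A. U = {x\<in>X. \<exists>f\<in>B. f x \<noteq> 0}"
  have mult: "(\<lambda>x\<in>X. f x * g x) \<in> A" if "f \<in> A" "g \<in> A" for f g
    using subringE(6)[OF assms that] by (simp add: fun_ring_def)
  have "istopology ?L"
    unfolding istopology_def
  proof (intro conjI allI impI)
    fix S T assume "?L S" "?L T"
    then obtain B C where BC: "B \<subseteq> A" "C \<subseteq> A"
      and S: "S = {x\<in>X. \<exists>f\<in>B. f x \<noteq> 0}" and T: "T = {x\<in>X. \<exists>f\<in>C. f x \<noteq> 0}" by blast
    let ?D = "{\<lambda>x\<in>X. f x * g x | f g. f \<in> B \<and> g \<in> C}"
    have "?D \<subseteq> A" using mult BC by blast
    moreover have "S \<inter> T = {x\<in>X. \<exists>f\<in>?D. f x \<noteq> 0}"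
    proof (intro equalityI subsetI)
      fix x assume "x \<in> S \<inter> T"
      then obtain f g where "x \<in> X" "f \<in> B" "f x \<noteq> 0" "g \<in> C" "g x \<noteq> 0"
        unfolding S T by auto
      moreover from this have "(\<lambda>x\<in>X. f x * g x) x \<noteq> 0" by simp
      ultimately show "x \<in> {x\<in>X. \<exists>f\<in>?D. f x \<noteq> 0}" by blast
    next
      fix x assume "x \<in> {x\<in>X. \<exists>f\<in>?D. f x \<noteq> 0}"
      then obtain f g where "x \<in> X" "f \<in> B" "g \<in> C" "(\<lambda>x\<in>X. f x * g x) x \<noteq> 0" by blast
      then show "x \<in> S \<inter> T" unfolding S T by auto
    qed
    ultimately show "?L (S \<inter> T)" by blast
  next
    fix K assume "\<forall>U\<in>K. ?L U"
    then have "\<forall>U\<in>K. \<exists>B. B \<subseteq> A \<and> U = {x\<in>X. \<exists>f\<in>B. f x \<noteq> 0}" .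
    then obtain B where B: "\<forall>U\<in>K. B U \<subseteq> A \<and> U = {x\<in>X. \<exists>f\<in>B U. f x \<noteq> 0}"
      by (rule bchoice[THEN exE])
    have "\<Union>(B ` K) \<subseteq> A" using B by auto
    moreover have "\<Union>K = (\<Union>U\<in>K. {x\<in>X. \<exists>f\<in>B U. f x \<noteq> 0})"
      using B by (metis (no_types, lifting) SUP_cong image_ident)
    then have "\<Union>K = {x\<in>X. \<exists>f\<in>\<Union>(B ` K). f x \<noteq> 0}" by auto
    ultimately show "?L (\<Union>K)" by (intro exI conjI)
  qed
  then show ?thesis by (simp add: zariski_def)
qed

text \<open>
  A space with functions is a topological space together with an algebra of \<open>k\<close>-valued functions
  on each open subset.
\<close>

type_synonym ('x, 'a) fspace = "'x topology \<times> ('x set \<Rightarrow> ('x \<Rightarrow> 'a) set)"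

definition regular_funs ::
  "('x \<Rightarrow> 'a::field) set \<Rightarrow> 'x topology \<Rightarrow> 'x set \<Rightarrow> ('x \<Rightarrow> 'a) set" where
  "regular_funs A T U = {f \<in> U \<rightarrow>\<^sub>E UNIV. \<forall>x\<in>U. \<exists>V a b. openin T V \<and> x \<in> V \<and> V \<subseteq> U \<and>
     a \<in> A \<and> b \<in> A \<and> (\<forall>y\<in>V. b y \<noteq> 0 \<and> f y = a y / b y)}"

definition subvariety :: "'x set \<Rightarrow> ('x \<Rightarrow> 'a::field) set \<Rightarrow> 'x set \<Rightarrow> ('x, 'a) fspace" where
  "subvariety X A Y =
     (let T = subtopology (zariski X A) Y in (T, regular_funs A T))"

definition pullback_fun :: "'x topology \<Rightarrow> ('x \<Rightarrow> 'y) \<Rightarrow> 'y set \<Rightarrow> ('y \<Rightarrow> 'a) \<Rightarrow> ('x \<Rightarrow> 'a)" where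
  "pullback_fun T \<pi> U f = (\<lambda>x\<in>{x\<in>topspace T. \<pi> x \<in> U}. f (\<pi> x))"

definition quotient_fspace :: "('x, 'a) fspace \<Rightarrow> ('x \<Rightarrow> 'y) \<Rightarrow> ('y, 'a) fspace" where
  "quotient_fspace = (\<lambda>(T, F) \<pi>.
     (topology (\<lambda>U. U \<subseteq> \<pi> ` topspace T \<and> openin T {x\<in>topspace T. \<pi> x \<in> U}),
      \<lambda>U. {f \<in> U \<rightarrow>\<^sub>E UNIV. pullback_fun T \<pi> U f \<in> F {x\<in>topspace T. \<pi> x \<in> U}}))"

lemma openin_quotient_fspace:
  "openin (fst (quotient_fspace (T, F) \<pi>)) U \<longleftrightarrow>
     U \<subseteq> \<pi> ` topspace T \<and> openin T {x\<in>topspace T. \<pi> x \<in> U}"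
proof -
  have "istopology (\<lambda>U. U \<subseteq> \<pi> ` topspace T \<and> openin T {x\<in>topspace T. \<pi> x \<in> U})"
    unfolding istopology_def
  proof (intro conjI allI impI)
    fix U V assume "U \<subseteq> \<pi> ` topspace T \<and> openin T {x\<in>topspace T. \<pi> x \<in> U}"
      "V \<subseteq> \<pi> ` topspace T \<and> openin T {x\<in>topspace T. \<pi> x \<in> V}"
    moreover have "{x\<in>topspace T. \<pi> x \<in> U \<inter> V} =
      {x\<in>topspace T. \<pi> x \<in> U} \<inter> {x\<in>topspace T. \<pi> x \<in> V}" by blast
    ultimately show "U \<inter> V \<subseteq> \<pi> ` topspace T" "openin T {x\<in>topspace T. \<pi> x \<in> U \<inter> V}"
      by auto
  next
    fix K assume K: "\<forall>U\<in>K. U \<subseteq> \<pi> ` topspace T \<and> openin T {x\<in>topspace T. \<pi> x \<in> U}"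
    then show "\<Union>K \<subseteq> \<pi> ` topspace T" by blast
    have "{x\<in>topspace T. \<pi> x \<in> \<Union>K} = (\<Union>U\<in>K. {x\<in>topspace T. \<pi> x \<in> U})" by blast
    then show "openin T {x\<in>topspace T. \<pi> x \<in> \<Union>K}" using K by auto
  qed
  then show ?thesis by (simp add: quotient_fspace_def)
qed

definition fspace_iso :: "('x, 'a) fspace \<Rightarrow> ('y, 'a) fspace \<Rightarrow> ('x \<Rightarrow> 'y) \<Rightarrow> bool" where
  "fspace_iso = (\<lambda>(T, F) (T', F') \<phi>. homeomorphic_map T T' \<phi> \<and>
     (\<forall>V. openin T' V \<longrightarrow> (\<forall>f \<in> V \<rightarrow>\<^sub>E UNIV.
        f \<in> F' V \<longleftrightarrow> pullback_fun T \<phi> V f \<in> F {x\<in>topspace T. \<phi> x \<in> V})))"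

definition quasi_affine :: "('x, 'a::field) fspace \<Rightarrow> bool" where
  "quasi_affine S \<longleftrightarrow> (\<exists>m U C \<phi>.
     openin (zariski (carrier_vec m) (vec_polys m :: ('a vec \<Rightarrow> 'a) set)) U \<and>
     closedin (zariski (carrier_vec m) (vec_polys m :: ('a vec \<Rightarrow> 'a) set)) C \<and>
     fspace_iso S (subvariety (carrier_vec m) (vec_polys m) (U \<inter> C)) \<phi>)"

section \<open>Linear algebraic groups and Grosshans subgroups\<close>

definition GL :: "nat \<Rightarrow> 'a::field mat monoid" where
  "GL n = units_of (ring_mat TYPE('a) n ())"

definition SL :: "nat \<Rightarrow> 'a::field mat monoid" where
  "SL n = (GL n)\<lparr>carrier := {g \<in> carrier (GL n). det g = 1}\<rparr>"

lemma carrier_GL: "carrier (GL n) = {g \<in> carrier_mat n n. det g \<noteq> (0::'a::field)}"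
proof -
  have "g \<in> Units (ring_mat TYPE('a) n ()) \<longleftrightarrow> g \<in> carrier_mat n n \<and> det g \<noteq> 0" for g
    using det_non_zero_imp_unit[of g n "()"] unit_imp_det_non_zero[of g n "()"]
    by (auto simp: Units_def ring_mat_def)
  then show ?thesis by (auto simp: GL_def units_of_def)
qed

lemma GL_group: "group (GL n)"
  unfolding GL_def
  by (rule monoid.units_group[OF ring.is_monoid[OF ring_mat]])

text \<open>
  In the following, \<open>G\<close> is a closed subgroup of \<^term>\<open>GL n\<close>. As a variety it is a locally closed
  subset of the affine space of \<open>n \<times> n\<close> matrices.
\<close>

definition group_variety :: "nat \<Rightarrow> 'a::field mat monoid \<Rightarrow> ('a mat, 'a) fspace" where
  "group_variety n G = subvariety (carrier_mat n n) (mat_polys n n) (carrier G)"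

definition closed_subgroup :: "nat \<Rightarrow> 'a::field mat monoid \<Rightarrow> 'a mat set \<Rightarrow> bool" where
  "closed_subgroup n G H \<longleftrightarrow> subgroup H G \<and> closedin (fst (group_variety n G)) H"

text \<open>
  The points of \<open>G/H\<close> are the left cosets \<open>gH\<close>; a set of cosets is open, and a function on an open
  set of cosets is regular, iff its pullback to \<open>G\<close> is.
\<close>

definition homogeneous_space ::
  "nat \<Rightarrow> 'a::field mat monoid \<Rightarrow> 'a mat set \<Rightarrow> ('a mat set, 'a) fspace" where
  "homogeneous_space n G H = quotient_fspace (group_variety n G) (\<lambda>g. g <#\<^bsub>G\<^esub> H)"

definition observable :: "nat \<Rightarrow> 'a::field mat monoid \<Rightarrow> 'a mat set \<Rightarrow> bool" where
  "observable n G H \<longleftrightarrow> quasi_affine (homogeneous_space n G H)"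

text \<open>
  The coordinate ring \<open>k[G]\<close> of the affine variety \<open>G\<close>, and its invariants under right translation
  by \<open>H\<close>, which are \<open>k[G/H]\<close>.
\<close>

definition coord_ring :: "nat \<Rightarrow> 'a::field mat monoid \<Rightarrow> ('a mat \<Rightarrow> 'a) set" where
  "coord_ring n G = generated_alg (carrier G)
     (insert (\<lambda>g\<in>carrier G. 1 / det g) {\<lambda>g\<in>carrier G. g $$ (i, j) | i j. i < n \<and> j < n})"

definition right_invariants ::
  "nat \<Rightarrow> 'a::field mat monoid \<Rightarrow> 'a mat set \<Rightarrow> ('a mat \<Rightarrow> 'a) set" where
  "right_invariants n G H =
     {f \<in> coord_ring n G. \<forall>h\<in>H. (\<lambda>g\<in>carrier G. f (g \<otimes>\<^bsub>G\<^esub> h)) = f}"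

definition grosshans_subgroup :: "nat \<Rightarrow> 'a::field mat monoid \<Rightarrow> 'a mat set \<Rightarrow> bool" where
  "grosshans_subgroup n G H \<longleftrightarrow> closed_subgroup n G H \<and> observable n G H \<and>
     finitely_generated_alg (carrier G) (right_invariants n G H)"

section \<open>Vector invariants\<close>

definition left_act :: "nat \<Rightarrow> nat \<Rightarrow> 'a::field mat \<Rightarrow> ('a mat \<Rightarrow> 'a) \<Rightarrow> ('a mat \<Rightarrow> 'a)" where
  "left_act n d h F = (\<lambda>x\<in>carrier_mat n d. F ((inv\<^bsub>GL n\<^esub> h) * x))"

definition vector_invariants :: "nat \<Rightarrow> nat \<Rightarrow> 'a::field mat set \<Rightarrow> ('a mat \<Rightarrow> 'a) set" where
  "vector_invariants n d H = {F \<in> mat_polys n d. \<forall>h\<in>H. left_act n d h F = F}"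

definition right_act :: "nat \<Rightarrow> nat \<Rightarrow> 'a::field mat \<Rightarrow> ('a mat \<Rightarrow> 'a) \<Rightarrow> ('a mat \<Rightarrow> 'a)" where
  "right_act n d g F = (\<lambda>x\<in>carrier_mat n d. F (x * g))"

definition first_cols :: "nat \<Rightarrow> nat \<Rightarrow> ('a::field mat \<Rightarrow> 'a) \<Rightarrow> ('a mat \<Rightarrow> 'a)" where
  "first_cols n d F = (\<lambda>x\<in>carrier_mat n d. F (mat_of_cols n (map (col x) [0..<n])))"

definition polarization_alg :: "nat \<Rightarrow> nat \<Rightarrow> 'a::field mat set \<Rightarrow> ('a mat \<Rightarrow> 'a) set" where
  "polarization_alg n d H = generated_alg (carrier_mat n d)
     {right_act n d g (first_cols n d f) | g f. g \<in> carrier (GL d) \<and> f \<in> vector_invariants n n H}"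

section \<open>Quotient fields and \<open>p\<close>-root closures\<close>

definition fraction_rel :: "('r, 'm) ring_scheme \<Rightarrow> (('r \<times> 'r) \<times> ('r \<times> 'r)) set" where
  "fraction_rel A = {((a, b), (c, e)). a \<in> carrier A \<and> b \<in> carrier A - {\<zero>\<^bsub>A\<^esub>} \<and>
     c \<in> carrier A \<and> e \<in> carrier A - {\<zero>\<^bsub>A\<^esub>} \<and> a \<otimes>\<^bsub>A\<^esub> e = c \<otimes>\<^bsub>A\<^esub> b}"

definition fraction :: "('r, 'm) ring_scheme \<Rightarrow> 'r \<Rightarrow> 'r \<Rightarrow> ('r \<times> 'r) set" where
  "fraction A a b = fraction_rel A `` {(a, b)}"

definition Frac :: "('r, 'm) ring_scheme \<Rightarrow> ('r \<times> 'r) set ring" where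
  "Frac A = \<lparr>carrier = {fraction A a b | a b. a \<in> carrier A \<and> b \<in> carrier A - {\<zero>\<^bsub>A\<^esub>}},
     mult = (\<lambda>P Q. \<Union>(a, b)\<in>P. \<Union>(c, e)\<in>Q. fraction A (a \<otimes>\<^bsub>A\<^esub> c) (b \<otimes>\<^bsub>A\<^esub> e)),
     one = fraction A \<one>\<^bsub>A\<^esub> \<one>\<^bsub>A\<^esub>,
     zero = fraction A \<zero>\<^bsub>A\<^esub> \<one>\<^bsub>A\<^esub>,
     add = (\<lambda>P Q. \<Union>(a, b)\<in>P. \<Union>(c, e)\<in>Q.
              fraction A (a \<otimes>\<^bsub>A\<^esub> e \<oplus>\<^bsub>A\<^esub> c \<otimes>\<^bsub>A\<^esub> b) (b \<otimes>\<^bsub>A\<^esub> e))\<rparr>"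

definition to_Frac :: "('r, 'm) ring_scheme \<Rightarrow> 'r \<Rightarrow> ('r \<times> 'r) set" where
  "to_Frac A a = fraction A a \<one>\<^bsub>A\<^esub>"

lemma UN2_const:
  assumes "p \<in> P" "q \<in> Q" and K: "\<And>a b c e. (a, b) \<in> P \<Longrightarrow> (c, e) \<in> Q \<Longrightarrow> K a b c e = F"
  shows "(\<Union>(a, b)\<in>P. \<Union>(c, e)\<in>Q. K a b c e) = F"
proof -
  have inner: "(\<Union>(c, e)\<in>Q. K a b c e) = F" if "(a, b) \<in> P" for a b
  proof -
    have "(\<Union>(c, e)\<in>Q. K a b c e) = (\<Union>y\<in>Q. F)"
      by (rule SUP_cong) (auto simp: K[OF that])
    then show ?thesis using assms(2) by auto
  qed
  have "(\<Union>(a, b)\<in>P. \<Union>(c, e)\<in>Q. K a b c e) = (\<Union>x\<in>P. F)"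
  proof (rule SUP_cong)
    fix x assume "x \<in> P"
    then show "(case x of (a, b) \<Rightarrow> \<Union>(c, e)\<in>Q. K a b c e) = F"
      by (cases x) (simp only: prod.case inner)
  qed simp
  then show ?thesis using assms(1) by auto
qed

context domain begin

lemma equiv_fraction_rel: "equiv (carrier R \<times> (carrier R - {\<zero>})) (fraction_rel R)"
proof (rule equivI)
  show "fraction_rel R \<subseteq> (carrier R \<times> (carrier R - {\<zero>})) \<times> (carrier R \<times> (carrier R - {\<zero>}))"
    by (auto simp: fraction_rel_def)
  show "refl_on (carrier R \<times> (carrier R - {\<zero>})) (fraction_rel R)"
    by (auto simp: fraction_rel_def refl_on_def)
  show "sym (fraction_rel R)" by (auto simp: fraction_rel_def sym_def)
  show "trans (fraction_rel R)"
  proof (rule transI)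
    fix u v w assume "(u, v) \<in> fraction_rel R" "(v, w) \<in> fraction_rel R"
    then obtain a b c e f g where uvw: "u = (a, b)" "v = (c, e)" "w = (f, g)"
      and cl: "a \<in> carrier R" "b \<in> carrier R" "c \<in> carrier R" "e \<in> carrier R"
        "f \<in> carrier R" "g \<in> carrier R" "b \<noteq> \<zero>" "e \<noteq> \<zero>" "g \<noteq> \<zero>"
      and eq: "a \<otimes> e = c \<otimes> b" "c \<otimes> g = f \<otimes> e"
      by (auto simp: fraction_rel_def)
    have "e \<otimes> (a \<otimes> g) = (a \<otimes> e) \<otimes> g" using cl by (simp add: m_ac)
    also have "\<dots> = (c \<otimes> g) \<otimes> b" unfolding eq(1) using cl by (simp add: m_ac)
    also have "\<dots> = e \<otimes> (f \<otimes> b)" unfolding eq(2) using cl by (simp add: m_ac)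
    finally have "a \<otimes> g = f \<otimes> b" using cl m_lcancel by auto
    then show "(u, w) \<in> fraction_rel R" using uvw cl by (auto simp: fraction_rel_def)
  qed
qed

lemma fraction_eq_iff:
  assumes "a \<in> carrier R" "b \<in> carrier R - {\<zero>}" "c \<in> carrier R" "e \<in> carrier R - {\<zero>}"
  shows "fraction R a b = fraction R c e \<longleftrightarrow> a \<otimes> e = c \<otimes> b"
  using eq_equiv_class_iff[OF equiv_fraction_rel, of "(a, b)" "(c, e)"] assms
  by (auto simp: fraction_def fraction_rel_def)

lemma fraction_mult:
  assumes "a \<in> carrier R" "b \<in> carrier R - {\<zero>}" "c \<in> carrier R" "e \<in> carrier R - {\<zero>}"
  shows "fraction R a b \<otimes>\<^bsub>Frac R\<^esub> fraction R c e = fraction R (a \<otimes> c) (b \<otimes> e)"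
proof -
  have rep: "fraction R (a' \<otimes> c') (b' \<otimes> e') = fraction R (a \<otimes> c) (b \<otimes> e)"
    if "(a', b') \<in> fraction R a b" "(c', e') \<in> fraction R c e" for a' b' c' e'
  proof -
    have *: "a' \<in> carrier R" "b' \<in> carrier R" "c' \<in> carrier R" "e' \<in> carrier R"
      "b' \<noteq> \<zero>" "e' \<noteq> \<zero>" "a \<otimes> b' = a' \<otimes> b" "c \<otimes> e' = c' \<otimes> e"
      using that by (auto simp: fraction_def fraction_rel_def)
    have "(a' \<otimes> c') \<otimes> (b \<otimes> e) = (a' \<otimes> b) \<otimes> (c' \<otimes> e)"
      using *(1-4) assms by (simp add: m_ac)
    also have "\<dots> = (a \<otimes> c) \<otimes> (b' \<otimes> e')" unfolding *(7,8)[symmetric] using *(1-4) assms by (simp add: m_ac)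
    finally show ?thesis using * assms by (subst fraction_eq_iff) (auto simp: integral_iff)
  qed
  have mem: "(a, b) \<in> fraction R a b" "(c, e) \<in> fraction R c e"
    using assms by (auto simp: fraction_def fraction_rel_def)
  show ?thesis
    unfolding Frac_def monoid.simps ring.simps
    by (rule UN2_const[where K = "\<lambda>a b c e. fraction R (a \<otimes> c) (b \<otimes> e)", OF mem]) (rule rep)
qed

lemma fraction_add:
  assumes "a \<in> carrier R" "b \<in> carrier R - {\<zero>}" "c \<in> carrier R" "e \<in> carrier R - {\<zero>}"
  shows "fraction R a b \<oplus>\<^bsub>Frac R\<^esub> fraction R c e = fraction R (a \<otimes> e \<oplus> c \<otimes> b) (b \<otimes> e)"
proof -
  have rep: "fraction R (a' \<otimes> e' \<oplus> c' \<otimes> b') (b' \<otimes> e') = fraction R (a \<otimes> e \<oplus> c \<otimes> b) (b \<otimes> e)"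
    if "(a', b') \<in> fraction R a b" "(c', e') \<in> fraction R c e" for a' b' c' e'
  proof -
    have *: "a' \<in> carrier R" "b' \<in> carrier R" "c' \<in> carrier R" "e' \<in> carrier R"
      "b' \<noteq> \<zero>" "e' \<noteq> \<zero>" "a \<otimes> b' = a' \<otimes> b" "c \<otimes> e' = c' \<otimes> e"
      using that by (auto simp: fraction_def fraction_rel_def)
    have "(a' \<otimes> e' \<oplus> c' \<otimes> b') \<otimes> (b \<otimes> e) = (a' \<otimes> b) \<otimes> (e' \<otimes> e) \<oplus> (c' \<otimes> e) \<otimes> (b' \<otimes> b)"
      using *(1-4) assms by (simp add: l_distr r_distr m_ac)
    also have "\<dots> = (a \<otimes> e \<oplus> c \<otimes> b) \<otimes> (b' \<otimes> e')"
      unfolding *(7,8)[symmetric] using *(1-4) assms by (simp add: l_distr r_distr m_ac)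
    finally show ?thesis using * assms by (subst fraction_eq_iff) (auto simp: integral_iff)
  qed
  have mem: "(a, b) \<in> fraction R a b" "(c, e) \<in> fraction R c e"
    using assms by (auto simp: fraction_def fraction_rel_def)
  show ?thesis
    unfolding Frac_def monoid.simps ring.simps
    by (rule UN2_const[where K = "\<lambda>a b c e. fraction R (a \<otimes> e \<oplus> c \<otimes> b) (b \<otimes> e)", OF mem]) (rule rep)
qed

lemma carrier_Frac: "P \<in> carrier (Frac R) \<longleftrightarrow>
    (\<exists>a b. a \<in> carrier R \<and> b \<in> carrier R - {\<zero>} \<and> P = fraction R a b)"
  by (auto simp: Frac_def)

lemma Frac_one: "\<one>\<^bsub>Frac R\<^esub> = fraction R \<one> \<one>" and Frac_zero: "\<zero>\<^bsub>Frac R\<^esub> = fraction R \<zero> \<one>"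
  by (simp_all add: Frac_def)

lemma fraction_closed [intro]:
  "a \<in> carrier R \<Longrightarrow> b \<in> carrier R - {\<zero>} \<Longrightarrow> fraction R a b \<in> carrier (Frac R)"
  by (auto simp: Frac_def)

lemma Frac_cases:
  assumes "P \<in> carrier (Frac R)"
  obtains a b where "a \<in> carrier R" "b \<in> carrier R" "b \<noteq> \<zero>" "P = fraction R a b"
  using assms by (auto simp: Frac_def)

lemma field_Frac: "field (Frac R)"
proof -
  note simps = fraction_mult fraction_add fraction_eq_iff Frac_one Frac_zero integral_iff
  have add_closed: "P \<oplus>\<^bsub>Frac R\<^esub> Q \<in> carrier (Frac R)"
    and mult_closed: "P \<otimes>\<^bsub>Frac R\<^esub> Q \<in> carrier (Frac R)"
    and add_comm: "P \<oplus>\<^bsub>Frac R\<^esub> Q = Q \<oplus>\<^bsub>Frac R\<^esub> P"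
    and mult_comm: "P \<otimes>\<^bsub>Frac R\<^esub> Q = Q \<otimes>\<^bsub>Frac R\<^esub> P"
    if PQ: "P \<in> carrier (Frac R)" "Q \<in> carrier (Frac R)" for P Q
  proof -
    obtain a b where P: "a \<in> carrier R" "b \<in> carrier R" "b \<noteq> \<zero>" "P = fraction R a b"
      using PQ(1) by (rule Frac_cases)
    obtain c e where Q: "c \<in> carrier R" "e \<in> carrier R" "e \<noteq> \<zero>" "Q = fraction R c e"
      using PQ(2) by (rule Frac_cases)
    note * = P Q
    then show "P \<oplus>\<^bsub>Frac R\<^esub> Q \<in> carrier (Frac R)" "P \<otimes>\<^bsub>Frac R\<^esub> Q \<in> carrier (Frac R)"
      by (simp_all add: fraction_mult fraction_add fraction_closed integral_iff)
    show "P \<oplus>\<^bsub>Frac R\<^esub> Q = Q \<oplus>\<^bsub>Frac R\<^esub> P" "P \<otimes>\<^bsub>Frac R\<^esub> Q = Q \<otimes>\<^bsub>Frac R\<^esub> P"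
      using * by (simp_all add: fraction_mult fraction_add m_comm a_comm)
  qed
  have add_assoc: "(P \<oplus>\<^bsub>Frac R\<^esub> Q) \<oplus>\<^bsub>Frac R\<^esub> S = P \<oplus>\<^bsub>Frac R\<^esub> (Q \<oplus>\<^bsub>Frac R\<^esub> S)"
    and mult_assoc: "(P \<otimes>\<^bsub>Frac R\<^esub> Q) \<otimes>\<^bsub>Frac R\<^esub> S = P \<otimes>\<^bsub>Frac R\<^esub> (Q \<otimes>\<^bsub>Frac R\<^esub> S)"
    and distr: "(P \<oplus>\<^bsub>Frac R\<^esub> Q) \<otimes>\<^bsub>Frac R\<^esub> S = P \<otimes>\<^bsub>Frac R\<^esub> S \<oplus>\<^bsub>Frac R\<^esub> Q \<otimes>\<^bsub>Frac R\<^esub> S"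
    if PQ: "P \<in> carrier (Frac R)" "Q \<in> carrier (Frac R)" "S \<in> carrier (Frac R)" for P Q S
  proof -
    obtain a b where P: "a \<in> carrier R" "b \<in> carrier R" "b \<noteq> \<zero>" "P = fraction R a b"
      using PQ(1) by (rule Frac_cases)
    obtain c e where Q: "c \<in> carrier R" "e \<in> carrier R" "e \<noteq> \<zero>" "Q = fraction R c e"
      using PQ(2) by (rule Frac_cases)
    obtain f g where S: "f \<in> carrier R" "g \<in> carrier R" "g \<noteq> \<zero>" "S = fraction R f g"
      using PQ(3) by (rule Frac_cases)
    note * = P Q S
    have dom: "b \<in> carrier R - {\<zero>}" "e \<in> carrier R - {\<zero>}" "g \<in> carrier R - {\<zero>}"
      "b \<otimes> e \<in> carrier R - {\<zero>}" "e \<otimes> g \<in> carrier R - {\<zero>}" "b \<otimes> g \<in> carrier R - {\<zero>}"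
      using * by (simp_all add: integral_iff)
    have cl: "a \<in> carrier R" "b \<in> carrier R" "c \<in> carrier R" "e \<in> carrier R" "f \<in> carrier R" "g \<in> carrier R"
      using * by simp_all
    have "(a \<otimes> e \<oplus> c \<otimes> b) \<otimes> g \<oplus> f \<otimes> (b \<otimes> e) = a \<otimes> (e \<otimes> g) \<oplus> (c \<otimes> g \<oplus> f \<otimes> e) \<otimes> b"
      using cl by algebra
    then show "(P \<oplus>\<^bsub>Frac R\<^esub> Q) \<oplus>\<^bsub>Frac R\<^esub> S = P \<oplus>\<^bsub>Frac R\<^esub> (Q \<oplus>\<^bsub>Frac R\<^esub> S)"
      unfolding *(4,8,12) using dom cl by (simp add: fraction_add m_assoc del: Diff_iff)
    show "(P \<otimes>\<^bsub>Frac R\<^esub> Q) \<otimes>\<^bsub>Frac R\<^esub> S = P \<otimes>\<^bsub>Frac R\<^esub> (Q \<otimes>\<^bsub>Frac R\<^esub> S)"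
      unfolding *(4,8,12) using dom cl by (simp add: fraction_mult m_assoc del: Diff_iff)
    have "((a \<otimes> e \<oplus> c \<otimes> b) \<otimes> f) \<otimes> ((b \<otimes> g) \<otimes> (e \<otimes> g)) =
        ((a \<otimes> f) \<otimes> (e \<otimes> g) \<oplus> (c \<otimes> f) \<otimes> (b \<otimes> g)) \<otimes> ((b \<otimes> e) \<otimes> g)"
      using cl by algebra
    moreover have "b \<otimes> e \<otimes> g \<in> carrier R - {\<zero>}" "(b \<otimes> g) \<otimes> (e \<otimes> g) \<in> carrier R - {\<zero>}"
      using * by (simp_all add: integral_iff)
    ultimately show "(P \<oplus>\<^bsub>Frac R\<^esub> Q) \<otimes>\<^bsub>Frac R\<^esub> S = P \<otimes>\<^bsub>Frac R\<^esub> S \<oplus>\<^bsub>Frac R\<^esub> Q \<otimes>\<^bsub>Frac R\<^esub> S"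
      unfolding *(4,8,12) using dom cl
      by (simp add: fraction_mult fraction_add fraction_eq_iff del: Diff_iff)
  qed
  have cr: "cring (Frac R)"
  proof (rule cringI)
    show "abelian_group (Frac R)"
    proof (rule abelian_groupI)
      fix P assume "P \<in> carrier (Frac R)"
      then obtain a b where P: "a \<in> carrier R" "b \<in> carrier R" "b \<noteq> \<zero>" "P = fraction R a b"
        by (rule Frac_cases)
      then have "fraction R (\<ominus> a) b \<oplus>\<^bsub>Frac R\<^esub> P = \<zero>\<^bsub>Frac R\<^esub>"
        by (simp add: simps l_minus l_neg)
      then show "\<exists>Q\<in>carrier (Frac R). Q \<oplus>\<^bsub>Frac R\<^esub> P = \<zero>\<^bsub>Frac R\<^esub>"
        using P by (intro bexI[of _ "fraction R (\<ominus> a) b"]) auto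
      show "\<zero>\<^bsub>Frac R\<^esub> \<oplus>\<^bsub>Frac R\<^esub> P = P"
        using P by (simp add: simps)
    qed (use add_closed add_comm add_assoc in \<open>auto simp: Frac_zero\<close>)
    show "comm_monoid (Frac R)"
    proof (rule comm_monoidI)
      fix P assume "P \<in> carrier (Frac R)"
      then show "\<one>\<^bsub>Frac R\<^esub> \<otimes>\<^bsub>Frac R\<^esub> P = P"
        by (rule Frac_cases) (simp add: simps)
    qed (use mult_closed mult_comm mult_assoc in \<open>auto simp: Frac_one\<close>)
  qed (rule distr)
  show ?thesis
  proof (rule cring.cring_fieldI2[OF cr])
    show "\<zero>\<^bsub>Frac R\<^esub> \<noteq> \<one>\<^bsub>Frac R\<^esub>" by (simp add: simps)
  next
    fix P assume "P \<in> carrier (Frac R)" and nz: "P \<noteq> \<zero>\<^bsub>Frac R\<^esub>"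
    then obtain a b where P: "a \<in> carrier R" "b \<in> carrier R" "b \<noteq> \<zero>" "P = fraction R a b"
      by (elim Frac_cases)
    moreover from P nz have "a \<noteq> \<zero>" by (auto simp: simps)
    ultimately have "P \<otimes>\<^bsub>Frac R\<^esub> fraction R b a = \<one>\<^bsub>Frac R\<^esub>" "fraction R b a \<in> carrier (Frac R)"
      by (auto simp: simps m_comm)
    then show "\<exists>Q\<in>carrier (Frac R). P \<otimes>\<^bsub>Frac R\<^esub> Q = \<one>\<^bsub>Frac R\<^esub>" by blast
  qed
qed

lemma to_Frac_hom: "to_Frac R \<in> ring_hom R (Frac R)"
proof (rule ring_hom_memI)
  fix x assume "x \<in> carrier R"
  then show "to_Frac R x \<in> carrier (Frac R)"
    unfolding carrier_Frac to_Frac_def by (intro exI[of _ x] exI[of _ \<one>]) simp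
qed (auto simp: to_Frac_def fraction_mult fraction_add Frac_one)

lemma to_Frac_inj: "inj_on (to_Frac R) (carrier R)"
  by (rule inj_onI) (auto simp: to_Frac_def fraction_eq_iff)

end

text \<open>The quotient field of a subring \<open>R\<close> of a domain \<open>A\<close>, as a subfield of that of \<open>A\<close>.\<close>

definition quotient_field :: "('r, 'm) ring_scheme \<Rightarrow> 'r set \<Rightarrow> ('r \<times> 'r) set set" where
  "quotient_field A R = {fraction A a b | a b. a \<in> R \<and> b \<in> R - {\<zero>\<^bsub>A\<^esub>}}"

text \<open>Here \<open>L\<close> is an ambient ring, \<open>R\<close> and \<open>S\<close> are subrings of \<open>L\<close> and \<open>K\<close> is a subfield of \<open>L\<close>.\<close>

definition in_p_root_closure ::
  "nat \<Rightarrow> ('r, 'm) ring_scheme \<Rightarrow> 'r set \<Rightarrow> 'r set \<Rightarrow> bool" where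
  "in_p_root_closure p L R S \<longleftrightarrow> R \<subseteq> S \<and>
     (if p = 0 then R = S else \<forall>s\<in>S. \<exists>m::nat. s [^]\<^bsub>L\<^esub> (p ^ m) \<in> R)"

definition p_root_closure ::
  "nat \<Rightarrow> ('r, 'm) ring_scheme \<Rightarrow> 'r set \<Rightarrow> 'r set \<Rightarrow> 'r set" where
  "p_root_closure p L R K =
     (if p = 0 then R else {s \<in> K. \<exists>m::nat. s [^]\<^bsub>L\<^esub> (p ^ m) \<in> R})"

end

theory Submission
  imports Defs "HOL-Library.Function_Algebras" "Jordan_Normal_Form.Char_Poly"
begin

text \<open>
  The theorem holds for all subgroups \<open>H\<close>. Let \<open>R\<^sub>r\<close> be the algebra generated by the functions \<open>x \<mapsto> f (x B)\<close>
  with \<open>f\<close> an invariant of \<open>n \<times> r\<close> matrices; then \<open>R\<^sub>n\<close> is the polarization algebra.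

  In characteristic \<open>p\<close> one descends from \<open>d\<close> to \<open>n\<close>. For \<open>d > n\<close> let \<open>F\<close> be an invariant of degree \<open>e\<close>, so that
  \<open>R\<^bsub>d-1\<^esub>\<close> contains \<open>F (x A)\<close> for all singular \<open>A\<close>, and let \<open>c (x)\<close> be a polynomial kernel vector of \<open>x\<close>.
  For \<open>Q\<close> a large power of \<open>p\<close>, multiplication by \<open>T = F\<^sup>Q\<close> preserves the \<open>R\<^bsub>d-1\<^esub>\<close>-module \<open>M\<close> spanned by the
  monomials of a large degree in \<open>c\<close>, and \<open>T \<otimes> 1 = 1 \<otimes> T\<close> on \<open>M \<otimes> M\<close>: both follow from
  identities between polynomials in \<open>z\<close>, \<open>w\<close> with coefficients in \<open>R\<^bsub>d-1\<^esub>\<close> on setting \<open>z = c\<close> or \<open>w = c\<close>.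
  For a faithful finitely generated module this forces a power \<open>T\<^bsup>p\<^sup>m\<^esup>\<close> into \<open>R\<^bsub>d-1\<^esub>\<close>.

  In characteristic \<open>0\<close> the identity of \<open>k\<^sup>d\<close>, acting on polynomials of degree \<open>e\<close>, is a linear combination
  of matrices of rank at most \<open>n\<close>.

  If \<open>H \<subseteq> SL\<^sub>n\<close>, maximal minors are invariants, and by Cramer's rule they serve as denominators of vector
  invariants over \<open>R\<^sub>n\<close>. Conversely, \<open>a\<^sup>q = r b\<^sup>q\<close> with polynomials over a perfect field implies that \<open>b\<close> divides
  \<open>a\<close>, and the quotient of invariants is invariant.
\<close>

section \<open>Subrings and ideals\<close>

text \<open>The obstacle: \<open>F (x A)\<close> is known to lie in the lower algebra only for
  constant singular \<open>A\<close>, whereas \<open>F x\<close> needs the identity. If c is a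
  kernel vector of x, the matrix c_j - c e_j^t is singular and multiplies x by c_j, but it varies
  with x. So a variable z stands in for c: the coefficients in z of F(x (z_j - z e_j^t)) lie in the
  lower algebra, and z = c gives c_j^e F. Every monomial of large degree contains some c_j^e; this
  makes M stable. The same device with two variables z, w compares T tensor 1 with 1 tensor T. For F
  itself the two agree only up to nilpotents. Their difference E on c_j^e tensor c_j^e is killed by
  delta^e for every minor delta = z_i w_l - z_l w_i, and for q >= e a power of p Frobenius writes
  E^q through the delta^q, so E^(q+1) = 0. Hence T = F^Q with Q > q. Equality of T tensor 1 and 1
  tensor T means that T acts as a scalar on each fibre of M over a prime, which makes T purely
  inseparable over the lower algebra. In characteristic 0 positivity of a rational scalar product
  takes the place of Frobenius: it provides the orthogonal projection.\<close>

definition is_subring :: "'b::comm_ring_1 set \<Rightarrow> bool" where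
  "is_subring R \<longleftrightarrow> 1 \<in> R \<and> (\<forall>a\<in>R. \<forall>b\<in>R. a - b \<in> R \<and> a * b \<in> R)"

definition is_ideal :: "'b::comm_ring_1 set \<Rightarrow> 'b set \<Rightarrow> bool" where
  "is_ideal R I \<longleftrightarrow> I \<subseteq> R \<and> 0 \<in> I \<and> (\<forall>a\<in>I. \<forall>b\<in>I. a + b \<in> I) \<and> (\<forall>r\<in>R. \<forall>a\<in>I. r * a \<in> I)"

locale subring_set =
  fixes R :: "'b::comm_ring_1 set"
  assumes sub: "is_subring R"
begin

lemma one_closed [intro, simp]: "1 \<in> R" and diff_closed: "a \<in> R \<Longrightarrow> b \<in> R \<Longrightarrow> a - b \<in> R"
  and mult_closed: "a \<in> R \<Longrightarrow> b \<in> R \<Longrightarrow> a * b \<in> R"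
  using sub by (auto simp: is_subring_def)

lemma zero_closed [intro, simp]: "0 \<in> R"
  using diff_closed[of 1 1] by simp

lemma uminus_closed: "a \<in> R \<Longrightarrow> - a \<in> R"
  using diff_closed[of 0 a] by simp

lemma add_closed: "a \<in> R \<Longrightarrow> b \<in> R \<Longrightarrow> a + b \<in> R"
  using diff_closed[of a "- b"] uminus_closed by simp

lemma sum_closed: "(\<And>i. i \<in> I \<Longrightarrow> f i \<in> R) \<Longrightarrow> sum f I \<in> R"
  by (induction I rule: infinite_finite_induct) (auto intro: add_closed)

lemma prod_closed: "(\<And>i. i \<in> I \<Longrightarrow> f i \<in> R) \<Longrightarrow> prod f I \<in> R"
  by (induction I rule: infinite_finite_induct) (auto intro: mult_closed)

lemma power_closed: "a \<in> R \<Longrightarrow> a ^ n \<in> R"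
  by (induction n) (auto intro: mult_closed)

lemma signof_closed: "signof p \<in> R"
  by (cases "evenperm p") (auto simp: sign_def intro: uminus_closed)

lemma det_closed:
  assumes "A \<in> carrier_mat n n" "\<And>i j. i < n \<Longrightarrow> j < n \<Longrightarrow> A $$ (i, j) \<in> R"
  shows "det A \<in> R"
  unfolding det_def'[OF assms(1)]
  by (intro sum_closed mult_closed signof_closed prod_closed) (use assms(2) in \<open>auto simp: permutes_in_image\<close>)

end

locale ideal_set = subring_set R for R :: "'b::comm_ring_1 set" +
  fixes I :: "'b set"
  assumes ideal: "is_ideal R I"
begin

lemma zero_I [intro, simp]: "0 \<in> I" and add_I: "a \<in> I \<Longrightarrow> b \<in> I \<Longrightarrow> a + b \<in> I"
  and mult_I: "r \<in> R \<Longrightarrow> a \<in> I \<Longrightarrow> r * a \<in> I" and I_R: "a \<in> I \<Longrightarrow> a \<in> R"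
  using ideal by (auto simp: is_ideal_def)

lemma mult_I': "r \<in> R \<Longrightarrow> a \<in> I \<Longrightarrow> a * r \<in> I"
  using mult_I[of r a] by (simp add: mult.commute[of a r])

lemma sum_I: "(\<And>i. i \<in> J \<Longrightarrow> f i \<in> I) \<Longrightarrow> sum f J \<in> I"
  by (induction J rule: infinite_finite_induct) (auto intro: add_I)

lemma power_I: "a \<in> I \<Longrightarrow> n > 0 \<Longrightarrow> a ^ n \<in> I"
  using I_R by (cases n) (auto intro: mult_I' power_closed)

lemma mult_cong:
  assumes "a - b \<in> I" "c - d \<in> I" "b \<in> R" "c \<in> R"
  shows "a * c - b * d \<in> I"
proof -
  have "a * c - b * d = (a - b) * c + b * (c - d)" by (simp add: algebra_simps)
  then show ?thesis using add_I[OF mult_I'[OF assms(4,1)] mult_I[OF assms(3,2)]] by simp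
qed

lemma prod_cong:
  assumes "\<And>i. i \<in> J \<Longrightarrow> f i - g i \<in> I" "\<And>i. i \<in> J \<Longrightarrow> f i \<in> R" "\<And>i. i \<in> J \<Longrightarrow> g i \<in> R"
  shows "prod f J - prod g J \<in> I"
  using assms
proof (induction J rule: infinite_finite_induct)
  case (insert x F)
  then show ?case by (auto intro!: mult_cong prod_closed)
qed auto

lemma power_cong:
  assumes "a - b \<in> I" "a \<in> R" "b \<in> R"
  shows "a ^ n - b ^ n \<in> I"
  using prod_cong[of "{..<n}" "\<lambda>_. a" "\<lambda>_. b"] assms by simp

lemma det_cong:
  assumes "A \<in> carrier_mat n n" "B \<in> carrier_mat n n"
    and "\<And>i j. i < n \<Longrightarrow> j < n \<Longrightarrow> A $$ (i, j) - B $$ (i, j) \<in> I"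
    and "\<And>i j. i < n \<Longrightarrow> j < n \<Longrightarrow> A $$ (i, j) \<in> R"
    and "\<And>i j. i < n \<Longrightarrow> j < n \<Longrightarrow> B $$ (i, j) \<in> R"
  shows "det A - det B \<in> I"
proof -
  have "det A - det B = (\<Sum>p | p permutes {0..<n}. signof p *
      ((\<Prod>i = 0..<n. A $$ (i, p i)) - (\<Prod>i = 0..<n. B $$ (i, p i))))"
    unfolding det_def'[OF assms(1)] det_def'[OF assms(2)]
    by (simp add: sum_subtractf algebra_simps)
  also have "\<dots> \<in> I"
    by (intro sum_I mult_I signof_closed prod_cong) (use assms(3-) in \<open>auto simp: permutes_in_image\<close>)
  finally show ?thesis .
qed

end

section \<open>Cayley-Hamilton for faithful modules\<close>

lemma det_annihilates:
  fixes v :: "nat \<Rightarrow> 'b::comm_ring_1"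
  assumes B: "B \<in> carrier_mat n n" and "\<And>i. i < n \<Longrightarrow> (\<Sum>j<n. B $$ (i, j) * v j) = 0" "k < n"
  shows "det B * v k = 0"
proof -
  have "det B * v k = (\<Sum>j<n. (det B \<cdot>\<^sub>m 1\<^sub>m n) $$ (k, j) * v j)"
    using assms(3) by (simp add: if_distrib if_distribR sum.delta cong: if_cong)
  also have "\<dots> = (\<Sum>j<n. (adj_mat B * B) $$ (k, j) * v j)"
    using adj_mat(3)[OF B] by simp
  also have "\<dots> = (\<Sum>j<n. \<Sum>i<n. adj_mat B $$ (k, i) * (B $$ (i, j) * v j))"
    using adj_mat(1)[OF B] B assms(3)
    by (intro sum.cong refl)
      (auto simp: scalar_prod_def sum_distrib_right mult.assoc atLeast0LessThan intro!: sum.cong)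
  also have "\<dots> = (\<Sum>i<n. adj_mat B $$ (k, i) * (\<Sum>j<n. B $$ (i, j) * v j))"
    by (subst sum.swap) (simp add: sum_distrib_left)
  also have "\<dots> = 0" using assms(2) by simp
  finally show ?thesis .
qed

text \<open>Cayley-Hamilton is applied to multiplication by an element on the module spanned by
  \<open>v\<close>; faithfulness turns a determinant that annihilates all \<open>v i\<close> into
  one that vanishes.\<close>

locale faithful_family = subring_set P for P :: "'b::comm_ring_1 set" +
  fixes G :: "'i set" and v :: "'i \<Rightarrow> 'b"
  assumes finG: "finite G"
    and faithful: "s \<in> P \<Longrightarrow> (\<And>i. i \<in> G \<Longrightarrow> s * v i = 0) \<Longrightarrow> s = 0"
begin

lemma det_trick:
  assumes s: "s \<in> P" and \<sigma>: "\<And>i j. i \<in> G \<Longrightarrow> j \<in> G \<Longrightarrow> \<sigma> i j \<in> P"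
    and eq: "\<And>i. i \<in> G \<Longrightarrow> s * v i = (\<Sum>j\<in>G. \<sigma> i j * v j)"
    and h: "bij_betw h {0..<card G} G"
  shows "det (mat (card G) (card G) (\<lambda>(i, j). (if i = j then s else 0) - \<sigma> (h i) (h j))) = 0"
    (is "det ?B = 0")
proof -
  let ?n = "card G"
  have hG: "h i \<in> G" if "i < ?n" for i using h that by (auto simp: bij_betw_def)
  have B: "?B \<in> carrier_mat ?n ?n" by simp
  have row: "(\<Sum>j<?n. ?B $$ (i, j) * v (h j)) = 0" if "i < ?n" for i
  proof -
    have "(\<Sum>j<?n. ?B $$ (i, j) * v (h j)) =
        (\<Sum>j<?n. (if i = j then s else 0) * v (h j)) - (\<Sum>j<?n. \<sigma> (h i) (h j) * v (h j))"
      using that by (simp add: left_diff_distrib sum_subtractf)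
    also have "(\<Sum>j<?n. (if i = j then s else 0) * v (h j)) = s * v (h i)"
      using that by (simp add: if_distrib[of "\<lambda>x. x * _"] sum.delta cong: if_cong)
    also have "(\<Sum>j<?n. \<sigma> (h i) (h j) * v (h j)) = (\<Sum>j\<in>G. \<sigma> (h i) j * v j)"
      using sum.reindex_bij_betw[OF h, of "\<lambda>j. \<sigma> (h i) j * v j"] by (simp add: atLeast0LessThan)
    finally show ?thesis using eq[OF hG[OF that]] by simp
  qed
  have "det ?B * v i = 0" if i: "i \<in> G" for i
  proof -
    obtain k where "k < ?n" "i = h k"
      using h i unfolding bij_betw_def by (metis atLeastLessThan_iff image_iff)
    then show ?thesis using det_annihilates[OF B row] by auto
  qed
  moreover have "det ?B \<in> P"
    by (intro det_closed[OF B]) (auto intro!: diff_closed uminus_closed s \<sigma> hG)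
  ultimately show ?thesis using faithful by blast
qed

text \<open>Modulo \<open>J\<close> the matrix of \<open>det_trick\<close> is the scalar matrix of
  \<open>s\<close>, whose determinant is \<open>s ^ card G\<close>.\<close>

lemma det_trick_ideal:
  assumes "is_subring A" "A \<subseteq> P" "is_ideal A J" "s \<in> A"
    and \<sigma>: "\<And>i j. i \<in> G \<Longrightarrow> j \<in> G \<Longrightarrow> \<sigma> i j \<in> J"
    and eq: "\<And>i. i \<in> G \<Longrightarrow> s * v i = (\<Sum>j\<in>G. \<sigma> i j * v j)"
  shows "s ^ card G \<in> J"
proof -
  interpret A: ideal_set A J using assms by unfold_locales
  let ?n = "card G"
  obtain h where h: "bij_betw h {0..<?n} G"
    using ex_bij_betw_nat_finite[OF finG] by blast
  have hG: "h i \<in> G" if "i < ?n" for i using h that by (auto simp: bij_betw_def)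
  let ?B = "mat ?n ?n (\<lambda>(i, j). (if i = j then s else 0) - \<sigma> (h i) (h j))"
  have "det ?B = 0"
    by (rule det_trick[OF _ _ eq h]) (use assms \<sigma> A.I_R in auto)
  moreover have "det (s \<cdot>\<^sub>m 1\<^sub>m ?n) - det ?B \<in> J"
    by (rule A.det_cong[where n = ?n])
      (use assms \<sigma> hG A.I_R in \<open>auto intro!: A.diff_closed A.uminus_closed\<close>)
  ultimately show ?thesis by simp
qed

lemma det_trick_monic:
  assumes "is_subring A" "A \<subseteq> P" "s \<in> P"
    and \<sigma>: "\<And>i j. i \<in> G \<Longrightarrow> j \<in> G \<Longrightarrow> \<sigma> i j \<in> A"
    and eq: "\<And>i. i \<in> G \<Longrightarrow> s * v i = (\<Sum>j\<in>G. \<sigma> i j * v j)"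
  obtains a where "\<And>i. a i \<in> A" "s ^ card G = (\<Sum>i<card G. a i * s ^ i)"
proof -
  interpret A: subring_set A using assms by unfold_locales
  let ?n = "card G"
  obtain h where h: "bij_betw h {0..<?n} G"
    using ex_bij_betw_nat_finite[OF finG] by blast
  have hG: "h i \<in> G" if "i < ?n" for i using h that by (auto simp: bij_betw_def)
  let ?S = "mat ?n ?n (\<lambda>(i, j). \<sigma> (h i) (h j))"
  let ?B = "mat ?n ?n (\<lambda>(i, j). (if i = j then s else 0) - \<sigma> (h i) (h j))"
  define c where "c = char_poly ?S"
  have S: "?S \<in> carrier_mat ?n ?n" by simp
  have ev: "comm_ring_hom (\<lambda>p. poly p s)" by unfold_locales auto
  have "map_mat (\<lambda>p. poly p s) (char_poly_matrix ?S) = ?B"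
    by (rule eq_matI) (auto simp: char_poly_matrix_def)
  then have "poly c s = det ?B"
    unfolding c_def char_poly_def using comm_ring_hom.hom_det[OF ev, of "char_poly_matrix ?S"] by simp
  also have "det ?B = 0"
    by (rule det_trick[OF _ _ eq h]) (use assms \<sigma> in auto)
  finally have ev0: "poly c s = 0" .
  \<comment> \<open>Polynomials with coefficients in \<open>A\<close> form a subring, so the
    characteristic polynomial, being a determinant over it, has its coefficients in
    \<open>A\<close>.\<close>
  interpret Q: subring_set "{p. \<forall>i. poly.coeff p i \<in> A}"
    by unfold_locales
      (auto simp: is_subring_def coeff_mult coeff_1 intro!: A.diff_closed A.sum_closed A.mult_closed)
  have "c \<in> {p. \<forall>i. poly.coeff p i \<in> A}"
    unfolding c_def char_poly_def
    by (rule Q.det_closed[of _ ?n])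
      (auto simp: char_poly_matrix_def coeff_pCons hG intro!: A.add_closed A.uminus_closed \<sigma> split: nat.splits)
  then have cA: "poly.coeff c i \<in> A" for i by blast
  have deg: "degree c = ?n" "poly.coeff c ?n = 1"
    using degree_monic_char_poly[OF S] by (auto simp: c_def)
  have "0 = (\<Sum>i\<le>?n. poly.coeff c i * s ^ i)"
    using ev0 by (simp add: poly_altdef deg)
  also have "\<dots> = (\<Sum>i<?n. poly.coeff c i * s ^ i) + s ^ ?n"
    by (simp add: lessThan_Suc_atMost[symmetric] deg)
  finally have "s ^ ?n = (\<Sum>i<?n. - poly.coeff c i * s ^ i)"
    by (simp add: sum_negf eq_neg_iff_add_eq_0 add.commute)
  then show thesis using that[of "\<lambda>i. - poly.coeff c i"] cA A.uminus_closed by blast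
qed

end

section \<open>Frobenius and descent of scalars\<close>

lemma freshman:
  fixes x y :: "'b::comm_ring_1" and f :: "'i \<Rightarrow> 'b"
  assumes "prime p" "of_nat p = (0::'b)"
  shows "(x + y) ^ (p ^ m) = x ^ (p ^ m) + y ^ (p ^ m)"
    and "(\<Sum>i\<in>I. f i) ^ (p ^ m) = (\<Sum>i\<in>I. f i ^ (p ^ m))"
    and "(x - y) ^ (p ^ m) = x ^ (p ^ m) - y ^ (p ^ m)"
proof -
  have "CHAR('b) dvd p" using assms by (simp add: of_nat_eq_0_iff_char_dvd)
  moreover have "CHAR('b) \<noteq> 1" using of_nat_CHAR[where 'a = 'b] by (metis of_nat_1 zero_neq_one)
  ultimately have p: "CHAR('b) = p" using assms(1) by (metis prime_nat_iff)
  show a: "(x + y) ^ (p ^ m) = x ^ (p ^ m) + y ^ (p ^ m)" for x y :: 'b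
    by (rule freshmans_dream') (use assms p in auto)
  show "(\<Sum>i\<in>I. f i) ^ (p ^ m) = (\<Sum>i\<in>I. f i ^ (p ^ m))"
    using prime_gt_0_nat[OF assms(1)]
    by (induction I rule: infinite_finite_induct) (simp_all add: a power_0_left)
  show "(x - y) ^ (p ^ m) = x ^ (p ^ m) - y ^ (p ^ m)"
    using a[of "x - y" y] by simp
qed

text \<open>
  With \<open>I = 0\<close> this says that \<open>v\<^sub>i \<mapsto> \<phi> i\<close> defines an \<open>R\<close>-linear functional on \<open>M = \<Sum> R v\<^sub>i\<close>. The assumption
  \<open>bilinear\<close> below says that \<open>T \<otimes> 1\<close> and \<open>1 \<otimes> T\<close> on \<open>M \<otimes> M\<close> agree under all pairs of functionals with
  values in \<open>R/I\<close>.
\<close>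

definition rel_functional :: "'b::comm_ring_1 set \<Rightarrow> 'i set \<Rightarrow> ('i \<Rightarrow> 'b) \<Rightarrow> 'b set \<Rightarrow> ('i \<Rightarrow> 'b) \<Rightarrow> bool" where
  "rel_functional R G v I \<phi> \<longleftrightarrow> (\<forall>i\<in>G. \<phi> i \<in> R) \<and>
     (\<forall>r. (\<forall>i\<in>G. r i \<in> R) \<longrightarrow> (\<Sum>i\<in>G. r i * v i) = 0 \<longrightarrow> (\<Sum>i\<in>G. r i * \<phi> i) \<in> I)"

locale scalar_descent = faithful_family P G v + R: subring_set R
  for P R :: "'b::comm_ring_1 set" and G :: "'i set" and v :: "'i \<Rightarrow> 'b" +
  fixes p :: nat and T :: 'b and \<tau> :: "'i \<Rightarrow> 'i \<Rightarrow> 'b"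
  assumes prime: "prime p" and char: "of_nat p = (0::'b)"
    and RP: "R \<subseteq> P" and TP: "T \<in> P"
    and \<tau>: "i \<in> G \<Longrightarrow> j \<in> G \<Longrightarrow> \<tau> i j \<in> R"
    and Tv: "i \<in> G \<Longrightarrow> T * v i = (\<Sum>j\<in>G. \<tau> i j * v j)"
    and bilinear: "is_ideal R I \<Longrightarrow> rel_functional R G v I \<phi> \<Longrightarrow> rel_functional R G v I \<psi> \<Longrightarrow>
      i \<in> G \<Longrightarrow> l \<in> G \<Longrightarrow>
      (\<Sum>j\<in>G. \<tau> i j * \<phi> j) * \<psi> l - \<phi> i * (\<Sum>j\<in>G. \<tau> l j * \<psi> j) \<in> I"
begin

abbreviation D where "D \<equiv> card G"

text \<open>This is the extended ideal I R[T], and \<open>ext R\<close> is R[T]: higher powers of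
  \<open>T\<close> are reduced by \<open>T_monic\<close>. With only \<open>D\<close> coefficients,
  an element over the union of a chain already lies over one member.\<close>

definition ext :: "'b set \<Rightarrow> 'b set" where
  "ext I = {s. \<exists>a. (\<forall>i. a i \<in> I) \<and> s = (\<Sum>i<D. a i * T ^ i)}"

lemma is_ideal_R: "is_ideal R R"
  by (auto simp: is_ideal_def intro: R.add_closed R.mult_closed)

lemma D_pos: "D > 0"
proof (rule ccontr)
  assume "\<not> D > 0"
  then have "G = {}" using finG by simp
  then have "(1::'b) = 0" using faithful[of 1] by simp
  then show False by simp
qed

lemma extI: "(\<And>i. i < D \<Longrightarrow> a i \<in> I) \<Longrightarrow> 0 \<in> I \<Longrightarrow> (\<Sum>i<D. a i * T ^ i) \<in> ext I"
  unfolding ext_def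
  by (intro CollectI exI[of _ "\<lambda>i. if i < D then a i else 0"]) auto

lemma ext_add:
  assumes "is_ideal R I" "s \<in> ext I" "t \<in> ext I"
  shows "s + t \<in> ext I"
proof -
  obtain a b where "\<forall>i. a i \<in> I" "s = (\<Sum>i<D. a i * T ^ i)" "\<forall>i. b i \<in> I" "t = (\<Sum>i<D. b i * T ^ i)"
    using assms by (auto simp: ext_def)
  then show ?thesis using assms(1) unfolding ext_def
    by (intro CollectI exI[of _ "\<lambda>i. a i + b i"]) (auto simp: algebra_simps sum.distrib is_ideal_def)
qed

lemma ext_scale:
  assumes "is_ideal R I" "s \<in> ext I" "r \<in> R"
  shows "r * s \<in> ext I"
proof -
  obtain a where "\<forall>i. a i \<in> I" "s = (\<Sum>i<D. a i * T ^ i)"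
    using assms by (auto simp: ext_def)
  then show ?thesis using assms(1,3) unfolding ext_def
    by (intro CollectI exI[of _ "\<lambda>i. r * a i"]) (auto simp: sum_distrib_left mult.assoc is_ideal_def)
qed

lemma ext_scale':
  assumes "is_ideal R I" "a \<in> I" "s \<in> ext R"
  shows "a * s \<in> ext I"
proof -
  obtain b where "\<forall>i. b i \<in> R" "s = (\<Sum>i<D. b i * T ^ i)"
    using assms by (auto simp: ext_def)
  moreover from this have "\<forall>i. b i * a \<in> I"
    using assms(1,2) unfolding is_ideal_def by blast
  moreover have "a * (\<Sum>i<D. b i * T ^ i) = (\<Sum>i<D. b i * a * T ^ i)"
    by (simp add: sum_distrib_left mult_ac)
  ultimately show ?thesis unfolding ext_def by (intro CollectI exI[of _ "\<lambda>i. b i * a"]) simp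
qed

lemma ext_zero: "is_ideal R I \<Longrightarrow> 0 \<in> ext I"
  using extI[of "\<lambda>_. 0" I] by (auto simp: is_ideal_def)

lemma ext_sum:
  assumes "is_ideal R I" "\<And>i. i \<in> J \<Longrightarrow> f i \<in> ext I"
  shows "sum f J \<in> ext I"
  using assms(2) by (induction J rule: infinite_finite_induct) (auto intro: ext_add[OF assms(1)] ext_zero[OF assms(1)])

lemma T_monic: "\<exists>a. (\<forall>i. a i \<in> R) \<and> T ^ D = (\<Sum>i<D. a i * T ^ i)"
proof (rule det_trick_monic[OF R.sub RP TP, of \<tau>])
  fix a assume "\<And>i. a i \<in> R" "T ^ D = (\<Sum>i<D. a i * T ^ i)"
  then show ?thesis by blast
qed (erule (1) \<tau>, erule Tv)

lemma ext_T:
  assumes I: "is_ideal R I" and s: "s \<in> ext I"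
  shows "T * s \<in> ext I"
proof -
  obtain a where a: "\<forall>i. a i \<in> I" "s = (\<Sum>i<D. a i * T ^ i)"
    using s by (auto simp: ext_def)
  obtain b where b: "\<And>i. b i \<in> R" "T ^ D = (\<Sum>i<D. b i * T ^ i)" using T_monic by blast
  obtain D' where D': "D = Suc D'" using D_pos by (cases D) auto
  have "T * s = (\<Sum>i<D. a i * T ^ Suc i)"
    by (simp add: a sum_distrib_left algebra_simps)
  also have "\<dots> = (\<Sum>i<D'. a i * T ^ Suc i) + a D' * T ^ D"
    by (simp add: D')
  also have "(\<Sum>i<D'. a i * T ^ Suc i) = (\<Sum>i<D. (case i of 0 \<Rightarrow> 0 | Suc k \<Rightarrow> a k) * T ^ i)"
    unfolding D' by (subst sum.lessThan_Suc_shift) simp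
  also have "\<dots> + a D' * T ^ D \<in> ext I"
  proof (rule ext_add[OF I])
    show "(\<Sum>i<D. (case i of 0 \<Rightarrow> 0 | Suc k \<Rightarrow> a k) * T ^ i) \<in> ext I"
      by (rule extI) (use I a in \<open>auto simp: is_ideal_def split: nat.splits\<close>)
    show "a D' * T ^ D \<in> ext I"
      using a(1) b by (intro ext_scale'[OF I]) (unfold ext_def, blast+)
  qed
  finally show ?thesis .
qed

lemma T_pow_ext: "T ^ i \<in> ext R"
proof (induction i)
  case 0
  have "(\<Sum>i<D. (if i = 0 then 1 else 0) * T ^ i) = 1"
    using D_pos by (simp add: if_distrib[of "\<lambda>x. x * _"] sum.delta cong: if_cong)
  then show ?case using extI[of "\<lambda>i. if i = 0 then 1 else 0" R] by simp
next
  case (Suc i)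
  then show ?case using ext_T[OF is_ideal_R] by simp
qed

lemma ext_T_pow: "is_ideal R I \<Longrightarrow> s \<in> ext I \<Longrightarrow> T ^ i * s \<in> ext I"
  by (induction i) (auto simp: mult.assoc intro: ext_T)

lemma ext_mult:
  assumes I: "is_ideal R I" and "s \<in> ext R" "t \<in> ext I"
  shows "s * t \<in> ext I"
proof -
  obtain a where a: "\<forall>i. a i \<in> R" "s = (\<Sum>i<D. a i * T ^ i)"
    using assms by (auto simp: ext_def)
  have "s * t = (\<Sum>i<D. a i * (T ^ i * t))"
    by (simp add: a sum_distrib_right mult.assoc)
  also have "\<dots> \<in> ext I"
    using a by (intro ext_sum[OF I] ext_scale[OF I] ext_T_pow[OF I] assms) auto
  finally show ?thesis .
qed

lemma R_ext: "R \<subseteq> ext R"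
  using ext_scale[OF is_ideal_R T_pow_ext[of 0]] by auto

lemma I_ext: "is_ideal R I \<Longrightarrow> a \<in> I \<Longrightarrow> a \<in> ext I"
  using ext_scale'[OF _ _ T_pow_ext[of 0]] by auto

lemma ext_subring: "is_subring (ext R)"
proof -
  have "a - b \<in> ext R" if "a \<in> ext R" "b \<in> ext R" for a b
    using ext_add[OF is_ideal_R that(1) ext_scale[OF is_ideal_R that(2), of "-1"]] R.uminus_closed[of 1]
    by simp
  then show ?thesis
    using T_pow_ext[of 0] ext_mult[OF is_ideal_R] by (auto simp: is_subring_def)
qed

lemma ext_P: "ext R \<subseteq> P"
  unfolding ext_def using RP TP by (auto intro!: sum_closed mult_closed power_closed)

lemma ext_ideal:
  assumes "is_ideal R I"
  shows "is_ideal (ext R) (ext I)"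
proof -
  have "ext I \<subseteq> ext R"
  proof
    fix s assume "s \<in> ext I"
    then obtain a where "\<forall>i. a i \<in> I" "s = (\<Sum>i<D. a i * T ^ i)" by (auto simp: ext_def)
    moreover from this have "\<And>i. a i \<in> R" using assms by (auto simp: is_ideal_def)
    ultimately show "s \<in> ext R" using extI[of a R] by simp
  qed
  then show ?thesis unfolding is_ideal_def
    by (intro conjI ballI ext_zero[OF assms]) (auto intro: ext_add[OF assms] ext_mult[OF assms])
qed

text \<open>The failure of the goal modulo the extension of \<open>I\<close>; for
  \<open>I = {0}\<close> it is the negation of \<open>power_in_subring\<close>.\<close>

definition bad :: "'b set \<Rightarrow> bool" where
  "bad I \<longleftrightarrow> is_ideal R I \<and> \<not> (\<exists>m. \<exists>r\<in>R. T ^ (p ^ m) - r \<in> ext I)"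

end

text \<open>
  A maximal bad ideal \<open>M\<close> is prime. Modulo \<open>M\<close> the assumption \<open>bilinear\<close> makes some \<open>a T\<close> with \<open>a \<in> R - M\<close>
  act on \<open>\<Sum> R v\<^sub>i\<close> like an element of \<open>R\<close>. By the determinant trick a power of \<open>T\<close> times an element of
  \<open>R - M\<close> then lies in \<open>R\<close> modulo \<open>M\<close>, which maximality excludes.
\<close>

locale maximal_bad = scalar_descent P R G v p T \<tau>
  for P R :: "'b::comm_ring_1 set" and G :: "'i set" and v p T \<tau> +
  fixes M :: "'b set"
  assumes bad: "bad M" and maximal: "bad X \<Longrightarrow> M \<subseteq> X \<Longrightarrow> X = M"
begin

lemma M: "is_ideal R M"
  using bad by (simp add: bad_def)

sublocale M: ideal_set R M
  using M by unfold_locales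

sublocale E: ideal_set "ext R" "ext M"
  using ext_subring ext_ideal[OF M] by unfold_locales

lemma p_pos: "p ^ m > 0"
  using prime prime_gt_0_nat by simp

text \<open>By maximality M + b R is not bad, and each coefficient of an element of its extension
  splits into a part from \<open>M\<close> and a multiple of \<open>b\<close>.\<close>

lemma extend:
  assumes b: "b \<in> R" "b \<notin> M"
  obtains m r s x where "r \<in> R" "s \<in> ext M" "x \<in> ext R" "T ^ (p ^ m) = r + s + b * x"
proof -
  define X where "X = {a + b * r | a r. a \<in> M \<and> r \<in> R}"
  have "is_ideal R X"
    unfolding is_ideal_def
  proof (intro conjI ballI)
    show "X \<subseteq> R" by (auto simp: X_def intro: R.add_closed[OF M.I_R R.mult_closed[OF b(1)]])
    have "0 + b * 0 \<in> X" unfolding X_def by (intro CollectI exI[of _ 0]) auto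
    then show "0 \<in> X" by simp
    fix x y assume "x \<in> X" "y \<in> X"
    then obtain a r a' r' where *: "x = a + b * r" "y = a' + b * r'" "a \<in> M" "r \<in> R" "a' \<in> M" "r' \<in> R"
      by (auto simp: X_def)
    then have "x + y = (a + a') + b * (r + r')" by (simp add: algebra_simps)
    then show "x + y \<in> X" unfolding X_def using * M.add_I R.add_closed by blast
  next
    fix s x assume "s \<in> R" "x \<in> X"
    then obtain a r where *: "x = a + b * r" "a \<in> M" "r \<in> R"
      by (auto simp: X_def)
    then have "s * x = s * a + b * (s * r)" by (simp add: algebra_simps)
    then show "s * x \<in> X" unfolding X_def using * M.mult_I R.mult_closed \<open>s \<in> R\<close> by blast
  qed
  moreover have "M \<subseteq> X"
  proof
    fix a assume "a \<in> M"
    then have "a + b * 0 \<in> X" unfolding X_def by blast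
    then show "a \<in> X" by simp
  qed
  moreover have "b \<in> X"
    unfolding X_def by (intro CollectI exI[of _ 0] exI[of _ 1]) auto
  ultimately have "\<not> bad X" using maximal[of X] b(2) by auto
  then obtain m r where r: "r \<in> R" "T ^ (p ^ m) - r \<in> ext X"
    using \<open>is_ideal R X\<close> by (auto simp: bad_def)
  then obtain c where c: "\<forall>i. c i \<in> X" "T ^ (p ^ m) - r = (\<Sum>i<D. c i * T ^ i)"
    by (auto simp: ext_def)
  then have "\<forall>i. \<exists>a r. a \<in> M \<and> r \<in> R \<and> c i = a + b * r" unfolding X_def by blast
  then obtain a d where ad: "\<And>i. a i \<in> M" "\<And>i. d i \<in> R" "\<And>i. c i = a i + b * d i" by metis
  define s where "s = (\<Sum>i<D. a i * T ^ i)"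
  define x where "x = (\<Sum>i<D. d i * T ^ i)"
  have s: "s \<in> ext M" and x: "x \<in> ext R" using ad by (auto simp: s_def x_def ext_def)
  have eq: "T ^ (p ^ m) = r + s + b * x"
    using c(2) by (simp add: ad s_def x_def algebra_simps sum.distrib sum_distrib_left)
  show thesis by (rule that[OF r(1) s x eq])
qed

text \<open>If \<open>b\<close> were outside \<open>M\<close>, \<open>extend\<close> would write a
  power of \<open>T\<close> as r + s + b x. A further Frobenius power is additive and by assumption
  puts the term b x into \<open>R\<close> modulo \<open>ext M\<close>, against the badness of
  \<open>M\<close>.\<close>

lemma absorbing:
  assumes b: "b \<in> R" and abs: "\<And>s. s \<in> ext R \<Longrightarrow> \<exists>m. \<exists>r\<in>R. (b * s) ^ (p ^ m) - r \<in> ext M"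
  shows "b \<in> M"
proof (rule ccontr)
  assume "b \<notin> M"
  then obtain m r s x where r: "r \<in> R" and s: "s \<in> ext M" and x: "x \<in> ext R"
    and eq: "T ^ (p ^ m) = r + s + b * x"
    using extend[OF b] by metis
  obtain k r' where r': "r' \<in> R" "(b * x) ^ (p ^ k) - r' \<in> ext M"
    using abs[OF x] by blast
  have "T ^ (p ^ (m + k)) = (r + s + b * x) ^ (p ^ k)"
    by (simp add: power_add power_mult flip: eq)
  also have "\<dots> = r ^ (p ^ k) + s ^ (p ^ k) + (b * x) ^ (p ^ k)"
    by (simp add: freshman(1)[OF prime char])
  finally have "T ^ (p ^ (m + k)) - (r ^ (p ^ k) + r') = s ^ (p ^ k) + ((b * x) ^ (p ^ k) - r')"
    by simp
  also have "\<dots> \<in> ext M"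
    using E.add_I[OF E.power_I[OF s] r'(2)] p_pos by simp
  finally show False
    using bad r r'(1) unfolding bad_def by (meson R.add_closed R.power_closed)
qed

text \<open>For s = sum a_i T^i, Frobenius gives (c s)^q = sum c^(q-1) a_i^q (c T^(q i)), so
  \<open>D\<close> conditions suffice for the hypothesis of \<open>absorbing\<close>.\<close>

lemma absorbing_powers:
  assumes c: "c \<in> R" and \<kappa>: "\<And>i. i < D \<Longrightarrow> \<exists>k\<in>R. c * T ^ (p ^ m * i) - k \<in> ext M"
  shows "c \<in> M"
proof (rule absorbing[OF c])
  fix s assume "s \<in> ext R"
  then obtain a where a: "\<forall>i. a i \<in> R" "s = (\<Sum>i<D. a i * T ^ i)" by (auto simp: ext_def)
  obtain k where k: "\<And>i. i < D \<Longrightarrow> k i \<in> R" "\<And>i. i < D \<Longrightarrow> c * T ^ (p ^ m * i) - k i \<in> ext M"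
    using \<kappa> by metis
  let ?q = "p ^ m"
  define b where "b i = c ^ (?q - 1) * a i ^ ?q" for i
  have b: "b i \<in> R" for i unfolding b_def using c a by (auto intro!: R.mult_closed R.power_closed)
  have cq: "c ^ ?q = c ^ (?q - 1) * c" using power_minus_mult[OF p_pos, of c m] by simp
  have "(c * s) ^ ?q = (\<Sum>i<D. c ^ ?q * a i ^ ?q * T ^ (?q * i))"
    by (simp add: a(2) sum_distrib_left freshman(2)[OF prime char] power_mult_distrib mult.assoc
        mult.commute[of _ ?q] flip: power_mult)
  also have "\<dots> = (\<Sum>i<D. b i * (c * T ^ (?q * i)))"
    unfolding cq b_def by (simp add: mult_ac)
  finally have "(c * s) ^ ?q - (\<Sum>i<D. b i * k i) = (\<Sum>i<D. b i * (c * T ^ (?q * i) - k i))"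
    by (simp add: sum_subtractf right_diff_distrib)
  also have "\<dots> \<in> ext M"
    using b k R_ext by (intro E.sum_I E.mult_I) auto
  finally show "\<exists>m. \<exists>r\<in>R. (c * s) ^ (p ^ m) - r \<in> ext M"
    using b k by (intro exI bexI[of _ "\<Sum>i<D. b i * k i"]) (auto intro!: R.sum_closed R.mult_closed)
qed

text \<open>Multiplication by \<open>a\<close> kills the term b x of \<open>extend\<close> modulo
  \<open>ext M\<close>. Hence \<open>a\<close> times a power of T^q is congruent to \<open>a\<close>
  times a power of r, and \<open>absorbing_powers\<close> applies.\<close>

lemma M_prime:
  assumes a: "a \<in> R" and b: "b \<in> R" "b \<notin> M" and ab: "a * b \<in> M"
  shows "a \<in> M"
proof -
  obtain m r s x where r: "r \<in> R" and s: "s \<in> ext M" and x: "x \<in> ext R"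
    and eq: "T ^ (p ^ m) = r + s + b * x"
    using extend[OF b] by metis
  let ?q = "p ^ m"
  have step: "a * (T ^ ?q - r) \<in> ext M"
  proof -
    have "a * (T ^ ?q - r) = a * s + (a * b) * x" by (simp add: eq algebra_simps)
    then show ?thesis
      using E.add_I[OF ext_scale[OF M s a] ext_scale'[OF M ab x]] by simp
  qed
  have "a * T ^ (?q * i) - a * r ^ i \<in> ext M" for i
  proof (induction i)
    case (Suc i)
    have "a * T ^ (?q * Suc i) - a * r ^ Suc i =
        T ^ ?q * (a * T ^ (?q * i) - a * r ^ i) + r ^ i * (a * (T ^ ?q - r))"
      by (simp add: power_add algebra_simps)
    also have "\<dots> \<in> ext M"
      by (rule E.add_I[OF ext_T_pow[OF M Suc] ext_scale[OF M step R.power_closed[OF r]]])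
    finally show ?case .
  qed simp
  then show ?thesis
    using a r by (intro absorbing_powers[OF a, of m]) (blast intro: R.mult_closed R.power_closed)
qed

lemma one_notin_M: "1 \<notin> M"
proof
  assume "1 \<in> M"
  then have "T ^ (p ^ 0) - 0 \<in> ext M"
    using ext_scale'[OF M _ T_pow_ext[of 1], of 1] by simp
  then show False using bad unfolding bad_def by blast
qed

lemma M_power: "a \<in> R \<Longrightarrow> a ^ k \<in> M \<Longrightarrow> a \<in> M"
proof (induction k)
  case (Suc k)
  show ?case
  proof (cases "a ^ k \<in> M")
    case False
    then show ?thesis using M_prime[of a "a ^ k"] Suc.prems R.power_closed by simp
  qed (use Suc in auto)
qed (use one_notin_M in simp)

lemma M_prod: "finite J \<Longrightarrow> (\<And>j. j \<in> J \<Longrightarrow> r j \<in> R - M) \<Longrightarrow> prod r J \<in> R - M"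
proof (induction J rule: finite_induct)
  case (insert x F)
  then have "prod r F \<in> R - M" "r x \<in> R - M" by auto
  then show ?case using M_prime[of "r x" "prod r F"] insert(1,2) by (auto intro: R.mult_closed)
qed (use one_notin_M in simp)

text \<open>With V the \<open>R\<close>-module spanned by the \<open>v i\<close>, this is M V.
  Below, \<open>indep\<close> is linear independence in V / M V over the domain R / M.\<close>

definition MV :: "'b set" where
  "MV = {u. \<exists>a. (\<forall>i\<in>G. a i \<in> M) \<and> u = (\<Sum>i\<in>G. a i * v i)}"

lemma MV_zero: "0 \<in> MV"
  unfolding MV_def by (intro CollectI exI[of _ "\<lambda>_. 0"]) auto

lemma MV_add: "u \<in> MV \<Longrightarrow> w \<in> MV \<Longrightarrow> u + w \<in> MV"
  unfolding MV_def
proof (elim CollectE exE conjE)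
  fix a b assume *: "\<forall>i\<in>G. a i \<in> M" "u = (\<Sum>i\<in>G. a i * v i)" "\<forall>i\<in>G. b i \<in> M" "w = (\<Sum>i\<in>G. b i * v i)"
  then show "u + w \<in> {u. \<exists>a. (\<forall>i\<in>G. a i \<in> M) \<and> u = (\<Sum>i\<in>G. a i * v i)}"
    by (intro CollectI exI[of _ "\<lambda>i. a i + b i"]) (auto simp: algebra_simps sum.distrib M.add_I)
qed

lemma MV_scale: "u \<in> MV \<Longrightarrow> r \<in> R \<Longrightarrow> r * u \<in> MV"
  unfolding MV_def
proof (elim CollectE exE conjE)
  fix a assume *: "r \<in> R" "\<forall>i\<in>G. a i \<in> M" "u = (\<Sum>i\<in>G. a i * v i)"
  then show "r * u \<in> {u. \<exists>a. (\<forall>i\<in>G. a i \<in> M) \<and> u = (\<Sum>i\<in>G. a i * v i)}"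
    by (intro CollectI exI[of _ "\<lambda>i. r * a i"]) (auto simp: sum_distrib_left mult.assoc M.mult_I)
qed

lemma MV_v:
  assumes "a \<in> M" "j \<in> G"
  shows "a * v j \<in> MV"
proof -
  have "(\<Sum>i\<in>G. (if i = j then a else 0) * v i) = a * v j"
    using finG assms(2) by (simp add: if_distrib[of "\<lambda>x. x * _"] sum.delta cong: if_cong)
  then show ?thesis unfolding MV_def using assms
    by (intro CollectI exI[of _ "\<lambda>i. if i = j then a else 0"]) auto
qed

lemma MV_diff: "u \<in> MV \<Longrightarrow> w \<in> MV \<Longrightarrow> u - w \<in> MV"
  using MV_add[of u "- w"] MV_scale[of w "-1"] R.uminus_closed[of 1] by simp

lemma MV_sum: "(\<And>i. i \<in> J \<Longrightarrow> f i \<in> MV) \<Longrightarrow> sum f J \<in> MV"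
  by (induction J rule: infinite_finite_induct) (auto intro: MV_add MV_zero)

lemma MV_nilpotent:
  assumes s: "s \<in> ext R" and MV: "\<And>i. i \<in> G \<Longrightarrow> s * v i \<in> MV"
  shows "s ^ D \<in> ext M"
proof -
  have "\<forall>i\<in>G. \<exists>a. (\<forall>j\<in>G. a j \<in> M) \<and> s * v i = (\<Sum>j\<in>G. a j * v j)"
    using MV by (auto simp: MV_def)
  then obtain \<sigma> where "\<And>i j. i \<in> G \<Longrightarrow> j \<in> G \<Longrightarrow> \<sigma> i j \<in> M"
    "\<And>i. i \<in> G \<Longrightarrow> s * v i = (\<Sum>j\<in>G. \<sigma> i j * v j)"
    by metis
  then show ?thesis
    using I_ext[OF M] s
    by (intro det_trick_ideal[OF ext_subring ext_P ext_ideal[OF M], of _ \<sigma>]) auto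
qed

definition indep :: "'i set \<Rightarrow> bool" where
  "indep J \<longleftrightarrow> (\<forall>r. (\<forall>i\<in>J. r i \<in> R) \<longrightarrow> (\<Sum>i\<in>J. r i * v i) \<in> MV \<longrightarrow> (\<forall>i\<in>J. r i \<in> M))"

text \<open>A maximal independent set spans V / M V after inverting an element outside
  \<open>M\<close>: maximality gives for each \<open>v j\<close> a relation whose coefficient at
  \<open>v j\<close> is outside \<open>M\<close>, and the product of these coefficients is a common
  denominator.\<close>

lemma basis_mod:
  "\<exists>J r L. J \<subseteq> G \<and> indep J \<and> r \<in> R - M \<and> (\<forall>j\<in>G. \<forall>i\<in>J. L j i \<in> R) \<and>
    (\<forall>j\<in>G. r * v j - (\<Sum>i\<in>J. L j i * v i) \<in> MV)"
proof -
  have "finite {J. J \<subseteq> G \<and> indep J}" "{J. J \<subseteq> G \<and> indep J} \<noteq> {}"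
    using finG by (auto simp: indep_def)
  from finite_has_maximal[OF this]
  obtain J where *: "J \<in> {J. J \<subseteq> G \<and> indep J}"
    "\<forall>K\<in>{J. J \<subseteq> G \<and> indep J}. J \<subseteq> K \<longrightarrow> J = K" by (elim bexE)
  then have J: "J \<subseteq> G" "indep J" by simp_all
  have max: "J = K" if "K \<subseteq> G" "indep K" "J \<subseteq> K" for K
    using * that by simp
  have finJ: "finite J" using J(1) finG finite_subset by blast
  have "\<exists>r l. r \<in> R - M \<and> (\<forall>i\<in>J. l i \<in> R) \<and> r * v j - (\<Sum>i\<in>J. l i * v i) \<in> MV" if j: "j \<in> G" for j
  proof (cases "j \<in> J")
    case True
    have "(\<Sum>i\<in>J. (if i = j then 1 else 0) * v i) = v j"
      using finJ True by (simp add: if_distrib[of "\<lambda>x. x * _"] sum.delta cong: if_cong)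
    then show ?thesis using one_notin_M MV_zero
      by (intro exI[of _ 1] exI[of _ "\<lambda>i. if i = j then 1 else 0"]) auto
  next
    case False
    then have "\<not> indep (insert j J)" using max[of "insert j J"] J(1) j by auto
    then obtain r where r: "\<forall>i\<in>insert j J. r i \<in> R" "(\<Sum>i\<in>insert j J. r i * v i) \<in> MV"
      "\<not> (\<forall>i\<in>insert j J. r i \<in> M)"
      unfolding indep_def not_all not_imp by (elim exE conjE)
    have sum: "r j * v j + (\<Sum>i\<in>J. r i * v i) \<in> MV" using r(2) finJ False by simp
    have "r j \<notin> M"
    proof
      assume rj: "r j \<in> M"
      then have "(\<Sum>i\<in>J. r i * v i) \<in> MV"
        using MV_diff[OF sum MV_v[OF rj j]] by simp
      then have "\<forall>i\<in>J. r i \<in> M"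
        using J(2)[unfolded indep_def, THEN spec, of r] r(1) by simp
      then show False using r(3) rj by simp
    qed
    then have "r j \<in> R - M" "\<forall>i\<in>J. - r i \<in> R" "r j * v j - (\<Sum>i\<in>J. - r i * v i) \<in> MV"
      using r(1) sum by (simp_all add: sum_negf R.uminus_closed)
    then show ?thesis by (intro exI conjI)
  qed
  then obtain r l where r: "\<And>j. j \<in> G \<Longrightarrow> r j \<in> R - M" and l: "\<And>j i. j \<in> G \<Longrightarrow> i \<in> J \<Longrightarrow> l j i \<in> R"
    and rl: "\<And>j. j \<in> G \<Longrightarrow> r j * v j - (\<Sum>i\<in>J. l j i * v i) \<in> MV"
  proof -
    assume *: "\<And>r l. \<lbrakk>\<And>j. j \<in> G \<Longrightarrow> r j \<in> R - M; \<And>j i. j \<in> G \<Longrightarrow> i \<in> J \<Longrightarrow> l j i \<in> R;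
      \<And>j. j \<in> G \<Longrightarrow> r j * v j - (\<Sum>i\<in>J. l j i * v i) \<in> MV\<rbrakk> \<Longrightarrow> thesis"
    assume ex: "\<And>j. j \<in> G \<Longrightarrow> \<exists>r l. r \<in> R - M \<and> (\<forall>i\<in>J. l i \<in> R) \<and> r * v j - (\<Sum>i\<in>J. l i * v i) \<in> MV"
    then have "\<forall>j\<in>G. \<exists>x. fst x \<in> R - M \<and> (\<forall>i\<in>J. snd x i \<in> R) \<and> fst x * v j - (\<Sum>i\<in>J. snd x i * v i) \<in> MV"
      by simp
    from bchoice[OF this] obtain f where "\<forall>j\<in>G. fst (f j) \<in> R - M \<and> (\<forall>i\<in>J. snd (f j) i \<in> R) \<and>
      fst (f j) * v j - (\<Sum>i\<in>J. snd (f j) i * v i) \<in> MV" ..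
    then show thesis by (intro *[of "fst \<circ> f" "snd \<circ> f"]) auto
  qed
  let ?c = "\<lambda>j. prod r (G - {j})"
  have c: "?c j \<in> R" for j using r by (auto intro: R.prod_closed)
  show ?thesis
  proof (intro exI[of _ J] exI[of _ "prod r G"] exI[of _ "\<lambda>j i. ?c j * l j i"] conjI ballI J)
    show "prod r G \<in> R - M" using M_prod[OF finG] r by blast
    fix j assume j: "j \<in> G"
    show "?c j * l j i \<in> R" if "i \<in> J" for i by (rule R.mult_closed[OF c l[OF j that]])
    have "prod r G * v j - (\<Sum>i\<in>J. ?c j * l j i * v i) = ?c j * (r j * v j - (\<Sum>i\<in>J. l j i * v i))"
      unfolding prod.remove[OF finG j, of r] by (simp add: algebra_simps sum_distrib_left)
    then show "prod r G * v j - (\<Sum>i\<in>J. ?c j * l j i * v i) \<in> MV"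
      using MV_scale[OF rl[OF j] c] by simp
  qed
qed

lemma contradiction: False
proof -
  obtain J r L where J: "J \<subseteq> G" "indep J" and r: "r \<in> R - M"
    and lam: "\<And>j i. j \<in> G \<Longrightarrow> i \<in> J \<Longrightarrow> L j i \<in> R"
    and span: "\<And>j. j \<in> G \<Longrightarrow> r * v j - (\<Sum>i\<in>J. L j i * v i) \<in> MV"
    using basis_mod by blast
  have finJ: "finite J" using J(1) finG finite_subset by blast
  have expand: "r * (\<Sum>j\<in>G. s j * v j) - (\<Sum>i\<in>J. (\<Sum>j\<in>G. s j * L j i) * v i) \<in> MV"
    if "\<And>j. j \<in> G \<Longrightarrow> s j \<in> R" for s
  proof -
    have "(\<Sum>i\<in>J. (\<Sum>j\<in>G. s j * L j i) * v i) = (\<Sum>j\<in>G. s j * (\<Sum>i\<in>J. L j i * v i))"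
      by (simp add: sum_distrib_left sum_distrib_right mult.assoc) (rule sum.swap)
    then have "r * (\<Sum>j\<in>G. s j * v j) - (\<Sum>i\<in>J. (\<Sum>j\<in>G. s j * L j i) * v i) =
        (\<Sum>j\<in>G. s j * (r * v j - (\<Sum>i\<in>J. L j i * v i)))"
      by (simp add: sum_distrib_left sum_subtractf algebra_simps)
    then show ?thesis using MV_sum[of G] MV_scale[OF span that] by simp
  qed
  have indepD: "t i \<in> M" if "\<And>i. i \<in> J \<Longrightarrow> t i \<in> R" "(\<Sum>i\<in>J. t i * v i) \<in> MV" "i \<in> J" for t i
    using J(2) that unfolding indep_def by blast
  have lam_sum: "(\<Sum>j\<in>G. s j * L j i) \<in> R" if "\<And>j. j \<in> G \<Longrightarrow> s j \<in> R" "i \<in> J" for s i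
    using that lam by (auto intro!: R.sum_closed R.mult_closed)
  \<comment> \<open>Coordinates with respect to the basis, multiplied by \<open>r\<close>, are
    functionals modulo \<open>M\<close>: \<open>expand\<close> turns a relation among the
    \<open>v j\<close> into one among the basis elements.\<close>
  have functional: "rel_functional R G v M (\<lambda>j. L j i)" if i: "i \<in> J" for i
    unfolding rel_functional_def
  proof (intro conjI ballI allI impI)
    fix s assume s: "\<forall>j\<in>G. s j \<in> R" "(\<Sum>j\<in>G. s j * v j) = 0"
    have "(\<Sum>i\<in>J. (\<Sum>j\<in>G. s j * L j i) * v i) \<in> MV"
      using MV_diff[OF MV_zero expand[of s]] s by simp
    then show "(\<Sum>j\<in>G. s j * L j i) \<in> M"
      using s i by (intro indepD[of "\<lambda>i. \<Sum>j\<in>G. s j * L j i"] lam_sum) auto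
  qed (use lam i in auto)
  have "J \<noteq> {}"
  proof
    assume "J = {}"
    then have "r ^ D \<in> ext M"
      using span r R_ext by (intro MV_nilpotent) auto
    have "r ^ D \<in> M"
    proof (rule absorbing)
      fix s assume "s \<in> ext R"
      then have "(r ^ D * s) ^ (p ^ 0) - 0 \<in> ext M"
        using E.mult_I'[OF _ \<open>r ^ D \<in> ext M\<close>] by simp
      then show "\<exists>m. \<exists>t\<in>R. (r ^ D * s) ^ (p ^ m) - t \<in> ext M" by blast
    qed (use r in \<open>auto intro: R.power_closed\<close>)
    then show False using M_power r by blast
  qed
  then obtain l where l: "l \<in> J" by blast
  \<comment> \<open>\<open>a\<close> is the value of the functional of \<open>l\<close> on
    \<open>v l\<close>, congruent to \<open>r\<close> modulo \<open>M\<close>; \<open>k\<close>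
    below is its value on \<open>T * v l\<close>.\<close>
  define a where "a = L l l"
  have lG: "l \<in> G" using l J(1) by blast
  have aR: "a \<in> R" unfolding a_def using lam l lG by blast
  have "(\<Sum>i\<in>J. ((if i = l then r else 0) - L l i) * v i) = r * v l - (\<Sum>i\<in>J. L l i * v i)"
    using finJ l
    by (simp add: left_diff_distrib sum_subtractf if_distrib[of "\<lambda>x. x * _"] sum.delta cong: if_cong)
  then have "(if l = l then r else 0) - L l l \<in> M"
    using span[OF lG] r lam lG l
    by (intro indepD[of "\<lambda>i. (if i = l then r else 0) - L l i"]) (auto intro!: R.diff_closed R.uminus_closed)
  then have aM: "a \<notin> M"
    using r M.add_I[of "r - a" a] by (auto simp: a_def)
  define k where "k = (\<Sum>j\<in>G. \<tau> l j * L j l)"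
  have kR: "k \<in> R" unfolding k_def using \<tau> lG l by (intro lam_sum) auto
  \<comment> \<open>By \<open>bilinear\<close>, \<open>T\<close> acts on V / M V as the scalar k / a
    once \<open>r\<close> is inverted. So \<open>s\<close>, which clears the denominators, maps V
    into M V.\<close>
  define s where "s = r * (a * T - k)"
  have TE: "T \<in> ext R" using T_pow_ext[of 1] by simp
  have sE: "s \<in> ext R"
    unfolding s_def using r aR kR R_ext TE by (auto intro!: E.mult_closed E.diff_closed)
  have "s * v i \<in> MV" if i: "i \<in> G" for i
  proof -
    define \<mu> where "\<mu> j = a * \<tau> i j - (if j = i then k else 0)" for j
    have \<mu>R: "\<mu> j \<in> R" if "j \<in> G" for j
      unfolding \<mu>_def using aR kR \<tau>[OF i that] by (auto intro!: R.diff_closed R.mult_closed)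
    have "(\<Sum>j\<in>G. \<mu> j * v j) = a * (T * v i) - k * v i"
      using finG i Tv[OF i]
      by (simp add: \<mu>_def left_diff_distrib sum_subtractf sum_distrib_left mult.assoc
          if_distrib[of "\<lambda>x. x * _"] sum.delta cong: if_cong)
    moreover have "s * v i = r * (a * (T * v i) - k * v i)"
      by (simp add: s_def algebra_simps)
    ultimately have s_eq: "s * v i = r * (\<Sum>j\<in>G. \<mu> j * v j)" by simp
    have coeff: "(\<Sum>j\<in>G. \<mu> j * L j i') \<in> M" if i': "i' \<in> J" for i'
    proof -
      have "(\<Sum>j\<in>G. \<mu> j * L j i') = (\<Sum>j\<in>G. \<tau> i j * L j i') * L l l - L i i' * (\<Sum>j\<in>G. \<tau> l j * L j l)"
      proof -
        have "(\<Sum>j\<in>G. \<mu> j * L j i') = (\<Sum>j\<in>G. a * \<tau> i j * L j i') - (\<Sum>j\<in>G. (if j = i then k else 0) * L j i')"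
          by (simp add: \<mu>_def left_diff_distrib sum_subtractf)
        also have "(\<Sum>j\<in>G. a * \<tau> i j * L j i') = a * (\<Sum>j\<in>G. \<tau> i j * L j i')"
          by (simp add: sum_distrib_left mult.assoc)
        also have "(\<Sum>j\<in>G. (if j = i then k else 0) * L j i') = k * L i i'"
          using finG i by (simp add: if_distrib[of "\<lambda>x. x * _"] sum.delta cong: if_cong)
        finally show ?thesis by (simp only: a_def k_def mult.commute)
      qed
      also have "\<dots> \<in> M"
        by (rule bilinear[OF M functional[OF i'] functional[OF l] i lG])
      finally show ?thesis .
    qed
    have "(\<Sum>i'\<in>J. (\<Sum>j\<in>G. \<mu> j * L j i') * v i') \<in> MV"
      using coeff J(1) by (intro MV_sum MV_v) auto
    then show ?thesis
      using MV_add[OF expand[of \<mu>]] \<mu>R by (fastforce simp: s_eq)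
  qed
  then have sD: "s ^ D \<in> ext M" by (rule MV_nilpotent[OF sE])
  \<comment> \<open>An exponent q = p^m that is at least \<open>D\<close> puts s^q into
    \<open>ext M\<close> and is additive on r a T - r k.\<close>
  obtain m where m: "D \<le> p ^ m"
  proof (rule that)
    have "D < 2 ^ D" by (rule less_exp)
    also have "\<dots> \<le> p ^ D" using prime_ge_2_nat[OF prime] by (rule power_mono) simp
    finally show "D \<le> p ^ D" by simp
  qed
  let ?q = "p ^ m"
  have "s ^ ?q = s ^ (?q - D) * s ^ D" using m by (simp flip: power_add)
  then have sq: "s ^ ?q \<in> ext M" using E.mult_I[OF E.power_closed[OF sE] sD] by simp
  define b where "b = (r * a) ^ ?q"
  define c where "c = (r * k) ^ ?q"
  have bR: "b \<in> R" and cR: "c \<in> R"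
    unfolding b_def c_def using r aR kR by (auto intro!: R.power_closed R.mult_closed)
  have "r * a \<notin> M" using M_prime[of a r] aR aM r by (auto simp: mult.commute)
  then have bM: "b \<notin> M"
    unfolding b_def using M_power[of "r * a"] r aR by (blast intro: R.mult_closed)
  have bT: "b * T ^ ?q - c \<in> ext M"
  proof -
    have "s = r * a * T - r * k" by (simp add: s_def algebra_simps)
    then have "s ^ ?q = (r * a * T) ^ ?q - (r * k) ^ ?q"
      by (simp only: freshman(3)[OF prime char])
    then show ?thesis using sq by (simp add: b_def c_def power_mult_distrib mult_ac)
  qed
  \<comment> \<open>The factor b^D clears the denominators of all T^(q i) with i < D at once, as T^q
    is congruent to c / b.\<close>
  have "b ^ D \<in> M"
  proof (rule absorbing_powers[where m = m])
    fix i assume i: "i < D"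
    have bi: "b ^ i * T ^ (?q * i) - c ^ i \<in> ext M"
      using E.power_cong[OF bT, of i] bR cR R_ext TE
      by (auto simp: power_mult_distrib intro!: E.mult_closed E.power_closed simp flip: power_mult)
    have "b ^ D * T ^ (?q * i) - b ^ (D - i) * c ^ i = b ^ (D - i) * (b ^ i * T ^ (?q * i) - c ^ i)"
      using i by (simp add: right_diff_distrib flip: power_add mult.assoc)
    also have "\<dots> \<in> ext M"
      using bi bR by (intro ext_scale[OF M] R.power_closed)
    finally show "\<exists>t\<in>R. b ^ D * T ^ (?q * i) - t \<in> ext M"
      using bR cR by (blast intro: R.mult_closed R.power_closed)
  qed (use bR in \<open>auto intro: R.power_closed\<close>)
  then show False using M_power bR bM by blast
qed

end

context scalar_descent
begin

text \<open>If no power lies in \<open>R\<close>, then \<open>{0}\<close> is bad. Zorn applies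
  because a witness against the union of a chain has \<open>D\<close> coefficients, all in one
  member of the chain.\<close>

theorem power_in_subring: "\<exists>m. T ^ (p ^ m) \<in> R"
proof (rule ccontr)
  assume nin: "\<nexists>m. T ^ (p ^ m) \<in> R"
  have "bad {0}"
    unfolding bad_def
  proof
    show "is_ideal R {0}" by (auto simp: is_ideal_def)
    show "\<not> (\<exists>m. \<exists>r\<in>R. T ^ p ^ m - r \<in> ext {0})"
      using nin by (auto simp: ext_def)
  qed
  have "\<exists>M\<in>Collect bad. \<forall>X\<in>Collect bad. M \<subseteq> X \<longrightarrow> X = M"
  proof (rule subset_Zorn_nonempty)
    show "Collect bad \<noteq> {}" using \<open>bad {0}\<close> by blast
    fix C assume C: "C \<noteq> {}" "subset.chain (Collect bad) C"
    have id: "is_ideal R I" if "I \<in> C" for I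
      using C(2) that by (auto simp: subset.chain_def bad_def)
    have "is_ideal R (\<Union>C)"
      unfolding is_ideal_def
    proof (intro conjI ballI)
      show "\<Union>C \<subseteq> R" "0 \<in> \<Union>C" using id C(1) unfolding is_ideal_def by blast+
      fix a b assume "a \<in> \<Union>C" "b \<in> \<Union>C"
      then obtain I where "I \<in> C" "{a, b} \<subseteq> I"
        using finite_subset_Union_chain[of "{a, b}" C, OF _ _ C] by auto
      then show "a + b \<in> \<Union>C" using id[of I] unfolding is_ideal_def by blast
    next
      fix r a assume "r \<in> R" "a \<in> \<Union>C"
      then show "r * a \<in> \<Union>C" using id unfolding is_ideal_def by blast
    qed
    moreover have False if r: "r \<in> R" and Tr: "T ^ p ^ m - r \<in> ext (\<Union>C)" for m r
    proof -
      obtain a where a: "\<forall>i. a i \<in> \<Union>C" "T ^ p ^ m - r = (\<Sum>i<D. a i * T ^ i)"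
        using Tr by (auto simp: ext_def)
      have "finite (a ` {..<D})" "a ` {..<D} \<subseteq> \<Union>C" using a(1) by auto
      then obtain I where I: "I \<in> C" "a ` {..<D} \<subseteq> I"
        by (rule finite_subset_Union_chain[OF _ _ C])
      then have "T ^ p ^ m - r \<in> ext I"
        unfolding a(2) using id[OF I(1)] by (intro extI) (auto simp: is_ideal_def)
      moreover have "bad I" using C(2) I(1) by (auto simp: subset.chain_def)
      ultimately show False using r by (auto simp: bad_def)
    qed
    ultimately show "\<Union>C \<in> Collect bad" by (auto simp: bad_def)
  qed
  then obtain M where "bad M" "\<And>X. bad X \<Longrightarrow> M \<subseteq> X \<Longrightarrow> X = M" by auto
  then interpret maximal_bad P R G v p T \<tau> M by unfold_locales
  show False by (rule contradiction)
qed

end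

section \<open>Polynomial functions and their coefficients\<close>

definition mon :: "('i \<Rightarrow> 'a::comm_semiring_1) \<Rightarrow> 'i multiset \<Rightarrow> 'a" where
  "mon z \<kappa> = (\<Prod>i\<in>#\<kappa>. z i)"

lemma mon_empty [simp]: "mon z {#} = 1"
  and mon_add_mset [simp]: "mon z (add_mset i \<kappa>) = z i * mon z \<kappa>"
  and mon_union: "mon z (\<kappa> + \<mu>) = mon z \<kappa> * mon z \<mu>"
  by (simp_all add: mon_def)

lemma mon_replicate [simp]: "mon z (replicate_mset n i) = z i ^ n"
  by (induction n) auto

lemma mon_cong: "(\<And>i. i \<in># \<kappa> \<Longrightarrow> z i = z' i) \<Longrightarrow> mon z \<kappa> = mon z' \<kappa>"
  by (induction \<kappa>) auto

lemma mon_scale: "mon (\<lambda>i. t * z i) \<kappa> = t ^ size \<kappa> * mon z \<kappa>"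
  by (induction \<kappa>) (auto simp: mult_ac)

lemma mon_scale_one: "mon (\<lambda>j. if j = i then t * z j else z j) \<kappa> = t ^ count \<kappa> i * mon z \<kappa>"
  by (induction \<kappa>) (auto simp: mult_ac)

section \<open>Recovering coefficients within a space of functions\<close>

definition is_subspace :: "('x \<Rightarrow> 'a::field) set \<Rightarrow> bool" where
  "is_subspace V \<longleftrightarrow> (\<lambda>x. 0) \<in> V \<and> (\<forall>f\<in>V. \<forall>g\<in>V. (\<lambda>x. f x + g x) \<in> V) \<and>
     (\<forall>c. \<forall>f\<in>V. (\<lambda>x. c * f x) \<in> V)"

lemma subspace_zero: "is_subspace V \<Longrightarrow> (\<lambda>x. 0) \<in> V"
  and subspace_add: "is_subspace V \<Longrightarrow> f \<in> V \<Longrightarrow> g \<in> V \<Longrightarrow> (\<lambda>x. f x + g x) \<in> V"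
  and subspace_scale: "is_subspace V \<Longrightarrow> f \<in> V \<Longrightarrow> (\<lambda>x. c * f x) \<in> V"
  by (auto simp: is_subspace_def)

lemma subspace_diff:
  assumes "is_subspace V" "f \<in> V" "g \<in> V"
  shows "(\<lambda>x. f x - g x) \<in> V"
  using subspace_add[OF assms(1,2) subspace_scale[OF assms(1,3), of "-1"]] by simp

lemma subspace_sum:
  assumes "is_subspace V" "\<And>i. i \<in> J \<Longrightarrow> f i \<in> V"
  shows "(\<lambda>x. \<Sum>i\<in>J. f i x) \<in> V"
  using assms(2)
  by (induction J rule: infinite_finite_induct)
    (auto intro: subspace_zero[OF assms(1)] subspace_add[OF assms(1)])

lemma subspace_UNIV: "is_subspace UNIV"
  and subspace_singleton_zero: "is_subspace {\<lambda>x. 0}"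
  by (auto simp: is_subspace_def)

text \<open>Interpolation with one degree bound for all \<open>x\<close>: synthetic division by t -
  t0 lowers the bound, and the quotient still has values in \<open>V\<close> at the points other
  than t0.\<close>

lemma poly_coeff_in_subspace:
  fixes p :: "'x \<Rightarrow> 'a::field poly"
  assumes V: "is_subspace V"
  shows "infinite T \<Longrightarrow> (\<And>x. degree (p x) \<le> D) \<Longrightarrow> (\<And>t. t \<in> T \<Longrightarrow> (\<lambda>x. poly (p x) t) \<in> V) \<Longrightarrow>
    (\<lambda>x. poly.coeff (p x) i) \<in> V"
proof (induction D arbitrary: p T i)
  case 0
  then obtain t where t: "t \<in> T" by fastforce
  have p: "p x = [:poly.coeff (p x) 0:]" for x
    using 0(2)[of x] by (auto elim: degree_eq_zeroE)
  show ?case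
  proof (cases i)
    case 0
    have "poly (p x) t = poly.coeff (p x) 0" for x by (subst p) simp
    then show ?thesis using \<open>t \<in> T\<close> 0 "0.prems"(3)[of t] by simp
  next
    case (Suc k)
    then have "poly.coeff (p x) i = 0" for x using "0.prems"(2)[of x] by (simp add: coeff_eq_0)
    then show ?thesis using subspace_zero[OF V] by simp
  qed
next
  case (Suc D)
  obtain t0 where t0: "t0 \<in> T" using Suc.prems(1) by fastforce
  define q where "q x = synthetic_div (p x) t0" for x
  have pq: "p x = [:-t0, 1:] * q x + [:poly (p x) t0:]" for x
    unfolding q_def by (rule synthetic_div_correct'[symmetric])
  have q: "(\<lambda>x. poly.coeff (q x) i) \<in> V" for i
  proof (rule Suc.IH[of "T - {t0}"])
    show "infinite (T - {t0})" using Suc.prems(1) by simp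
    show "degree (q x) \<le> D" for x
      using Suc.prems(2)[of x] by (simp add: q_def degree_synthetic_div)
    fix t assume t: "t \<in> T - {t0}"
    have "poly (q x) t = inverse (t - t0) * (poly (p x) t - poly (p x) t0)" for x
    proof -
      have "poly (p x) t = (t - t0) * poly (q x) t + poly (p x) t0"
        by (subst pq) (simp add: algebra_simps)
      then show ?thesis using t by (simp add: field_simps)
    qed
    then show "(\<lambda>x. poly (q x) t) \<in> V"
      using t t0 by (auto intro!: subspace_scale[OF V] subspace_diff[OF V] Suc.prems(3))
  qed
  show ?case
  proof (cases i)
    case 0
    have "poly.coeff (p x) i = poly (p x) t0 - t0 * poly.coeff (q x) 0" for x
      unfolding 0 by (subst pq) simp
    then show ?thesis
      using subspace_diff[OF V Suc.prems(3)[OF t0] subspace_scale[OF V q, of t0 0]] by simp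
  next
    case (Suc k)
    have "poly.coeff (p x) i = poly.coeff (q x) k - t0 * poly.coeff (q x) (Suc k)" for x
      unfolding Suc by (subst pq) simp
    then show ?thesis
      using subspace_diff[OF V q[of k] subspace_scale[OF V q, of t0 "Suc k"]] by simp
  qed
qed

lemma power_coeff_in_subspace:
  fixes b :: "'k \<Rightarrow> 'x \<Rightarrow> 'a::field"
  assumes V: "is_subspace V" and T: "infinite T" and fin: "finite K"
    and mem: "\<And>t. t \<in> T \<Longrightarrow> (\<lambda>x. \<Sum>\<kappa>\<in>K. t ^ E \<kappa> * b \<kappa> x) \<in> V"
  shows "(\<lambda>x. \<Sum>\<kappa>\<in>{\<kappa>\<in>K. E \<kappa> = m}. b \<kappa> x) \<in> V"
proof -
  define p where "p x = (\<Sum>\<kappa>\<in>K. Polynomial.monom (b \<kappa> x) (E \<kappa>))" for x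
  have "(\<lambda>x. poly.coeff (p x) m) \<in> V"
  proof (rule poly_coeff_in_subspace[OF V T])
    show "degree (p x) \<le> (\<Sum>\<kappa>\<in>K. E \<kappa>)" for x
      unfolding p_def
    proof (rule degree_sum_le[OF fin])
      fix \<kappa> assume "\<kappa> \<in> K"
      then have "E \<kappa> \<le> (\<Sum>\<kappa>\<in>K. E \<kappa>)" using fin by (simp add: member_le_sum)
      then show "degree (Polynomial.monom (b \<kappa> x) (E \<kappa>)) \<le> (\<Sum>\<kappa>\<in>K. E \<kappa>)"
        using degree_monom_le[of "b \<kappa> x" "E \<kappa>"] by simp
    qed
    show "(\<lambda>x. poly (p x) t) \<in> V" if "t \<in> T" for t
      using mem[OF that] by (simp add: p_def poly_sum poly_monom mult.commute)
  qed
  moreover have "poly.coeff (p x) m = (\<Sum>\<kappa>\<in>{\<kappa>\<in>K. E \<kappa> = m}. b \<kappa> x)" for x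
    using fin by (simp add: p_def coeff_sum sum.inter_filter)
  ultimately show ?thesis by simp
qed

text \<open>Scaling a variable in which two monomials have different degrees separates them.\<close>

lemma coeff_in_subspace:
  fixes a :: "'i multiset \<Rightarrow> 'x \<Rightarrow> 'a::field"
  assumes V: "is_subspace V" and inf: "infinite (UNIV :: 'a set)"
  shows "finite K \<Longrightarrow> (\<And>z. (\<lambda>x. \<Sum>\<kappa>\<in>K. a \<kappa> x * mon z \<kappa>) \<in> V) \<Longrightarrow> \<kappa> \<in> K \<Longrightarrow> a \<kappa> \<in> V"
proof (induction "card K" arbitrary: K rule: less_induct)
  case less
  show ?case
  proof (cases "K = {\<kappa>}")
    case True
    have "mon (\<lambda>_. 1) \<kappa> = (1::'a)" by (induction \<kappa>) auto
    then show ?thesis using less.prems(2)[of "\<lambda>_. 1"] True by simp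
  next
    case False
    then obtain \<mu> where \<mu>: "\<mu> \<in> K" "\<mu> \<noteq> \<kappa>" using less.prems(3) by blast
    then obtain i where i: "count \<mu> i \<noteq> count \<kappa> i" by (auto simp: multiset_eq_iff)
    let ?K = "{\<nu>\<in>K. count \<nu> i = count \<kappa> i}"
    have "card ?K < card K"
      using \<mu> i less.prems(1) by (intro psubset_card_mono) auto
    moreover have "(\<lambda>x. \<Sum>\<nu>\<in>?K. a \<nu> x * mon z \<nu>) \<in> V" for z
    proof (rule power_coeff_in_subspace[OF V inf less.prems(1)])
      fix t :: 'a
      show "(\<lambda>x. \<Sum>\<nu>\<in>K. t ^ count \<nu> i * (a \<nu> x * mon z \<nu>)) \<in> V"
        using less.prems(2)[of "\<lambda>j. if j = i then t * z j else z j"]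
        by (simp add: mon_scale_one mult_ac)
    qed
    ultimately show ?thesis using less.hyps[of ?K] less.prems by simp
  qed
qed

lemma mon_independent:
  fixes a :: "'i multiset \<Rightarrow> 'a::field"
  assumes "infinite (UNIV :: 'a set)" "finite K" "\<And>z. (\<Sum>\<kappa>\<in>K. a \<kappa> * mon z \<kappa>) = 0" "\<kappa> \<in> K"
  shows "a \<kappa> = 0"
  using coeff_in_subspace[OF subspace_singleton_zero assms(1,2), of "\<lambda>\<kappa> (_::unit). a \<kappa>" \<kappa>] assms(3,4)
  by (auto simp: fun_eq_iff)

text \<open>Polynomials in \<open>z\<close> with coefficient functions from \<open>V\<close>. The
  arguments \<open>x\<close> and \<open>z\<close> are kept apart because \<open>z\<close> is later
  specialized to a function of \<open>x\<close>.\<close>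

inductive_set gspan :: "('x \<Rightarrow> 'a::field) set \<Rightarrow> 'i multiset set \<Rightarrow> ('x \<Rightarrow> ('i \<Rightarrow> 'a) \<Rightarrow> 'a) set"
  for V K where
  zero: "(\<lambda>x z. 0) \<in> gspan V K"
| add: "f \<in> gspan V K \<Longrightarrow> g \<in> gspan V K \<Longrightarrow> (\<lambda>x z. f x z + g x z) \<in> gspan V K"
| mono: "v \<in> V \<Longrightarrow> \<kappa> \<in> K \<Longrightarrow> (\<lambda>x z. v x * mon z \<kappa>) \<in> gspan V K"

lemma gspan_sum: "(\<And>i. i \<in> J \<Longrightarrow> f i \<in> gspan V K) \<Longrightarrow> (\<lambda>x z. \<Sum>i\<in>J. f i x z) \<in> gspan V K"
  by (induction J rule: infinite_finite_induct) (auto intro: gspan.intros)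

lemma gspan_repr:
  assumes "f \<in> gspan V K" "is_subspace V" "finite K"
  obtains a where "\<And>\<kappa>. \<kappa> \<in> K \<Longrightarrow> a \<kappa> \<in> V" "f = (\<lambda>x z. \<Sum>\<kappa>\<in>K. a \<kappa> x * mon z \<kappa>)"
proof -
  have "\<exists>a. (\<forall>\<kappa>\<in>K. a \<kappa> \<in> V) \<and> f = (\<lambda>x z. \<Sum>\<kappa>\<in>K. a \<kappa> x * mon z \<kappa>)"
    using assms(1)
  proof (induction f rule: gspan.induct)
    case zero
    then show ?case using subspace_zero[OF assms(2)] by (intro exI[of _ "\<lambda>_ _. 0"]) auto
  next
    case (add f g)
    then obtain a b where "\<forall>\<kappa>\<in>K. a \<kappa> \<in> V" "f = (\<lambda>x z. \<Sum>\<kappa>\<in>K. a \<kappa> x * mon z \<kappa>)"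
      "\<forall>\<kappa>\<in>K. b \<kappa> \<in> V" "g = (\<lambda>x z. \<Sum>\<kappa>\<in>K. b \<kappa> x * mon z \<kappa>)" by blast
    then show ?case
      by (intro exI[of _ "\<lambda>\<kappa> x. a \<kappa> x + b \<kappa> x"])
        (auto simp: algebra_simps sum.distrib intro: subspace_add[OF assms(2)])
  next
    case (mono v \<kappa>)
    have "(\<Sum>\<mu>\<in>K. (if \<mu> = \<kappa> then v else (\<lambda>_. 0)) x * mon z \<mu>) = v x * mon z \<kappa>" for x z
    proof -
      have "(\<Sum>\<mu>\<in>K. (if \<mu> = \<kappa> then v else (\<lambda>_. 0)) x * mon z \<mu>) =
          (\<Sum>\<mu>\<in>K. if \<mu> = \<kappa> then v x * mon z \<kappa> else 0)"
        by (intro sum.cong) auto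
      then show ?thesis using assms(3) mono(2) by simp
    qed
    then show ?case using mono subspace_zero[OF assms(2)]
      by (intro exI[of _ "\<lambda>\<mu>. if \<mu> = \<kappa> then v else (\<lambda>_. 0)"]) auto
  qed
  then show thesis using that by blast
qed

lemma gspanI: "(\<And>\<kappa>. \<kappa> \<in> K \<Longrightarrow> a \<kappa> \<in> V) \<Longrightarrow> (\<lambda>x z. \<Sum>\<kappa>\<in>K. a \<kappa> x * mon z \<kappa>) \<in> gspan V K"
  by (rule gspan_sum) (auto intro: gspan.mono)

text \<open>Constant specializations of \<open>z\<close> determine the coefficients through
  \<open>coeff_in_subspace\<close>. This is how the coefficients of \<open>F\<close> at a singular
  matrix of variables are placed in the lower algebra.\<close>

lemma gspan_coeffs:
  fixes f :: "'x \<Rightarrow> ('i \<Rightarrow> 'a::field) \<Rightarrow> 'a"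
  assumes f: "f \<in> gspan UNIV K" and "finite K" "is_subspace V" "infinite (UNIV :: 'a set)"
    and mem: "\<And>z. (\<lambda>x. f x z) \<in> V"
  shows "f \<in> gspan V K"
proof -
  obtain a where a: "f = (\<lambda>x z. \<Sum>\<kappa>\<in>K. a \<kappa> x * mon z \<kappa>)"
    using gspan_repr[OF f subspace_UNIV assms(2)] by blast
  have "a \<kappa> \<in> V" if "\<kappa> \<in> K" for \<kappa>
    using coeff_in_subspace[OF assms(3,4,2) _ that, of a] mem by (simp add: a)
  then show ?thesis unfolding a by (rule gspanI)
qed

lemma gspan_mult:
  assumes f: "f \<in> gspan V K" and g: "g \<in> gspan W L"
    and VW: "\<And>v w. v \<in> V \<Longrightarrow> w \<in> W \<Longrightarrow> (\<lambda>x. v x * w x) \<in> U"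
    and KL: "\<And>\<kappa> \<mu>. \<kappa> \<in> K \<Longrightarrow> \<mu> \<in> L \<Longrightarrow> \<kappa> + \<mu> \<in> M"
  shows "(\<lambda>x z. f x z * g x z) \<in> gspan U M"
  using f
proof (induction f rule: gspan.induct)
  case zero
  then show ?case by (auto intro: gspan.zero)
next
  case (add f f')
  then show ?case using gspan.add by (fastforce simp: algebra_simps)
next
  case (mono v \<kappa>)
  show ?case using g
  proof (induction g rule: gspan.induct)
    case zero
    then show ?case by (auto intro: gspan.zero)
  next
    case (add g g')
    then show ?case using gspan.add by (fastforce simp: algebra_simps)
  next
    case (mono w \<mu>)
    then show ?case
      using gspan.mono[OF VW KL, of v w \<kappa> \<mu>] \<open>v \<in> V\<close> \<open>\<kappa> \<in> K\<close>
      by (simp add: mon_union mult_ac)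
  qed
qed

lemma gspan_mono: "f \<in> gspan V K \<Longrightarrow> V \<subseteq> W \<Longrightarrow> f \<in> gspan W K"
  by (induction f rule: gspan.induct) (auto intro: gspan.intros)

section \<open>Polynomial functions with prescribed exponents\<close>

inductive_set pspan :: "'i multiset set \<Rightarrow> (('i \<Rightarrow> 'a::field) \<Rightarrow> 'a) set" for K where
  zero: "(\<lambda>z. 0) \<in> pspan K"
| add: "f \<in> pspan K \<Longrightarrow> g \<in> pspan K \<Longrightarrow> (\<lambda>z. f z + g z) \<in> pspan K"
| mono: "\<kappa> \<in> K \<Longrightarrow> (\<lambda>z. c * mon z \<kappa>) \<in> pspan K"

abbreviation pol :: "'i set \<Rightarrow> (('i \<Rightarrow> 'a::field) \<Rightarrow> 'a) set" where
  "pol I \<equiv> pspan {\<kappa>. set_mset \<kappa> \<subseteq> I}"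

abbreviation hpol :: "'i set \<Rightarrow> nat \<Rightarrow> (('i \<Rightarrow> 'a::field) \<Rightarrow> 'a) set" where
  "hpol I e \<equiv> pspan (multisets_of_size I e)"

lemma pspan_scale: "f \<in> pspan K \<Longrightarrow> (\<lambda>z. c * f z) \<in> pspan K"
proof (induction f rule: pspan.induct)
  case (add f g)
  then show ?case using pspan.add by (fastforce simp: algebra_simps)
next
  case (mono \<kappa> b)
  then show ?case using pspan.mono[of \<kappa> K "c * b"] by (simp add: mult_ac)
qed (auto intro: pspan.intros)

lemma pspan_subspace: "is_subspace (pspan K)"
  unfolding is_subspace_def by (auto intro: pspan.intros pspan_scale)

lemma pspan_mult:
  assumes f: "f \<in> pspan K" and g: "g \<in> pspan L" and KL: "\<And>\<kappa> \<mu>. \<kappa> \<in> K \<Longrightarrow> \<mu> \<in> L \<Longrightarrow> \<kappa> + \<mu> \<in> M"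
  shows "(\<lambda>z. f z * g z) \<in> pspan M"
  using f
proof (induction f rule: pspan.induct)
  case zero
  then show ?case by (auto intro: pspan.zero)
next
  case (add f f')
  then show ?case using pspan.add by (fastforce simp: algebra_simps)
next
  case (mono \<kappa> c)
  show ?case using g
  proof (induction g rule: pspan.induct)
    case zero
    then show ?case by (auto intro: pspan.zero)
  next
    case (add g g')
    then show ?case using pspan.add by (fastforce simp: algebra_simps)
  next
    case (mono \<mu> b)
    then show ?case
      using pspan.mono[OF KL, of \<kappa> \<mu> "c * b"] \<open>\<kappa> \<in> K\<close> by (simp add: mon_union mult_ac)
  qed
qed

lemma pspan_subset: "f \<in> pspan K \<Longrightarrow> K \<subseteq> L \<Longrightarrow> f \<in> pspan L"
  by (induction f rule: pspan.induct) (auto intro: pspan.intros)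

lemma pol_const: "(\<lambda>z. c) \<in> pol I"
  using pspan.mono[of "{#}" "{\<kappa>. set_mset \<kappa> \<subseteq> I}" c] by simp

lemma pol_var: "i \<in> I \<Longrightarrow> (\<lambda>z. z i) \<in> pol I"
  using pspan.mono[of "{#i#}" "{\<kappa>. set_mset \<kappa> \<subseteq> I}" 1] by simp

lemma pol_mult: "f \<in> pol I \<Longrightarrow> g \<in> pol I \<Longrightarrow> (\<lambda>z. f z * g z) \<in> pol I"
  by (erule pspan_mult) auto

lemma pol_power: "f \<in> pol I \<Longrightarrow> (\<lambda>z. f z ^ m) \<in> pol I"
  by (induction m) (auto intro: pol_const[of 1] pol_mult)

lemma pol_sum: "(\<And>i. i \<in> J \<Longrightarrow> f i \<in> pol I) \<Longrightarrow> (\<lambda>z. \<Sum>i\<in>J. f i z) \<in> pol I"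
  by (rule subspace_sum[OF pspan_subspace])

lemma pol_prod: "(\<And>i. i \<in> J \<Longrightarrow> f i \<in> pol I) \<Longrightarrow> (\<lambda>z. \<Prod>i\<in>J. f i z) \<in> pol I"
  by (induction J rule: infinite_finite_induct) (auto intro: pol_const[of 1] pol_mult)

lemma pol_diff: "f \<in> pol I \<Longrightarrow> g \<in> pol I \<Longrightarrow> (\<lambda>z. f z - g z) \<in> pol I"
  by (rule subspace_diff[OF pspan_subspace])

lemma pspan_repr:
  assumes "f \<in> pspan K"
  obtains L c where "finite L" "L \<subseteq> K" "f = (\<lambda>z. \<Sum>\<kappa>\<in>L. c \<kappa> * mon z \<kappa>)"
proof -
  have "\<exists>L c. finite L \<and> L \<subseteq> K \<and> f = (\<lambda>z. \<Sum>\<kappa>\<in>L. c \<kappa> * mon z \<kappa>)"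
    using assms
  proof (induction f rule: pspan.induct)
    case zero
    then show ?case by (intro exI[of _ "{}"]) auto
  next
    case (add f g)
    then obtain L c M b where *: "finite L" "L \<subseteq> K" "f = (\<lambda>z. \<Sum>\<kappa>\<in>L. c \<kappa> * mon z \<kappa>)"
      "finite M" "M \<subseteq> K" "g = (\<lambda>z. \<Sum>\<kappa>\<in>M. b \<kappa> * mon z \<kappa>)" by blast
    let ?c = "\<lambda>\<kappa>. (if \<kappa> \<in> L then c \<kappa> else 0) + (if \<kappa> \<in> M then b \<kappa> else 0)"
    have "(\<Sum>\<kappa>\<in>L \<union> M. ?c \<kappa> * mon z \<kappa>) = f z + g z" for z
    proof -
      have "(\<Sum>\<kappa>\<in>L \<union> M. (if \<kappa> \<in> L then c \<kappa> else 0) * mon z \<kappa>) = (\<Sum>\<kappa>\<in>L. c \<kappa> * mon z \<kappa>)"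
        "(\<Sum>\<kappa>\<in>L \<union> M. (if \<kappa> \<in> M then b \<kappa> else 0) * mon z \<kappa>) = (\<Sum>\<kappa>\<in>M. b \<kappa> * mon z \<kappa>)"
        using *(1,4) by (auto intro!: sum.mono_neutral_cong_right)
      then show ?thesis by (simp add: * distrib_right sum.distrib)
    qed
    then show ?case using *(1,2,4,5)
      by (intro exI[of _ "L \<union> M"] exI[of _ ?c]) auto
  next
    case (mono \<kappa> c)
    then show ?case by (intro exI[of _ "{\<kappa>}"] exI[of _ "\<lambda>_. c"]) auto
  qed
  then show thesis using that by blast
qed

lemma pspan_disjoint:
  fixes f :: "('i \<Rightarrow> 'a::field) \<Rightarrow> 'a"
  assumes "infinite (UNIV :: 'a set)" "f \<in> pspan K" "f \<in> pspan L" "K \<inter> L = {}"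
  shows "f = (\<lambda>z. 0)"
proof -
  obtain M c where M: "finite M" "M \<subseteq> K" "f = (\<lambda>z. \<Sum>\<kappa>\<in>M. c \<kappa> * mon z \<kappa>)"
    using pspan_repr[OF assms(2)] .
  obtain N b where N: "finite N" "N \<subseteq> L" "f = (\<lambda>z. \<Sum>\<kappa>\<in>N. b \<kappa> * mon z \<kappa>)"
    using pspan_repr[OF assms(3)] .
  have disj: "M \<inter> N = {}" using M(2) N(2) assms(4) by blast
  have "(\<Sum>\<kappa>\<in>M \<union> N. (if \<kappa> \<in> M then c \<kappa> else - b \<kappa>) * mon z \<kappa>) = 0" for z
  proof -
    have "(\<Sum>\<kappa>\<in>M. (if \<kappa> \<in> M then c \<kappa> else - b \<kappa>) * mon z \<kappa>) = f z" by (simp add: M(3))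
    moreover have "(\<Sum>\<kappa>\<in>N. (if \<kappa> \<in> M then c \<kappa> else - b \<kappa>) * mon z \<kappa>) = (\<Sum>\<kappa>\<in>N. - b \<kappa> * mon z \<kappa>)"
      using disj by (intro sum.cong) auto
    then have "(\<Sum>\<kappa>\<in>N. (if \<kappa> \<in> M then c \<kappa> else - b \<kappa>) * mon z \<kappa>) = - f z"
      by (simp add: N(3) sum_negf)
    ultimately show ?thesis using M(1) N(1) disj by (simp add: sum.union_disjoint)
  qed
  then have "(if \<kappa> \<in> M then c \<kappa> else - b \<kappa>) = 0" if "\<kappa> \<in> M \<union> N" for \<kappa>
    using mon_independent[OF assms(1), of "M \<union> N" "\<lambda>\<kappa>. if \<kappa> \<in> M then c \<kappa> else - b \<kappa>" \<kappa>] M(1) N(1) that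
    by simp
  then have "\<forall>\<kappa>\<in>M. c \<kappa> = 0" by fastforce
  then show ?thesis by (simp add: M(3))
qed

lemma pol_homogeneous_parts:
  assumes "f \<in> pol I"
  obtains D g where "\<And>e. g e \<in> hpol I e" "f = (\<lambda>z. \<Sum>e\<le>D. g e z)"
proof -
  obtain L c where L: "finite L" "L \<subseteq> {\<kappa>. set_mset \<kappa> \<subseteq> I}" "f = (\<lambda>z. \<Sum>\<kappa>\<in>L. c \<kappa> * mon z \<kappa>)"
    using pspan_repr[OF assms] .
  define D where "D = (\<Sum>\<kappa>\<in>L. size \<kappa>)"
  define g where "g e = (\<lambda>z. \<Sum>\<kappa>\<in>{\<kappa>\<in>L. size \<kappa> = e}. c \<kappa> * mon z \<kappa>)" for e
  have "g e \<in> hpol I e" for e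
    unfolding g_def using L(2)
    by (intro subspace_sum[OF pspan_subspace] pspan.mono) (auto simp: multisets_of_size_def)
  moreover have "f z = (\<Sum>e\<le>D. g e z)" for z
  proof -
    have "size ` L \<subseteq> {..D}" using L(1) by (auto simp: D_def intro: member_le_sum)
    then show ?thesis
      unfolding L(3) g_def using sum.group[OF L(1), of "{..D}" size "\<lambda>\<kappa>. c \<kappa> * mon z \<kappa>"] by simp
  qed
  ultimately show thesis using that by blast
qed

text \<open>The family \<open>K\<close> abstracts a grading of exponents, so that one vector of
  variables, two vectors and a matrix of variables are treated alike.\<close>

lemma pspan_subst:
  assumes F: "F \<in> hpol I e" and L: "\<And>i. i \<in> I \<Longrightarrow> (\<lambda>x z. L x z i) \<in> gspan UNIV (K 1)"
    and K: "{#} \<in> K 0" "\<And>a b \<kappa> \<mu>. \<kappa> \<in> K a \<Longrightarrow> \<mu> \<in> K b \<Longrightarrow> \<kappa> + \<mu> \<in> K (a + b)"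
  shows "(\<lambda>x z. F (L x z)) \<in> gspan UNIV (K e)"
  using F
proof (induction F rule: pspan.induct)
  case (mono \<kappa> c)
  then have "set_mset \<kappa> \<subseteq> I" "size \<kappa> = e" by (auto simp: multisets_of_size_def)
  then have "(\<lambda>x z. mon (L x z) \<kappa>) \<in> gspan UNIV (K e)"
  proof (induction \<kappa> arbitrary: e)
    case empty
    then show ?case using gspan.mono[of "\<lambda>_. 1" UNIV "{#}" "K 0"] K(1) by simp
  next
    case (add i \<kappa>)
    then obtain e' where e': "e = Suc e'" "size \<kappa> = e'" by auto
    have "(\<lambda>x z. L x z i * mon (L x z) \<kappa>) \<in> gspan UNIV (K (Suc e'))"
      by (rule gspan_mult[OF L[of i] add.IH[of e']]) (use add.prems e' K(2)[of _ 1 _ e'] in auto)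
    then show ?case using e' by simp
  qed
  from gspan_mult[OF gspan.mono[OF _ K(1), of "\<lambda>_. c" UNIV] this, of UNIV "K e"] K(2)[of _ 0 _ e]
  show ?case by simp
qed (auto intro: gspan.intros)

lemma pol_subst:
  assumes "F \<in> pol I" and L: "\<And>i. i \<in> I \<Longrightarrow> (\<lambda>y. L y i) \<in> pol J"
  shows "(\<lambda>y. F (L y)) \<in> pol J"
  using assms(1)
proof (induction F rule: pspan.induct)
  case (mono \<kappa> c)
  then have "(\<lambda>y. mon (L y) \<kappa>) \<in> pol J"
    using L by (induction \<kappa>) (auto intro: pol_const[of 1] pol_mult)
  then show ?case by (rule pspan_scale)
qed (auto intro: pspan.intros)

lemma pol_cong: "F \<in> pol I \<Longrightarrow> (\<And>i. i \<in> I \<Longrightarrow> z i = z' i) \<Longrightarrow> F z = F z'"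
proof (induction F rule: pspan.induct)
  case (mono \<kappa> c)
  then show ?case using mon_cong[of \<kappa> z z'] by auto
qed auto

lemma hpol_scale: "F \<in> hpol I e \<Longrightarrow> F (\<lambda>i. t * z i) = t ^ e * F z"
  by (induction F rule: pspan.induct) (auto simp: mon_scale multisets_of_size_def algebra_simps)

text \<open>The bound is uniform in \<open>x\<close> and \<open>y\<close>, as
  \<open>poly_coeff_in_subspace\<close> requires.\<close>

lemma pol_line_degree:
  fixes F :: "('i \<Rightarrow> 'a::field) \<Rightarrow> 'a"
  assumes "F \<in> pol I"
  shows "\<exists>D. \<forall>x y. \<exists>p. degree p \<le> D \<and> (\<forall>t. F (\<lambda>i. x i + t * y i) = poly p t)"
  using assms
proof (induction F rule: pspan.induct)
  case zero
  then show ?case by (intro exI[of _ 0] allI) simp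
next
  case (add f g)
  then obtain D E where D: "\<forall>x y. \<exists>p. degree p \<le> D \<and> (\<forall>t. f (\<lambda>i. x i + t * y i) = poly p t)"
    and E: "\<forall>x y. \<exists>p. degree p \<le> E \<and> (\<forall>t. g (\<lambda>i. x i + t * y i) = poly p t)" by blast
  show ?case
  proof (intro exI[of _ "max D E"] allI)
    fix x y
    obtain p q where "degree p \<le> D" "\<forall>t. f (\<lambda>i. x i + t * y i) = poly p t"
      "degree q \<le> E" "\<forall>t. g (\<lambda>i. x i + t * y i) = poly q t" using D E by blast
    then show "\<exists>p. degree p \<le> max D E \<and>
        (\<forall>t. f (\<lambda>i. x i + t * y i) + g (\<lambda>i. x i + t * y i) = poly p t)"
      by (intro exI[of _ "p + q"]) (auto intro: degree_add_le)
  qed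
next
  case (mono \<kappa> c)
  have "\<exists>p. degree p \<le> size \<kappa> \<and> (\<forall>t. mon (\<lambda>i. x i + t * y i) \<kappa> = poly p t)" for x y :: "'i \<Rightarrow> 'a"
  proof (induction \<kappa>)
    case empty
    then show ?case by (intro exI[of _ 1]) simp
  next
    case (add i \<kappa>)
    then obtain p where p: "degree p \<le> size \<kappa>" "\<forall>t. mon (\<lambda>i. x i + t * y i) \<kappa> = poly p t" by blast
    have "degree ([:x i, y i:] * p) \<le> degree [:x i, y i:] + degree p" by (rule degree_mult_le)
    also have "\<dots> \<le> Suc (size \<kappa>)" using p(1) by simp
    finally have "degree ([:x i, y i:] * p) \<le> size (add_mset i \<kappa>)" by simp
    moreover have "\<forall>t. mon (\<lambda>i. x i + t * y i) (add_mset i \<kappa>) = poly ([:x i, y i:] * p) t"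
      using p(2) by (simp add: algebra_simps)
    ultimately show ?case by (intro exI[of _ "[:x i, y i:] * p"] conjI)
  qed
  note mon_line = this
  show ?case
  proof (intro exI[of _ "size \<kappa>"] allI)
    fix x y :: "'i \<Rightarrow> 'a"
    obtain p where p: "degree p \<le> size \<kappa>" "\<forall>t. mon (\<lambda>i. x i + t * y i) \<kappa> = poly p t"
      using mon_line by blast
    then show "\<exists>p. degree p \<le> size \<kappa> \<and> (\<forall>t. c * mon (\<lambda>i. x i + t * y i) \<kappa> = poly p t)"
      using degree_smult_le[of c p] by (intro exI[of _ "smult c p"]) simp
  qed
qed

lemma pol_line: "F \<in> pol I \<Longrightarrow> \<exists>p. \<forall>t. F (\<lambda>i. x i + t * y i) = poly p t"
  using pol_line_degree by blast

text \<open>On the line through \<open>x\<close> and \<open>y\<close> both functions become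
  polynomials in one variable with product zero.\<close>

lemma pol_domain:
  fixes F G :: "('i \<Rightarrow> 'a::field) \<Rightarrow> 'a"
  assumes inf: "infinite (UNIV :: 'a set)" and "F \<in> pol I" "G \<in> pol I"
    and FG: "\<And>z. F z * G z = 0" and x: "F x \<noteq> 0"
  shows "G y = 0"
proof (rule ccontr)
  assume y: "G y \<noteq> 0"
  obtain p where p: "F (\<lambda>i. x i + t * (y i - x i)) = poly p t" for t
    using pol_line[OF assms(2), of x "\<lambda>i. y i - x i"] by blast
  obtain q where q: "G (\<lambda>i. x i + t * (y i - x i)) = poly q t" for t
    using pol_line[OF assms(3), of x "\<lambda>i. y i - x i"] by blast
  have "poly (p * q) t = 0" for t by (simp flip: p q add: FG)
  then have "p * q = 0" using poly_roots_finite[of "p * q"] inf by auto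
  moreover have "poly p 0 \<noteq> 0" using p[of 0] x by simp
  moreover have "poly q 1 \<noteq> 0" using q[of 1] y by simp
  ultimately show False by auto
qed

section \<open>Matrices and invariants\<close>

text \<open>
  An \<open>n \<times> d\<close> matrix is represented by a total function on index pairs; only the entries in
  \<open>box n d\<close> are relevant. Then \<open>k[M\<^bsub>n,d\<^esub>]\<close> is a subring of a pointwise function ring.
\<close>

abbreviation box :: "nat \<Rightarrow> nat \<Rightarrow> (nat \<times> nat) set" where
  "box n d \<equiv> {..<n} \<times> {..<d}"

definition rmul :: "nat \<Rightarrow> (nat \<times> nat \<Rightarrow> 'a) \<Rightarrow> (nat \<times> nat \<Rightarrow> 'a) \<Rightarrow> nat \<times> nat \<Rightarrow> 'a::field" where
  "rmul d A x = (\<lambda>(i, j). \<Sum>t<d. x (i, t) * A (t, j))"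

definition lmul :: "nat \<Rightarrow> (nat \<times> nat \<Rightarrow> 'a) \<Rightarrow> (nat \<times> nat \<Rightarrow> 'a) \<Rightarrow> nat \<times> nat \<Rightarrow> 'a::field" where
  "lmul n h x = (\<lambda>(i, j). \<Sum>l<n. h (i, l) * x (l, j))"

lemma lmul_rmul: "lmul n h (rmul d A x) = rmul d A (lmul n h x)"
  by (auto simp: lmul_def rmul_def fun_eq_iff sum_distrib_left sum_distrib_right mult.assoc
      intro: sum.swap)

lemma rmul_rmul: "rmul e B (rmul d A x) = rmul d (rmul e B A) x"
  by (auto simp: rmul_def fun_eq_iff sum_distrib_left sum_distrib_right mult.assoc intro: sum.swap)

definition invs :: "nat \<Rightarrow> nat \<Rightarrow> (nat \<times> nat \<Rightarrow> 'a) set \<Rightarrow> ((nat \<times> nat \<Rightarrow> 'a::field) \<Rightarrow> 'a) set" where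
  "invs n d H = {F \<in> pol (box n d). \<forall>h\<in>H. \<forall>x. F (lmul n h x) = F x}"

lemma invs_pol: "F \<in> invs n d H \<Longrightarrow> F \<in> pol (box n d)"
  by (simp add: invs_def)

lemma rmul_pol: "F \<in> pol (box n e) \<Longrightarrow> (\<lambda>x. F (rmul d A x)) \<in> pol (box n d)"
  by (erule pol_subst)
    (auto simp: rmul_def intro!: pol_sum pol_mult pol_const pol_var)

lemma invs_rmul: "F \<in> invs n e H \<Longrightarrow> (\<lambda>x. F (rmul d A x)) \<in> invs n d H"
  by (auto simp: invs_def rmul_pol simp flip: lmul_rmul)

lemma invs_subspace: "is_subspace (invs n d H)"
  unfolding is_subspace_def invs_def by (auto intro: pspan.intros pspan_scale)

lemma invs_mult: "F \<in> invs n d H \<Longrightarrow> G \<in> invs n d H \<Longrightarrow> (\<lambda>x. F x * G x) \<in> invs n d H"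
  by (auto simp: invs_def intro: pol_mult)

lemma invs_const: "(\<lambda>x. c) \<in> invs n d H"
  by (auto simp: invs_def intro: pol_const)

text \<open>Scaling is right multiplication by a scalar matrix and therefore preserves invariance;
  the powers of the scalar separate the degrees.\<close>

lemma invs_homogeneous_parts:
  fixes F :: "(nat \<times> nat \<Rightarrow> 'a::field) \<Rightarrow> 'a"
  assumes "F \<in> invs n d H" "infinite (UNIV :: 'a set)"
  obtains D g where "\<And>e. e \<le> D \<Longrightarrow> g e \<in> invs n d H \<inter> hpol (box n d) e" "F = (\<lambda>z. \<Sum>e\<le>D. g e z)"
proof -
  obtain D g where g: "\<And>e. g e \<in> hpol (box n d) e" "F = (\<lambda>z. \<Sum>e\<le>D. g e z)"
    by (rule pol_homogeneous_parts[OF invs_pol[OF assms(1)]]) (erule that)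
  have "g e \<in> invs n d H" if "e \<le> D" for e
  proof -
    have "(\<lambda>x. \<Sum>e\<in>{e'\<in>{..D}. e' = e}. g e x) \<in> invs n d H"
    proof (rule power_coeff_in_subspace[OF invs_subspace assms(2)])
      fix t :: 'a
      have "(\<Sum>e\<le>D. t ^ e * g e x) = F (rmul d (\<lambda>(i, j). if i = j then t else 0) x)" for x
      proof -
        have "F (rmul d (\<lambda>(i, j). if i = j then t else 0) x) = F (\<lambda>i. t * x i)"
          by (rule pol_cong[OF invs_pol[OF assms(1)]])
            (auto simp: rmul_def if_distrib[of "\<lambda>a. _ * a"] sum.delta mult.commute cong: if_cong)
        then show ?thesis by (simp add: g(2) hpol_scale[OF g(1)])
      qed
      then show "(\<lambda>x. \<Sum>e\<le>D. t ^ e * g e x) \<in> invs n d H"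
        using invs_rmul[OF assms(1)] by simp
    qed simp
    moreover have "{e'\<in>{..D}. e' = e} = {e}" using that by auto
    ultimately show ?thesis by simp
  qed
  then show thesis using g by (intro that[of D g]) auto
qed

section \<open>Generated algebras and matrices of smaller rank\<close>

inductive_set falg :: "('x \<Rightarrow> 'a::field) set \<Rightarrow> ('x \<Rightarrow> 'a) set" for G where
  const: "(\<lambda>x. c) \<in> falg G"
| incl: "f \<in> G \<Longrightarrow> f \<in> falg G"
| add: "f \<in> falg G \<Longrightarrow> g \<in> falg G \<Longrightarrow> (\<lambda>x. f x + g x) \<in> falg G"
| mult: "f \<in> falg G \<Longrightarrow> g \<in> falg G \<Longrightarrow> (\<lambda>x. f x * g x) \<in> falg G"

lemma falg_scale: "f \<in> falg G \<Longrightarrow> (\<lambda>x. c * f x) \<in> falg G"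
  using falg.mult[OF falg.const] .

lemma falg_subspace: "is_subspace (falg G)"
  unfolding is_subspace_def by (auto intro: falg.intros falg_scale)

lemma falg_subring: "is_subring (falg G)"
  unfolding is_subring_def
proof (intro conjI ballI)
  show "1 \<in> falg G" using falg.const[of 1 G] by (simp add: one_fun_def)
  fix f g assume "f \<in> falg G" "g \<in> falg G"
  then show "f - g \<in> falg G" "f * g \<in> falg G"
    using subspace_diff[OF falg_subspace] falg.mult by (auto simp: fun_diff_def times_fun_def)
qed

lemma falg_power: "f \<in> falg G \<Longrightarrow> (\<lambda>x. f x ^ m) \<in> falg G"
  by (induction m) (auto intro: falg.intros)

lemma falg_sum: "(\<And>i. i \<in> J \<Longrightarrow> f i \<in> falg G) \<Longrightarrow> (\<lambda>x. \<Sum>i\<in>J. f i x) \<in> falg G"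
  by (rule subspace_sum[OF falg_subspace])

lemma pol_subring: "is_subring (pol I :: (('i \<Rightarrow> 'a::field) \<Rightarrow> 'a) set)"
  unfolding is_subring_def
proof (intro conjI ballI)
  show "1 \<in> (pol I :: (('i \<Rightarrow> 'a) \<Rightarrow> 'a) set)" using pol_const[of 1 I] by (simp add: one_fun_def)
  fix f g :: "('i \<Rightarrow> 'a) \<Rightarrow> 'a" assume "f \<in> pol I" "g \<in> pol I"
  then show "f - g \<in> pol I" "f * g \<in> pol I"
    using pol_diff pol_mult by (auto simp: fun_diff_def times_fun_def)
qed

definition gens :: "nat \<Rightarrow> nat \<Rightarrow> nat \<Rightarrow> (nat \<times> nat \<Rightarrow> 'a) set \<Rightarrow> ((nat \<times> nat \<Rightarrow> 'a::field) \<Rightarrow> 'a) set" where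
  "gens n d r H = {\<lambda>x. f (rmul d B x) | f B. f \<in> invs n r H}"

lemma falg_gens_invs: "F \<in> falg (gens n d r H) \<Longrightarrow> F \<in> invs n d H"
proof (induction F rule: falg.induct)
  case (incl f)
  then show ?case by (auto simp: gens_def intro: invs_rmul)
qed (auto intro: invs_const invs_mult subspace_add[OF invs_subspace])

lemma falg_gens_rmul: "F \<in> falg (gens n e r H) \<Longrightarrow> (\<lambda>x. F (rmul d B x)) \<in> falg (gens n d r H)"
proof (induction F rule: falg.induct)
  case (incl f)
  then obtain g A where "f = (\<lambda>x. g (rmul e A x))" "g \<in> invs n r H" by (auto simp: gens_def)
  then have "(\<lambda>x. f (rmul d B x)) \<in> gens n d r H"
    by (auto simp: gens_def rmul_rmul)
  then show ?case by (rule falg.incl)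
qed (auto intro: falg.intros)

lemma sum_skip:
  fixes g :: "nat \<Rightarrow> 'a::comm_monoid_add"
  assumes "m < Suc d"
  shows "(\<Sum>s<d. g (if s < m then s else Suc s)) = sum g ({..<Suc d} - {m})"
proof (rule sum.reindex_bij_betw[of "\<lambda>s. if s < m then s else Suc s" "{..<d}" "{..<Suc d} - {m}" g])
  show "bij_betw (\<lambda>s. if s < m then s else Suc s) {..<d} ({..<Suc d} - {m})"
    by (rule bij_betwI[of _ _ _ "\<lambda>s. if s < m then s else s - 1"]) (use assms in \<open>auto split: if_splits\<close>)
qed

text \<open>A singular \<open>d \<times> d\<close> matrix is a product of a \<open>d \<times> (d-1)\<close> and a \<open>(d-1) \<times> d\<close> matrix.\<close>

lemma singular_in_falg:
  assumes G: "G \<in> invs n d H" and m: "m < d" "y m \<noteq> 0"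
    and ker: "\<And>t. t < d \<Longrightarrow> (\<Sum>s<d. A (t, s) * y s) = 0"
  shows "(\<lambda>x. G (rmul d A x)) \<in> falg (gens n d (d - 1) H)"
proof -
  obtain d' where d: "d = Suc d'" using m by (cases d) auto
  define ins where "ins s = (if s < m then s else Suc s)" for s
  have skip: "(\<Sum>s<d'. g (ins s)) = sum g ({..<d} - {m})" for g :: "nat \<Rightarrow> 'a"
    using sum_skip[of m d' g] m by (simp add: ins_def d)
  \<comment> \<open>Column \<open>m\<close> of \<open>A\<close> is the combination of the other
    columns with coefficients -y_s / y_m: \<open>B\<close> keeps the others, and \<open>C\<close>
    restores all of them.\<close>
  define B where "B = (\<lambda>(t, s). A (t, ins s))"
  define C where "C = (\<lambda>(s', s). if s = m then - (y (ins s') / y m) else if s = ins s' then 1 else 0)"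
  have BC: "rmul d' C B (t, s) = A (t, s)" if "t < d" "s < d" for t s
  proof (cases "s = m")
    case True
    have "rmul d' C B (t, s) = - (\<Sum>s'<d'. A (t, ins s') * y (ins s')) / y m"
      by (simp add: rmul_def B_def C_def True sum_negf sum_divide_distrib)
    also have "(\<Sum>s'<d'. A (t, ins s') * y (ins s')) = - (A (t, m) * y m)"
      unfolding skip[of "\<lambda>s. A (t, s) * y s"] using ker[OF that(1)] sum.remove[of "{..<d}" m "\<lambda>s. A (t, s) * y s"] m
      by (simp add: eq_neg_iff_add_eq_0 add.commute)
    finally show ?thesis using m True by simp
  next
    case False
    have "rmul d' C B (t, s) = (\<Sum>s'<d'. A (t, ins s') * (if s = ins s' then 1 else 0))"
      by (simp add: rmul_def B_def C_def False)
    also have "\<dots> = (\<Sum>s'\<in>{..<d} - {m}. A (t, s') * (if s = s' then 1 else 0))"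
      by (rule skip)
    also have "\<dots> = A (t, s)"
      using False that by (simp add: if_distrib[of "\<lambda>a. _ * a"] cong: if_cong)
    finally show ?thesis .
  qed
  have "(\<lambda>x. G (rmul d A x)) = (\<lambda>x. G (rmul d' C (rmul d B x)))"
  proof
    fix x
    show "G (rmul d A x) = G (rmul d' C (rmul d B x))"
      unfolding rmul_rmul
      by (rule pol_cong[OF invs_pol[OF G]]) (auto simp: BC rmul_def[of d])
  qed
  also have "\<dots> \<in> gens n d (d - 1) H"
    unfolding gens_def using invs_rmul[OF G, of d' C] by (auto simp: d)
  finally show ?thesis by (rule falg.incl)
qed

text \<open>The first n + 1 columns of \<open>x\<close> and a zero row form a square matrix. Its
  cofactors along that row do not involve the row and are orthogonal to the rows of
  \<open>x\<close>; the remaining coordinates are 0. At the identity pattern the last cofactor is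
  1.\<close>

lemma kernel_polynomials:
  assumes "n < d"
  obtains c :: "nat \<Rightarrow> (nat \<times> nat \<Rightarrow> 'a::field) \<Rightarrow> 'a" and j x where "\<And>j. c j \<in> pol (box n d)"
    "\<And>i x. i < n \<Longrightarrow> (\<Sum>j<d. x (i, j) * c j x) = 0" "j < d" "c j x \<noteq> 0"
proof -
  define Y :: "(nat \<times> nat \<Rightarrow> 'a) \<Rightarrow> 'a mat"
    where "Y x = mat (Suc n) (Suc n) (\<lambda>(i, j). if i < n then x (i, j) else 0)" for x
  have Y: "Y x \<in> carrier_mat (Suc n) (Suc n)" for x by (simp add: Y_def)
  define c where "c j x = (if j \<le> n then cofactor (Y x) n j else 0)" for j x
  have "c j \<in> pol (box n d)" for j
  proof (cases "j \<le> n")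
    case True
    have del: "mat_delete (Y x) n j \<in> carrier_mat n n" for x
      using mat_delete_carrier[OF Y[of x]] by simp
    have perm: "p i < n" if "p permutes {0..<n}" "i < n" for p i
      using permutes_in_image[OF that(1), of i] that(2) by simp
    have "c j = (\<lambda>x. (- 1) ^ (n + j) * det (mat_delete (Y x) n j))"
      using True by (auto simp: c_def cofactor_def)
    also have "\<dots> = (\<lambda>x. (- 1) ^ (n + j) * (\<Sum>p\<in>{p. p permutes {0..<n}}.
        signof p * (\<Prod>i = 0..<n. mat_delete (Y x) n j $$ (i, p i))))"
      by (simp add: det_def'[OF del])
    also have "\<dots> = (\<lambda>x. (- 1) ^ (n + j) * (\<Sum>p\<in>{p. p permutes {0..<n}}.
        signof p * (\<Prod>i = 0..<n. x (i, if p i < j then p i else Suc (p i)))))"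
      by (intro ext arg_cong2[of _ _ _ _ "(*)"] sum.cong prod.cong refl)
        (use perm in \<open>auto simp: mat_delete_def Y_def less_SucI\<close>)
    also have "\<dots> \<in> pol (box n d)"
      using perm assms
      by (intro pol_mult pol_const pol_sum pol_prod pol_var) (force dest: perm)+
    finally show ?thesis .
  qed (auto simp: c_def[abs_def] intro: pspan.zero)
  moreover have "(\<Sum>j<d. x (i, j) * c j x) = 0" if "i < n" for i x
  proof -
    have "(\<Sum>j<d. x (i, j) * c j x) = (\<Sum>j<Suc n. x (i, j) * c j x)"
      using assms by (intro sum.mono_neutral_right) (auto simp: c_def)
    also have "\<dots> = (\<Sum>j<Suc n. Y x $$ (i, j) * adj_mat (Y x) $$ (j, n))"
      using that Y[of x] by (intro sum.cong) (auto simp: c_def Y_def adj_mat_def)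
    also have "\<dots> = (Y x * adj_mat (Y x)) $$ (i, n)"
      using that Y[of x] adj_mat(1)[OF Y[of x]] by (auto simp: scalar_prod_def atLeast0LessThan)
    also have "\<dots> = 0" using that adj_mat(2)[OF Y[of x]] by simp
    finally show ?thesis .
  qed
  moreover have "c n (\<lambda>(i, j). if i = j then 1 else 0) = 1"
  proof -
    have "mat_delete (Y (\<lambda>(i, j). if i = j then 1 else 0)) n n = 1\<^sub>m n"
      by (rule eq_matI) (auto simp: mat_delete_def Y_def)
    then show ?thesis by (simp add: c_def cofactor_def)
  qed
  ultimately show thesis using assms that[of c n "\<lambda>(i, j). if i = j then 1 else 0"] by simp
qed

section \<open>Pure inseparability of the polarization algebra\<close>

lemma mon_image: "mon z (image_mset f \<kappa>) = mon (\<lambda>i. z (f i)) \<kappa>"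
  by (induction \<kappa>) auto

abbreviation mexp :: "nat \<Rightarrow> nat \<Rightarrow> nat multiset set" where
  "mexp d m \<equiv> multisets_of_size {..<d} m"

text \<open>Exponents in two groups \<open>Inl i\<close> and \<open>Inr i\<close> (\<open>i < d\<close>) of variables, with both degrees \<open>m\<close>.\<close>

definition pair_exp :: "nat multiset \<times> nat multiset \<Rightarrow> (nat + nat) multiset" where
  "pair_exp = (\<lambda>(\<gamma>, \<mu>). image_mset Inl \<gamma> + image_mset Inr \<mu>)"

abbreviation mexp2 :: "nat \<Rightarrow> nat \<Rightarrow> (nat + nat) multiset set" where
  "mexp2 d m \<equiv> pair_exp ` (mexp d m \<times> mexp d m)"

lemma mexp_finite [simp]: "finite (mexp d m)"
  by (rule finite_multisets_of_size) simp

lemma mon_pair_exp: "mon (case_sum z w) (pair_exp (\<gamma>, \<mu>)) = mon z \<gamma> * mon w \<mu>"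
  by (simp add: pair_exp_def mon_union mon_image)

lemma inj_pair_exp: "inj_on pair_exp A"
proof (rule inj_onI)
  fix a b assume eq: "pair_exp a = pair_exp b"
  obtain \<gamma> \<mu> \<gamma>' \<mu>' where ab: "a = (\<gamma>, \<mu>)" "b = (\<gamma>', \<mu>')" by (cases a, cases b)
  have l: "image_mset projl (filter_mset isl (pair_exp (\<gamma>, \<mu>))) = \<gamma>"
    "image_mset projr (filter_mset (\<lambda>i. \<not> isl i) (pair_exp (\<gamma>, \<mu>))) = \<mu>"
    for \<gamma> \<mu> :: "nat multiset"
    by (simp_all add: pair_exp_def filter_mset_image_mset multiset.map_comp comp_def)
  show "a = b" using eq l unfolding ab by metis
qed

lemma mexp_add: "\<kappa> \<in> mexp d a \<Longrightarrow> \<mu> \<in> mexp d b \<Longrightarrow> \<kappa> + \<mu> \<in> mexp d (a + b)"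
  by (auto simp: multisets_of_size_def)

lemma mexp2_add: "\<kappa> \<in> mexp2 d a \<Longrightarrow> \<mu> \<in> mexp2 d b \<Longrightarrow> \<kappa> + \<mu> \<in> mexp2 d (a + b)"
proof (elim imageE)
  fix s t assume *: "\<kappa> = pair_exp s" "s \<in> mexp d a \<times> mexp d a" "\<mu> = pair_exp t" "t \<in> mexp d b \<times> mexp d b"
  then have "\<kappa> + \<mu> = pair_exp (fst s + fst t, snd s + snd t)"
    by (auto simp: pair_exp_def split: prod.splits)
  moreover have "(fst s + fst t, snd s + snd t) \<in> mexp d (a + b) \<times> mexp d (a + b)"
    using * by (auto intro: mexp_add)
  ultimately show ?thesis by blast
qed

lemma mexp_empty: "{#} \<in> mexp d 0" and mexp2_empty: "{#} \<in> mexp2 d 0"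
proof -
  show *: "{#} \<in> mexp d 0" for d by simp
  have "{#} = pair_exp ({#}, {#})" by (simp add: pair_exp_def)
  then show "{#} \<in> mexp2 d 0" using * by blast
qed

section \<open>Forms over the lower algebra and their values at the kernel vector\<close>

locale descent_step =
  fixes n d e p :: nat and H :: "(nat \<times> nat \<Rightarrow> 'a::field) set" and F :: "(nat \<times> nat \<Rightarrow> 'a) \<Rightarrow> 'a"
    and c :: "nat \<Rightarrow> (nat \<times> nat \<Rightarrow> 'a) \<Rightarrow> 'a"
  assumes infinite: "infinite (UNIV :: 'a set)" and prime: "prime p" and char: "of_nat p = (0 :: 'a)"
    and F_inv: "F \<in> invs n d H" and F_hom: "F \<in> hpol (box n d) e"
    and c_pol: "c j \<in> pol (box n d)"
    and c_ker: "i < n \<Longrightarrow> (\<Sum>j<d. x (i, j) * c j x) = 0"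
    and c_nonzero: "\<exists>j<d. \<exists>x. c j x \<noteq> 0"
begin

abbreviation R where "R \<equiv> falg (gens n d (d - Suc 0) H)"

lemma d_pos: "d > 0"
  using c_nonzero by auto

lemma p_pos: "p ^ m > 0"
  using prime prime_gt_0_nat by simp

lemma fresh: "(x + y) ^ (p ^ m) = x ^ (p ^ m) + y ^ (p ^ m)"
    "(\<Sum>i\<in>I. f i) ^ (p ^ m) = (\<Sum>i\<in>I. f i ^ (p ^ m))"
    "(x - y) ^ (p ^ m) = x ^ (p ^ m) - y ^ (p ^ m)" for x y :: 'a and f :: "'k \<Rightarrow> 'a"
  by (rule freshman[OF prime char])+

lemma R_one: "(\<lambda>x. 1) \<in> R"
  by (rule falg.const)

lemma R_invs: "f \<in> R \<Longrightarrow> f \<in> invs n d H"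
  by (rule falg_gens_invs)

lemma R_kernel:
  assumes "m < d" "y m \<noteq> 0" "\<And>t. t < d \<Longrightarrow> (\<Sum>s<d. A (t, s) * y s) = 0"
  shows "(\<lambda>x. F (rmul d A x)) \<in> R"
  using singular_in_falg[OF F_inv assms] by simp

text \<open>In the applications \<open>y\<close> is a vector of variables. Where it vanishes the
  matrix vanishes too, and any vector serves as kernel vector.\<close>

lemma R_kernel':
  assumes "\<And>t. t < d \<Longrightarrow> (\<Sum>s<d. A (t, s) * y s) = 0"
    and "(\<And>s. s < d \<Longrightarrow> y s = 0) \<Longrightarrow> (\<And>t s. t < d \<Longrightarrow> s < d \<Longrightarrow> A (t, s) = 0)"
  shows "(\<lambda>x. F (rmul d A x)) \<in> R"
proof (cases "\<exists>m<d. y m \<noteq> 0")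
  case True
  then show ?thesis using R_kernel assms(1) by blast
next
  case False
  then have "A (t, s) = 0" if "t < d" "s < d" for t s using assms(2) that by blast
  then show ?thesis using d_pos by (intro R_kernel[of 0 "\<lambda>_. 1"]) auto
qed

text \<open>Forms over \<open>R\<close> of degree \<open>m\<close> in each of two vectors z and w,
  addressed by \<open>Inl\<close> and \<open>Inr\<close>; \<open>Z m\<close> is the analogue for one
  vector.\<close>

abbreviation B :: "nat \<Rightarrow> ((nat \<times> nat \<Rightarrow> 'a) \<Rightarrow> (nat + nat \<Rightarrow> 'a) \<Rightarrow> 'a) set" where
  "B m \<equiv> gspan R (mexp2 d m)"

abbreviation Z :: "nat \<Rightarrow> ((nat \<times> nat \<Rightarrow> 'a) \<Rightarrow> (nat \<Rightarrow> 'a) \<Rightarrow> 'a) set" where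
  "Z m \<equiv> gspan R (mexp d m)"

lemma R_mult: "v \<in> R \<Longrightarrow> w \<in> R \<Longrightarrow> (\<lambda>x. v x * w x) \<in> R"
  by (rule falg.mult)

lemma Z_mult: "f \<in> Z a \<Longrightarrow> g \<in> Z b \<Longrightarrow> (\<lambda>x z. f x z * g x z) \<in> Z (a + b)"
  by (rule gspan_mult[OF _ _ R_mult mexp_add])

lemma B_mult: "f \<in> B a \<Longrightarrow> g \<in> B b \<Longrightarrow> (\<lambda>x z. f x z * g x z) \<in> B (a + b)"
  by (rule gspan_mult[OF _ _ R_mult mexp2_add])

lemma Z_const: "r \<in> R \<Longrightarrow> (\<lambda>x z. r x) \<in> Z 0"
  using gspan.mono[OF _ mexp_empty, of r R] by simp

lemma B_const: "r \<in> R \<Longrightarrow> (\<lambda>x z. r x) \<in> B 0"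
  using gspan.mono[OF _ mexp2_empty, of r R] by simp

lemma Z_power: "f \<in> Z a \<Longrightarrow> (\<lambda>x z. f x z ^ k) \<in> Z (a * k)"
  by (induction k) (use Z_const[OF R_one] Z_mult in auto)

lemma B_power: "f \<in> B a \<Longrightarrow> (\<lambda>x z. f x z ^ k) \<in> B (a * k)"
  by (induction k) (use B_const[OF R_one] B_mult in auto)

lemma B_scale: "f \<in> B m \<Longrightarrow> (\<lambda>x u. a * f x u) \<in> B m"
  using B_mult[OF B_const[OF falg.const]] by fastforce

lemma B_diff: "f \<in> B m \<Longrightarrow> g \<in> B m \<Longrightarrow> (\<lambda>x u. f x u - g x u) \<in> B m"
  using gspan.add[of f R _ "\<lambda>x u. - 1 * g x u"] B_scale[of g m "-1"] by simp

lemma Z_var: "i < d \<Longrightarrow> (\<lambda>x z. z i) \<in> Z 1"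
  using gspan.mono[of "\<lambda>_. 1" R "{#i#}" "mexp d 1"] R_one
  by (simp add: multisets_of_size_def)

lemma Z_mon: "\<gamma> \<in> mexp d m \<Longrightarrow> (\<lambda>x z. mon z \<gamma>) \<in> Z m"
  using gspan.mono[of "\<lambda>_. 1" R \<gamma> "mexp d m"] R_one by simp

lemma Z_Z_B:
  assumes f: "f \<in> Z m" and g: "g \<in> Z m"
  shows "(\<lambda>x u. f x (u \<circ> Inl) * g x (u \<circ> Inr)) \<in> B m"
  using f
proof (induction f rule: gspan.induct)
  case zero
  then show ?case by (auto intro: gspan.zero)
next
  case (add f f')
  then show ?case using gspan.add by (fastforce simp: algebra_simps)
next
  case (mono v \<gamma>)
  show ?case using g
  proof (induction g rule: gspan.induct)
    case zero
    then show ?case by (auto intro: gspan.zero)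
  next
    case (add g g')
    then show ?case using gspan.add by (fastforce simp: algebra_simps)
  next
    case (mono w \<mu>)
    have "mon u (pair_exp (\<gamma>, \<mu>)) = mon (u \<circ> Inl) \<gamma> * mon (u \<circ> Inr) \<mu>" for u :: "nat + nat \<Rightarrow> 'a"
      by (simp add: pair_exp_def mon_union mon_image comp_def)
    then show ?case
      using gspan.mono[OF R_mult[of v w], of "pair_exp (\<gamma>, \<mu>)" "mexp2 d m"]
        mono \<open>v \<in> R\<close> \<open>\<gamma> \<in> mexp d m\<close>
      by (simp add: mult_ac comp_def)
  qed
qed

lemma B_var2: "i < d \<Longrightarrow> l < d \<Longrightarrow> (\<lambda>x u. u (Inl i) * u (Inr l)) \<in> B 1"
  using Z_Z_B[OF Z_var Z_var, of i l] by (simp add: comp_def)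

definition \<delta> :: "nat \<Rightarrow> nat \<Rightarrow> (nat + nat \<Rightarrow> 'a) \<Rightarrow> 'a" where
  "\<delta> i l u = u (Inl i) * u (Inr l) - u (Inl l) * u (Inr i)"

lemma B_\<delta>: "i < d \<Longrightarrow> l < d \<Longrightarrow> (\<lambda>x u. \<delta> i l u) \<in> B 1"
  unfolding \<delta>_def by (intro B_diff B_var2)

lemma F_cong: "(\<And>i j. i < n \<Longrightarrow> j < d \<Longrightarrow> x (i, j) = y (i, j)) \<Longrightarrow> F x = F y"
  by (rule pol_cong[OF invs_pol[OF F_inv]]) auto

text \<open>\<open>F\<close> at the matrix z_j - z e_j^t. As z is a kernel vector of it, the
  coefficients are in \<open>R\<close>; the value at \<open>c\<close> is found in
  \<open>\<Theta>_c\<close>.\<close>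

definition \<Theta> :: "nat \<Rightarrow> (nat \<times> nat \<Rightarrow> 'a) \<Rightarrow> (nat \<Rightarrow> 'a) \<Rightarrow> 'a" where
  "\<Theta> j x z = F (rmul d (\<lambda>(t, s). (if t = s then z j else 0) - (if s = j then z t else 0)) x)"

lemma gspan_const_mult: "f \<in> gspan UNIV K \<Longrightarrow> (\<lambda>x z. r x * f x z) \<in> gspan UNIV K"
  using gspan_mult[OF gspan.mono[of r UNIV "{#}" "{{#}}"], of f UNIV K UNIV K] by simp

lemma gspan_diff: "f \<in> gspan UNIV K \<Longrightarrow> g \<in> gspan UNIV K \<Longrightarrow> (\<lambda>x z. f x z - g x z) \<in> gspan UNIV K"
  using gspan.add[of f UNIV K "\<lambda>x z. -1 * g x z"] gspan_const_mult[of g K "\<lambda>_. -1"] by simp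

lemma F_subst:
  assumes "\<And>t s. t < d \<Longrightarrow> s < d \<Longrightarrow> (\<lambda>(_::nat \<times> nat \<Rightarrow> 'a) u. A u (t, s)) \<in> gspan UNIV (K 1)"
    and "{#} \<in> K 0" "\<And>a b \<kappa> \<mu>. \<kappa> \<in> K a \<Longrightarrow> \<mu> \<in> K b \<Longrightarrow> \<kappa> + \<mu> \<in> K (a + b)"
    and "finite (K e)" "\<And>u. (\<lambda>x. F (rmul d (A u) x)) \<in> R"
  shows "(\<lambda>x u. F (rmul d (A u) x)) \<in> gspan R (K e)"
proof (rule gspan_coeffs[OF _ assms(4) falg_subspace infinite assms(5)])
  show "(\<lambda>x u. F (rmul d (A u) x)) \<in> gspan UNIV (K e)"
  proof (rule pspan_subst[OF F_hom _ assms(2,3)])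
    fix i assume "i \<in> box n d"
    then show "(\<lambda>x u. rmul d (A u) x i) \<in> gspan UNIV (K 1)"
      using assms(1) by (auto simp: rmul_def intro!: gspan_sum gspan_const_mult)
  qed
qed

lemma \<Theta>_Z:
  assumes "j < d"
  shows "\<Theta> j \<in> Z e"
  unfolding \<Theta>_def[abs_def]
proof (rule F_subst)
  fix t s assume ts: "t < d" "s < d"
  have var: "(\<lambda>(_::nat \<times> nat \<Rightarrow> 'a) (z::nat \<Rightarrow> 'a). if P then z i else 0) \<in> gspan UNIV (mexp d 1)" if "i < d" for P i
    by (cases P) (use gspan_mono[OF Z_var[OF that], of UNIV] in \<open>auto intro: gspan.zero\<close>)
  show "(\<lambda>(_::nat \<times> nat \<Rightarrow> 'a) (z::nat \<Rightarrow> 'a). (case (t, s) of (t, s) \<Rightarrow> (if t = s then z j else 0) - (if s = j then z t else 0)))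
      \<in> gspan UNIV (mexp d 1)"
    unfolding prod.case using assms ts by (intro gspan_diff var)
next
  fix z :: "nat \<Rightarrow> 'a"
  show "(\<lambda>x. F (rmul d (\<lambda>(t, s). (if t = s then z j else 0) - (if s = j then z t else 0)) x)) \<in> R"
    by (rule R_kernel'[of _ z])
      (use assms in \<open>auto simp: left_diff_distrib sum_subtractf if_distrib[of "\<lambda>a. a * _"] cong: if_cong\<close>)
qed (use mexp_add mexp_empty in auto)

lemma \<Theta>_c:
  assumes "j < d"
  shows "\<Theta> j x (\<lambda>i. c i x) = c j x ^ e * F x"
proof -
  have "\<Theta> j x (\<lambda>i. c i x) = F (\<lambda>i. c j x * x i)"
    unfolding \<Theta>_def
  proof (rule F_cong)
    fix i s assume i: "i < n" "s < d"
    have "(\<Sum>t<d. x (i, t) * ((if t = s then c j x else 0) - (if s = j then c t x else 0))) =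
        (\<Sum>t<d. x (i, t) * (if t = s then c j x else 0)) - (if s = j then \<Sum>t<d. x (i, t) * c t x else 0)"
      by (auto simp: right_diff_distrib sum_subtractf intro!: sum.cong)
    also have "\<dots> = c j x * x (i, s)" using i c_ker[of i x] by (simp add: if_distrib[of "\<lambda>a. _ * a"] mult.commute cong: if_cong)
    finally show "rmul d (\<lambda>(t, s). (if t = s then c j x else 0) - (if s = j then c t x else 0)) x (i, s) =
        c j x * x (i, s)"
      by (simp add: rmul_def)
  qed
  then show ?thesis using hpol_scale[OF F_hom] by simp
qed

text \<open>
  For \<open>z, w \<in> k\<^sup>d\<close> let \<open>a, b\<close> be the linear forms with \<open>a z = b w = \<delta>\<close>, \<open>a w = b z = 0\<close>, depending on the
  coordinates \<open>i, l\<close> only. The matrices \<open>\<delta> - z a\<close>, \<open>\<delta> - w b\<close> and \<open>\<delta> - z a - w b\<close> are singular; if \<open>x z = 0\<close>,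
  then the first one multiplies \<open>x\<close> by \<open>\<delta>\<close> and the last two agree on \<open>x\<close>.
\<close>

definition sing :: "'a \<Rightarrow> 'a \<Rightarrow> nat \<Rightarrow> nat \<Rightarrow> (nat + nat \<Rightarrow> 'a) \<Rightarrow> nat \<times> nat \<Rightarrow> 'a" where
  "sing f g i l u = (\<lambda>(t, s). (if t = s then \<delta> i l u else 0)
     - f * (u (Inl t) * ((if s = i then u (Inr l) else 0) - (if s = l then u (Inr i) else 0)))
     - g * (u (Inr t) * ((if s = l then u (Inl i) else 0) - (if s = i then u (Inl l) else 0))))"

text \<open>At z = c the last two terms cancel, at w = c the outer two, and what remains is F
  delta^e in both cases. Thus a single form over \<open>R\<close> has the required value at both
  specializations.\<close>

definition \<rho> :: "nat \<Rightarrow> nat \<Rightarrow> (nat \<times> nat \<Rightarrow> 'a) \<Rightarrow> (nat + nat \<Rightarrow> 'a) \<Rightarrow> 'a" where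
  "\<rho> i l x u = F (rmul d (sing 1 0 i l u) x) + F (rmul d (sing 0 1 i l u) x) - F (rmul d (sing 1 1 i l u) x)"

lemma sing_apply:
  assumes "i < d" "l < d"
  shows "(\<Sum>s<d. sing f g i l u (t, s) * y s) = \<delta> i l u * (if t < d then y t else 0)
     - f * (u (Inl t) * (y i * u (Inr l) - y l * u (Inr i)))
     - g * (u (Inr t) * (y l * u (Inl i) - y i * u (Inl l)))"
proof -
  have "(\<Sum>s<d. sing f g i l u (t, s) * y s) =
      (\<Sum>s<d. if t = s then \<delta> i l u * y s else 0)
      - f * (u (Inl t) * ((\<Sum>s<d. if s = i then y s * u (Inr l) else 0) - (\<Sum>s<d. if s = l then y s * u (Inr i) else 0)))
      - g * (u (Inr t) * ((\<Sum>s<d. if s = l then y s * u (Inl i) else 0) - (\<Sum>s<d. if s = i then y s * u (Inl l) else 0)))"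
    unfolding sum_subtractf[symmetric] sum_distrib_left
    by (intro sum.cong refl) (auto simp: sing_def algebra_simps)
  then show ?thesis using assms by simp
qed

lemma sing_R:
  assumes "i < d" "l < d" "(f, g) \<in> {(1, 0), (0, 1), (1, 1)}"
  shows "(\<lambda>x. F (rmul d (sing f g i l u) x)) \<in> R"
proof (cases "f = 1")
  case True
  show ?thesis
  proof (rule R_kernel'[of _ "u \<circ> Inl"])
    fix t assume "t < d"
    then show "(\<Sum>s<d. sing f g i l u (t, s) * (u \<circ> Inl) s) = 0"
      unfolding sing_apply[OF assms(1,2)] using True by (simp add: \<delta>_def algebra_simps)
  next
    fix t s assume "\<And>s. s < d \<Longrightarrow> (u \<circ> Inl) s = 0" "t < d" "s < d"
    then show "sing f g i l u (t, s) = 0" using assms by (auto simp: sing_def \<delta>_def)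
  qed
next
  case False
  then have fg: "f = 0" "g = 1" using assms(3) by auto
  show ?thesis
  proof (rule R_kernel'[of _ "u \<circ> Inr"])
    fix t assume "t < d"
    then show "(\<Sum>s<d. sing f g i l u (t, s) * (u \<circ> Inr) s) = 0"
      unfolding sing_apply[OF assms(1,2)] using fg by (simp add: \<delta>_def algebra_simps)
  next
    fix t s assume "\<And>s. s < d \<Longrightarrow> (u \<circ> Inr) s = 0" "t < d" "s < d"
    then show "sing f g i l u (t, s) = 0" using assms fg by (auto simp: sing_def \<delta>_def)
  qed
qed

lemma sing_B:
  assumes il: "i < d" "l < d" and fg: "(f, g) \<in> {(1, 0), (0, 1), (1, 1)}"
  shows "(\<lambda>x u. F (rmul d (sing f g i l u) x)) \<in> B e"
proof (rule F_subst)
  fix t s assume ts: "t < d" "s < d"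
  let ?G = "gspan UNIV (mexp2 d 1) :: ((nat \<times> nat \<Rightarrow> 'a) \<Rightarrow> _ \<Rightarrow> 'a) set"
  have var: "(\<lambda>_ u. if P then u (Inl i) * u (Inr l) else 0) \<in> ?G"
    if "i < d" "l < d" for P i l
    by (cases P) (use gspan_mono[OF B_var2[OF that], of UNIV] in \<open>auto intro: gspan.zero\<close>)
  have "(\<lambda>_ u. (if t = s then u (Inl i) * u (Inr l) else 0) - (if t = s then u (Inl l) * u (Inr i) else 0)
     - f * ((if s = i then u (Inl t) * u (Inr l) else 0) - (if s = l then u (Inl t) * u (Inr i) else 0))
     - g * ((if s = l then u (Inl i) * u (Inr t) else 0) - (if s = i then u (Inl l) * u (Inr t) else 0))) \<in> ?G"
    using il ts by (intro gspan_diff var gspan_const_mult[of _ _ "\<lambda>_. f"] gspan_const_mult[of _ _ "\<lambda>_. g"])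
  also have "(\<lambda>_ u. (if t = s then u (Inl i) * u (Inr l) else 0) - (if t = s then u (Inl l) * u (Inr i) else 0)
     - f * ((if s = i then u (Inl t) * u (Inr l) else 0) - (if s = l then u (Inl t) * u (Inr i) else 0))
     - g * ((if s = l then u (Inl i) * u (Inr t) else 0) - (if s = i then u (Inl l) * u (Inr t) else 0))) =
     (\<lambda>_ u. sing f g i l u (t, s))"
    by (auto simp: sing_def \<delta>_def fun_eq_iff algebra_simps)
  finally show "(\<lambda>_ u. sing f g i l u (t, s)) \<in> ?G" .
qed (use mexp2_add mexp2_empty sing_R[OF il fg] in auto)

lemma \<rho>_B:
  assumes "i < d" "l < d"
  shows "\<rho> i l \<in> B e"
  unfolding \<rho>_def[abs_def] by (intro B_diff gspan.add sing_B assms) auto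

lemma rmul_sing:
  assumes "i < d" "l < d" "s < d"
  shows "rmul d (sing f g i l u) x (i', s) = \<delta> i l u * x (i', s)
     - f * ((\<Sum>t<d. x (i', t) * u (Inl t)) * ((if s = i then u (Inr l) else 0) - (if s = l then u (Inr i) else 0)))
     - g * ((\<Sum>t<d. x (i', t) * u (Inr t)) * ((if s = l then u (Inl i) else 0) - (if s = i then u (Inl l) else 0)))"
proof -
  have "rmul d (sing f g i l u) x (i', s) = (\<Sum>t<d. if t = s then \<delta> i l u * x (i', t) else 0)
     - f * ((\<Sum>t<d. x (i', t) * u (Inl t)) * ((if s = i then u (Inr l) else 0) - (if s = l then u (Inr i) else 0)))
     - g * ((\<Sum>t<d. x (i', t) * u (Inr t)) * ((if s = l then u (Inl i) else 0) - (if s = i then u (Inl l) else 0)))"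
    unfolding rmul_def sing_def prod.case sum_distrib_left sum_distrib_right sum_subtractf[symmetric]
    by (intro sum.cong refl) (auto simp: algebra_simps)
  then show ?thesis using assms by simp
qed

lemma \<rho>_c1:
  assumes "i < d" "l < d"
  shows "\<rho> i l x (case_sum (\<lambda>j. c j x) w) = F x * \<delta> i l (case_sum (\<lambda>j. c j x) w) ^ e"
proof -
  let ?u = "case_sum (\<lambda>j. c j x) w"
  have "F (rmul d (sing 1 0 i l ?u) x) = F (\<lambda>i'. \<delta> i l ?u * x i')"
    by (rule F_cong) (simp add: rmul_sing[OF assms] c_ker)
  also have "\<dots> = \<delta> i l ?u ^ e * F x" by (rule hpol_scale[OF F_hom])
  finally have "F (rmul d (sing 1 0 i l ?u) x) = \<delta> i l ?u ^ e * F x" .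
  moreover have "F (rmul d (sing 0 1 i l ?u) x) = F (rmul d (sing 1 1 i l ?u) x)"
    by (rule F_cong) (simp add: rmul_sing[OF assms] c_ker)
  ultimately show ?thesis by (simp add: \<rho>_def mult.commute)
qed

lemma \<rho>_c2:
  assumes "i < d" "l < d"
  shows "\<rho> i l x (case_sum z (\<lambda>j. c j x)) = F x * \<delta> i l (case_sum z (\<lambda>j. c j x)) ^ e"
proof -
  let ?u = "case_sum z (\<lambda>j. c j x)"
  have "F (rmul d (sing 0 1 i l ?u) x) = F (\<lambda>i'. \<delta> i l ?u * x i')"
    by (rule F_cong) (simp add: rmul_sing[OF assms] c_ker)
  also have "\<dots> = \<delta> i l ?u ^ e * F x" by (rule hpol_scale[OF F_hom])
  finally have "F (rmul d (sing 0 1 i l ?u) x) = \<delta> i l ?u ^ e * F x" .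
  moreover have "F (rmul d (sing 1 0 i l ?u) x) = F (rmul d (sing 1 1 i l ?u) x)"
    by (rule F_cong) (simp add: rmul_sing[OF assms] c_ker)
  ultimately show ?thesis by (simp add: \<rho>_def mult.commute)
qed

end

section \<open>The tensor square of the module of monomials\<close>

locale descent_power = descent_step +
  fixes k :: nat
  assumes e_le: "e \<le> p ^ k"
begin

text \<open>The bound q >= e puts delta^q into the annihilator of \<open>E j\<close>;
  \<open>Q\<close> is the next power of \<open>p\<close>, so that Q >= q + 1 and E^(q+1) in
  \<open>J\<close> gives E^Q in \<open>J\<close>.\<close>

abbreviation q where "q \<equiv> p ^ k"
abbreviation Q where "Q \<equiv> p ^ Suc k"

abbreviation atl :: "(nat \<times> nat \<Rightarrow> 'a) \<Rightarrow> (nat \<Rightarrow> 'a) \<Rightarrow> nat + nat \<Rightarrow> 'a" where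
  "atl x w \<equiv> case_sum (\<lambda>j. c j x) w"
abbreviation atr :: "(nat \<times> nat \<Rightarrow> 'a) \<Rightarrow> (nat \<Rightarrow> 'a) \<Rightarrow> nat + nat \<Rightarrow> 'a" where
  "atr x z \<equiv> case_sum z (\<lambda>j. c j x)"

lemma atl_atr [simp]: "atl x w \<circ> Inl = (\<lambda>j. c j x)" "atl x w \<circ> Inr = w"
    "atr x z \<circ> Inl = z" "atr x z \<circ> Inr = (\<lambda>j. c j x)"
  by (auto simp: fun_eq_iff)

lemma q_less_Q: "q + 1 \<le> Q"
proof -
  have "q + 1 \<le> q * 2" using p_pos[of k] by linarith
  also have "\<dots> \<le> q * p" by (rule mult_le_mono2[OF prime_ge_2_nat[OF prime]])
  finally show ?thesis by (simp add: mult.commute)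
qed

text \<open>Let M_m be the \<open>R\<close>-module spanned by the degree m monomials in
  \<open>c\<close>. Monomials in the vector left free are independent, so \<open>I1 m\<close> and
  \<open>I2 m\<close> are the relations in the first and in the second factor, and
  \<open>J m\<close> is the kernel of the map from \<open>B m\<close> onto the tensor square of
  M_m.\<close>

definition I1 where "I1 m = {f \<in> B m. \<forall>x w. f x (atl x w) = 0}"
definition I2 where "I2 m = {f \<in> B m. \<forall>x z. f x (atr x z) = 0}"
definition J where "J m = {\<lambda>x u. f x u + g x u | f g. f \<in> I1 m \<and> g \<in> I2 m}"

lemma I1_zero: "(\<lambda>x u. 0) \<in> I1 m" and I2_zero: "(\<lambda>x u. 0) \<in> I2 m"
  by (auto simp: I1_def I2_def intro: gspan.zero)

lemma JI: "f \<in> I1 m \<Longrightarrow> g \<in> I2 m \<Longrightarrow> (\<lambda>x u. f x u + g x u) \<in> J m"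
  by (auto simp: J_def)

lemma J_zero: "(\<lambda>x u. 0) \<in> J m"
  using JI[OF I1_zero I2_zero] by simp

lemma J_add:
  assumes "f \<in> J m" "g \<in> J m"
  shows "(\<lambda>x u. f x u + g x u) \<in> J m"
proof -
  obtain f1 f2 g1 g2 where fg: "f = (\<lambda>x u. f1 x u + f2 x u)" "g = (\<lambda>x u. g1 x u + g2 x u)"
    "f1 \<in> I1 m" "f2 \<in> I2 m" "g1 \<in> I1 m" "g2 \<in> I2 m"
    using assms by (auto simp: J_def)
  have "(\<lambda>x u. (f1 x u + g1 x u) + (f2 x u + g2 x u)) \<in> J m"
    by (rule JI) (use fg(3-) in \<open>auto simp: I1_def I2_def intro: gspan.add\<close>)
  then show ?thesis unfolding fg by (simp add: add_ac)
qed

lemma J_mult: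
  assumes "f \<in> J a" "g \<in> B b" "a + b = m"
  shows "(\<lambda>x u. f x u * g x u) \<in> J m"
proof -
  obtain f1 f2 where f: "f = (\<lambda>x u. f1 x u + f2 x u)" "f1 \<in> I1 a" "f2 \<in> I2 a"
    using assms by (auto simp: J_def)
  have "(\<lambda>x u. f1 x u * g x u + f2 x u * g x u) \<in> J m"
    by (rule JI) (use f(2-) assms(2,3) in \<open>auto simp: I1_def I2_def intro: B_mult\<close>)
  then show ?thesis unfolding f by (simp add: distrib_right)
qed

definition \<Theta>l where "\<Theta>l j x u = \<Theta> j x (u \<circ> Inl) * u (Inr j) ^ e"
definition \<Theta>r where "\<Theta>r j x u = u (Inl j) ^ e * \<Theta> j x (u \<circ> Inr)"
text \<open>Represents F tensor 1 - 1 tensor F on c_j^e tensor c_j^e.\<close>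

definition E where "E j x u = \<Theta>l j x u - \<Theta>r j x u"

lemma \<Theta>l_B: "j < d \<Longrightarrow> \<Theta>l j \<in> B e" and \<Theta>r_B: "j < d \<Longrightarrow> \<Theta>r j \<in> B e"
proof -
  assume j: "j < d"
  have pow: "(\<lambda>x z. z j ^ e) \<in> Z e" using Z_power[OF Z_var[OF j], of e] by simp
  show "\<Theta>l j \<in> B e" using Z_Z_B[OF \<Theta>_Z[OF j] pow] by (simp add: \<Theta>l_def[abs_def])
  show "\<Theta>r j \<in> B e" using Z_Z_B[OF pow \<Theta>_Z[OF j]] by (simp add: \<Theta>r_def[abs_def])
qed

lemma E_B: "j < d \<Longrightarrow> E j \<in> B e"
  unfolding E_def[abs_def] by (intro B_diff \<Theta>l_B \<Theta>r_B)

lemma \<Theta>l_atl: "j < d \<Longrightarrow> \<Theta>l j x (atl x w) = F x * (c j x * w j) ^ e"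
  and \<Theta>r_atr: "j < d \<Longrightarrow> \<Theta>r j x (atr x z) = F x * (z j * c j x) ^ e"
  by (simp_all add: \<Theta>l_def \<Theta>r_def \<Theta>_c power_mult_distrib)

text \<open>Insert (z_j w_j)^e rho: it agrees with the first half of delta^e E at z = c and with the
  second half at w = c.\<close>

lemma E_\<delta>:
  assumes j: "j < d" and il: "i < d" "l < d"
  shows "(\<lambda>x u. \<delta> i l u ^ e * E j x u) \<in> J (e + e)"
proof -
  have de: "(\<lambda>x u. \<delta> i l u ^ e) \<in> B e" using B_power[OF B_\<delta>[OF il], of e] by simp
  have pp: "(\<lambda>x u. (u (Inl j) * u (Inr j)) ^ e) \<in> B e" using B_power[OF B_var2[OF j j], of e] by simp
  have "(\<lambda>x u. (\<Theta>l j x u * \<delta> i l u ^ e - (u (Inl j) * u (Inr j)) ^ e * \<rho> i l x u) +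
      ((u (Inl j) * u (Inr j)) ^ e * \<rho> i l x u - \<Theta>r j x u * \<delta> i l u ^ e)) \<in> J (e + e)"
  proof (rule JI)
    show "(\<lambda>x u. \<Theta>l j x u * \<delta> i l u ^ e - (u (Inl j) * u (Inr j)) ^ e * \<rho> i l x u) \<in> I1 (e + e)"
      unfolding I1_def
      using B_diff[OF B_mult[OF \<Theta>l_B[OF j] de] B_mult[OF pp \<rho>_B[OF il]]]
      by (auto simp: \<Theta>l_atl[OF j] \<rho>_c1[OF il])
    show "(\<lambda>x u. (u (Inl j) * u (Inr j)) ^ e * \<rho> i l x u - \<Theta>r j x u * \<delta> i l u ^ e) \<in> I2 (e + e)"
      unfolding I2_def
      using B_diff[OF B_mult[OF pp \<rho>_B[OF il]] B_mult[OF \<Theta>r_B[OF j] de]]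
      by (auto simp: \<Theta>r_atr[OF j] \<rho>_c2[OF il])
  qed
  then show ?thesis by (simp add: E_def algebra_simps)
qed

text \<open>Degree \<open>m\<close> part of the annihilator of \<open>E j\<close> modulo
  \<open>J\<close>. That it contains a power of \<open>E j\<close> itself (\<open>E_power_q\<close>)
  makes \<open>E j\<close> nilpotent modulo \<open>J\<close>.\<close>

definition Ann where "Ann j m = {f \<in> B m. (\<lambda>x u. f x u * E j x u) \<in> J (m + e)}"

lemma Ann_zero: "(\<lambda>x u. 0) \<in> Ann j m"
  by (auto simp: Ann_def gspan.zero J_zero)

lemma Ann_add: "f \<in> Ann j m \<Longrightarrow> g \<in> Ann j m \<Longrightarrow> (\<lambda>x u. f x u + g x u) \<in> Ann j m"
  using J_add by (fastforce simp: Ann_def distrib_right intro: gspan.add)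

lemma Ann_mult:
  assumes "f \<in> Ann j a" "g \<in> B b" "a + b = m"
  shows "(\<lambda>x u. g x u * f x u) \<in> Ann j m"
proof -
  have "(\<lambda>x u. f x u * E j x u) \<in> J (a + e)" and f: "f \<in> B a" using assms by (simp_all add: Ann_def)
  from J_mult[OF this(1) assms(2), of "m + e"] assms(3)
  have "(\<lambda>x u. f x u * E j x u * g x u) \<in> J (m + e)" by simp
  moreover have "(\<lambda>x u. g x u * f x u) \<in> B m"
    using B_mult[OF assms(2) f] assms(3) by (simp add: add.commute)
  ultimately show ?thesis by (simp add: Ann_def mult_ac)
qed

lemma Ann_sum: "(\<And>i. i \<in> I \<Longrightarrow> f i \<in> Ann j m) \<Longrightarrow> (\<lambda>x u. \<Sum>i\<in>I. f i x u) \<in> Ann j m"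
  by (induction I rule: infinite_finite_induct) (auto intro: Ann_add Ann_zero)

lemma Ann_\<delta>:
  assumes j: "j < d" and il: "i < d" "l < d"
  shows "(\<lambda>x u. \<delta> i l u ^ q) \<in> Ann j q"
proof -
  have "(\<lambda>x u. \<delta> i l u ^ e) \<in> Ann j e"
    unfolding Ann_def using B_power[OF B_\<delta>[OF il], of e] E_\<delta>[OF assms] by simp
  from Ann_mult[OF this B_power[OF B_\<delta>[OF il], of "q - e"], of q]
  show ?thesis using e_le by (simp flip: power_add)
qed

lemma B_mon_scaled:
  assumes "j < d" "set_mset \<gamma> \<subseteq> {..<d}"
  shows "(\<lambda>x u. mon (\<lambda>i. u (Inl i) * u (Inr j)) \<gamma> ^ m) \<in> B (size \<gamma> * m)"
    and "(\<lambda>x u. mon (\<lambda>i. u (Inl j) * u (Inr i)) \<gamma> ^ m) \<in> B (size \<gamma> * m)"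
proof -
  have "(\<lambda>x u. mon (\<lambda>i. u (Inl i) * u (Inr j)) \<gamma>) \<in> B (size \<gamma>)"
    using assms(2)
  proof (induction \<gamma>)
    case (add i \<gamma>)
    then show ?case using B_mult[OF B_var2[of i j], of _ "size \<gamma>"] assms(1) by simp
  qed (use B_const[OF R_one] in simp)
  then show "(\<lambda>x u. mon (\<lambda>i. u (Inl i) * u (Inr j)) \<gamma> ^ m) \<in> B (size \<gamma> * m)" by (rule B_power)
  have "(\<lambda>x u. mon (\<lambda>i. u (Inl j) * u (Inr i)) \<gamma>) \<in> B (size \<gamma>)"
    using assms(2)
  proof (induction \<gamma>)
    case (add i \<gamma>)
    then show ?case using B_mult[OF B_var2[of j i], of _ "size \<gamma>"] assms(1) by simp
  qed (use B_const[OF R_one] in simp)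
  then show "(\<lambda>x u. mon (\<lambda>i. u (Inl j) * u (Inr i)) \<gamma> ^ m) \<in> B (size \<gamma> * m)" by (rule B_power)
qed

text \<open>By Frobenius (z_i w_j)^q - (z_j w_i)^q = delta^q lies in the annihilator, so the two
  kinds of factors may be exchanged one at a time.\<close>

lemma Ann_mon:
  assumes j: "j < d" and "set_mset \<gamma> \<subseteq> {..<d}"
  shows "(\<lambda>x u. mon (\<lambda>i. u (Inl i) * u (Inr j)) \<gamma> ^ q - mon (\<lambda>i. u (Inl j) * u (Inr i)) \<gamma> ^ q)
    \<in> Ann j (size \<gamma> * q)"
  using assms(2)
proof (induction \<gamma>)
  case empty
  then show ?case using Ann_zero by simp
next
  case (add i \<gamma>)
  let ?a = "\<lambda>u :: nat + nat \<Rightarrow> 'a. mon (\<lambda>i. u (Inl i) * u (Inr j)) \<gamma>"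
  let ?b = "\<lambda>u :: nat + nat \<Rightarrow> 'a. mon (\<lambda>i. u (Inl j) * u (Inr i)) \<gamma>"
  have i: "i < d" and \<gamma>: "set_mset \<gamma> \<subseteq> {..<d}" using add.prems by auto
  have "(\<lambda>x u. ?a u ^ q * \<delta> i j u ^ q + (u (Inl j) * u (Inr i)) ^ q * (?a u ^ q - ?b u ^ q))
      \<in> Ann j (size (add_mset i \<gamma>) * q)"
  proof (rule Ann_add)
    show "(\<lambda>x u. ?a u ^ q * \<delta> i j u ^ q) \<in> Ann j (size (add_mset i \<gamma>) * q)"
      by (rule Ann_mult[OF Ann_\<delta>[OF j i j] B_mon_scaled(1)[OF j \<gamma>]]) simp
    show "(\<lambda>x u. (u (Inl j) * u (Inr i)) ^ q * (?a u ^ q - ?b u ^ q)) \<in> Ann j (size (add_mset i \<gamma>) * q)"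
      by (rule Ann_mult[OF add.IH[OF \<gamma>] B_power[OF B_var2[OF j i]]]) simp
  qed
  moreover have "?a u ^ q * \<delta> i j u ^ q + (u (Inl j) * u (Inr i)) ^ q * (?a u ^ q - ?b u ^ q) =
      mon (\<lambda>i. u (Inl i) * u (Inr j)) (add_mset i \<gamma>) ^ q - mon (\<lambda>i. u (Inl j) * u (Inr i)) (add_mset i \<gamma>) ^ q"
    for u
  proof -
    have "\<delta> i j u ^ q = (u (Inl i) * u (Inr j)) ^ q - (u (Inl j) * u (Inr i)) ^ q"
      unfolding \<delta>_def by (rule fresh)
    then show ?thesis by (simp only: mon_add_mset power_mult_distrib) (simp add: algebra_simps)
  qed
  ultimately show ?case by simp
qed

text \<open>Each monomial of \<open>\<Theta> j\<close> contributes to \<open>E j\<close> a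
  difference of a monomial in the z_i w_j and the same monomial in the z_j w_i. Frobenius moves the
  exponent onto these, where \<open>Ann_mon\<close> applies.\<close>

lemma E_power_q:
  assumes j: "j < d"
  shows "(\<lambda>x u. E j x u ^ q) \<in> Ann j (e * q)"
proof -
  obtain a where a: "\<And>\<gamma>. \<gamma> \<in> mexp d e \<Longrightarrow> a \<gamma> \<in> R" "\<Theta> j = (\<lambda>x z. \<Sum>\<gamma>\<in>mexp d e. a \<gamma> x * mon z \<gamma>)"
    by (rule gspan_repr[OF \<Theta>_Z[OF j] falg_subspace mexp_finite]) (erule that)
  let ?f = "\<lambda>\<gamma> (u :: nat + nat \<Rightarrow> 'a). mon (\<lambda>i. u (Inl i) * u (Inr j)) \<gamma>"
  let ?g = "\<lambda>\<gamma> (u :: nat + nat \<Rightarrow> 'a). mon (\<lambda>i. u (Inl j) * u (Inr i)) \<gamma>"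
  have "E j x u ^ q = (\<Sum>\<gamma>\<in>mexp d e. a \<gamma> x ^ q * (?f \<gamma> u ^ q - ?g \<gamma> u ^ q))" for x u
  proof -
    have "E j x u = (\<Sum>\<gamma>\<in>mexp d e. a \<gamma> x * (?f \<gamma> u - ?g \<gamma> u))"
    proof -
      have "?f \<gamma> u = mon (u \<circ> Inl) \<gamma> * u (Inr j) ^ e" "?g \<gamma> u = u (Inl j) ^ e * mon (u \<circ> Inr) \<gamma>"
        if "\<gamma> \<in> mexp d e" for \<gamma>
        using that mon_scale[of "u (Inr j)" "u \<circ> Inl" \<gamma>] mon_scale[of "u (Inl j)" "u \<circ> Inr" \<gamma>]
        by (auto simp: multisets_of_size_def comp_def mult.commute)
      then show ?thesis
        unfolding E_def \<Theta>l_def \<Theta>r_def a(2) sum_distrib_left sum_distrib_right sum_subtractf[symmetric]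
        by (intro sum.cong refl) (simp add: algebra_simps)
    qed
    then show ?thesis by (simp add: fresh power_mult_distrib)
  qed
  moreover have "(\<lambda>x u. \<Sum>\<gamma>\<in>mexp d e. a \<gamma> x ^ q * (?f \<gamma> u ^ q - ?g \<gamma> u ^ q)) \<in> Ann j (e * q)"
  proof (rule Ann_sum)
    fix \<gamma> assume \<gamma>: "\<gamma> \<in> mexp d e"
    then have s: "set_mset \<gamma> \<subseteq> {..<d}" "size \<gamma> = e" by (auto simp: multisets_of_size_def)
    show "(\<lambda>x u. a \<gamma> x ^ q * (?f \<gamma> u ^ q - ?g \<gamma> u ^ q)) \<in> Ann j (e * q)"
      using Ann_mult[OF Ann_mon[OF j s(1)] B_const[OF falg_power[OF a(1)[OF \<gamma>]]]] s(2) by simp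
  qed
  ultimately show ?thesis by simp
qed

lemma E_power_Q:
  assumes j: "j < d"
  shows "(\<lambda>x u. E j x u ^ Q) \<in> J (e * Q)"
proof -
  have "Suc q \<le> Q" using q_less_Q by linarith
  then obtain r where r: "Q = Suc q + r" using le_Suc_ex by blast
  have "(\<lambda>x u. E j x u ^ q * E j x u) \<in> J (e * q + e)"
    using E_power_q[OF j] by (simp add: Ann_def)
  from J_mult[OF this B_power[OF E_B[OF j], of r], of "e * Q"]
  have "(\<lambda>x u. E j x u ^ q * E j x u * E j x u ^ r) \<in> J (e * Q)"
    by (simp add: r algebra_simps del: power_Suc)
  then show ?thesis unfolding r by (simp add: power_add mult_ac)
qed

text \<open>\<open>h1\<close> and \<open>h2\<close> represent T tensor 1 and 1 tensor T on the class
  of \<open>g\<close>, where T = F^Q; the last condition is their equality in the tensor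
  square.\<close>

definition good where
  "good N g \<longleftrightarrow> (\<exists>h1\<in>B N. \<exists>h2\<in>B N. (\<forall>x w. h1 x (atl x w) = F x ^ Q * g x (atl x w)) \<and>
     (\<forall>x z. h2 x (atr x z) = F x ^ Q * g x (atr x z)) \<and> (\<lambda>x u. h1 x u - h2 x u) \<in> J N)"

lemma good_add: 
  assumes "good N g" "good N g'"
  shows "good N (\<lambda>x u. g x u + g' x u)"
proof -
  obtain h1 h2 h1' h2' where h: "h1 \<in> B N" "h2 \<in> B N" "h1' \<in> B N" "h2' \<in> B N"
    "\<And>x w. h1 x (atl x w) = F x ^ Q * g x (atl x w)" "\<And>x z. h2 x (atr x z) = F x ^ Q * g x (atr x z)"
    "\<And>x w. h1' x (atl x w) = F x ^ Q * g' x (atl x w)" "\<And>x z. h2' x (atr x z) = F x ^ Q * g' x (atr x z)"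
    "(\<lambda>x u. h1 x u - h2 x u) \<in> J N" "(\<lambda>x u. h1' x u - h2' x u) \<in> J N"
    using assms unfolding good_def by blast
  have "(\<lambda>x u. (h1 x u + h1' x u) - (h2 x u + h2' x u)) \<in> J N"
    using J_add[OF h(9,10)] by (simp add: algebra_simps)
  then show ?thesis
    unfolding good_def using h(1-8)
    by (intro bexI[of _ "\<lambda>x u. h1 x u + h1' x u"] bexI[of _ "\<lambda>x u. h2 x u + h2' x u"] conjI)
      (auto simp: distrib_left intro: gspan.add)
qed

text \<open>The power of \<open>\<rho>\<close> represents both sides at once.\<close>

lemma good_\<delta>:
  assumes il: "i < d" "l < d" and m: "m \<in> B M" "N = e * Q + M"
  shows "good N (\<lambda>x u. \<delta> i l u ^ (e * Q) * m x u)"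
proof -
  have "(\<lambda>x u. \<rho> i l x u ^ Q * m x u) \<in> B N"
    unfolding m(2) by (rule B_mult[OF B_power[OF \<rho>_B[OF il]] m(1)])
  then show ?thesis
    unfolding good_def using J_zero
    by (intro bexI[of _ "\<lambda>x u. \<rho> i l x u ^ Q * m x u"] conjI)
      (auto simp: \<rho>_c1[OF il] \<rho>_c2[OF il] power_mult_distrib mult_ac simp del: power_Suc simp flip: power_mult)
qed

text \<open>The representatives come from \<open>\<Theta>l\<close> and \<open>\<Theta>r\<close>; by
  Frobenius they differ by a multiple of E^Q.\<close>

lemma good_same:
  assumes j: "j < d" and m: "m \<in> B M" "N = e * Q + M"
  shows "good N (\<lambda>x u. (u (Inl j) * u (Inr j)) ^ (e * Q) * m x u)"
proof -
  have "(\<lambda>x u. \<Theta>l j x u ^ Q * m x u) \<in> B N" "(\<lambda>x u. \<Theta>r j x u ^ Q * m x u) \<in> B N"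
    unfolding m(2) by (intro B_mult[OF B_power m(1)] \<Theta>l_B \<Theta>r_B j)+
  moreover have "(\<lambda>x u. \<Theta>l j x u ^ Q * m x u - \<Theta>r j x u ^ Q * m x u) \<in> J N"
    using J_mult[OF E_power_Q[OF j] m(1), of N] m(2)
    by (simp add: E_def fresh left_diff_distrib del: power_Suc)
  ultimately show ?thesis
    unfolding good_def
    by (intro bexI[of _ "\<lambda>x u. \<Theta>l j x u ^ Q * m x u"] bexI[of _ "\<lambda>x u. \<Theta>r j x u ^ Q * m x u"] conjI)
      (auto simp: \<Theta>l_atl[OF j] \<Theta>r_atr[OF j] power_mult_distrib mult_ac simp del: power_Suc simp flip: power_mult)
qed

text \<open>Frobenius gives (z_j w_l)^q2 = delta^q2 + (z_l w_j)^q2. Multiplied by a second factor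
  (z_j w_l)^q2, the last term regroups as (z_j w_j)^q2 (z_l w_l)^q2, so both terms are covered by
  the previous two lemmas. Hence the exponent 2 q2.\<close>

lemma good_mon:
  assumes jl: "j < d" "l < d" and q2: "q2 = p ^ k2" "e * Q \<le> q2"
    and \<gamma>: "\<gamma> \<in> mexp d M" "\<mu> \<in> mexp d M" and N: "N = 2 * q2 + M"
  shows "good N (\<lambda>x u. mon (u \<circ> Inl) (replicate_mset (2 * q2) j + \<gamma>) *
    mon (u \<circ> Inr) (replicate_mset (2 * q2) l + \<mu>))"
proof -
  define m0 where "m0 = (\<lambda>(x :: nat \<times> nat \<Rightarrow> 'a) (u :: nat + nat \<Rightarrow> 'a). mon (u \<circ> Inl) \<gamma> * mon (u \<circ> Inr) \<mu>)"
  have m0: "m0 \<in> B M" unfolding m0_def by (rule Z_Z_B[OF Z_mon[OF \<gamma>(1)] Z_mon[OF \<gamma>(2)]])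
  obtain r where r: "q2 = e * Q + r" using q2(2) le_Suc_ex by blast
  have "(\<lambda>x u. (u (Inl j) * u (Inr l)) ^ q2 * m0 x u) \<in> B (1 * q2 + M)"
    by (rule B_mult[OF B_power[OF B_var2[OF jl]] m0])
  from B_mult[OF B_power[OF B_\<delta>[OF jl], of r] this]
  have b1: "(\<lambda>x u. \<delta> j l u ^ r * ((u (Inl j) * u (Inr l)) ^ q2 * m0 x u)) \<in> B (r + q2 + M)"
    by (simp add: add_ac)
  have "(\<lambda>x u. (u (Inl l) * u (Inr l)) ^ q2 * m0 x u) \<in> B (1 * q2 + M)"
    by (rule B_mult[OF B_power[OF B_var2[OF jl(2,2)]] m0])
  from B_mult[OF B_power[OF B_var2[OF jl(1,1)], of r] this]
  have b2: "(\<lambda>x u. (u (Inl j) * u (Inr j)) ^ r * ((u (Inl l) * u (Inr l)) ^ q2 * m0 x u)) \<in> B (r + q2 + M)"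
    by (simp add: add_ac)
  have N': "N = e * Q + (r + q2 + M)" unfolding N using r by simp
  have "good N (\<lambda>x u. \<delta> j l u ^ (e * Q) * (\<delta> j l u ^ r * ((u (Inl j) * u (Inr l)) ^ q2 * m0 x u)) +
     (u (Inl j) * u (Inr j)) ^ (e * Q) * ((u (Inl j) * u (Inr j)) ^ r * ((u (Inl l) * u (Inr l)) ^ q2 * m0 x u)))"
    by (intro good_add good_\<delta>[OF jl b1 N'] good_same[OF jl(1) b2 N'])
  moreover have "\<delta> j l u ^ (e * Q) * (\<delta> j l u ^ r * ((u (Inl j) * u (Inr l)) ^ q2 * m0 x u)) +
     (u (Inl j) * u (Inr j)) ^ (e * Q) * ((u (Inl j) * u (Inr j)) ^ r * ((u (Inl l) * u (Inr l)) ^ q2 * m0 x u)) =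
     mon (u \<circ> Inl) (replicate_mset (2 * q2) j + \<gamma>) * mon (u \<circ> Inr) (replicate_mset (2 * q2) l + \<mu>)" for x u
  proof -
    have pw: "a ^ (2 * q2) = a ^ q2 * a ^ q2" for a :: 'a by (simp add: mult_2 power_add)
    have "(u (Inl j) * u (Inr l)) ^ q2 = (\<delta> j l u + u (Inl l) * u (Inr j)) ^ q2"
      by (simp add: \<delta>_def)
    also have "\<dots> = \<delta> j l u ^ q2 + (u (Inl l) * u (Inr j)) ^ q2"
      unfolding q2(1) by (rule fresh)
    finally have eq: "\<delta> j l u ^ q2 = (u (Inl j) * u (Inr l)) ^ q2 - (u (Inl l) * u (Inr j)) ^ q2" by simp
    have "\<delta> j l u ^ (e * Q) * (\<delta> j l u ^ r * ((u (Inl j) * u (Inr l)) ^ q2 * m0 x u)) +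
     (u (Inl j) * u (Inr j)) ^ (e * Q) * ((u (Inl j) * u (Inr j)) ^ r * ((u (Inl l) * u (Inr l)) ^ q2 * m0 x u)) =
     \<delta> j l u ^ q2 * ((u (Inl j) * u (Inr l)) ^ q2 * m0 x u) +
      (u (Inl j) * u (Inr j)) ^ q2 * ((u (Inl l) * u (Inr l)) ^ q2 * m0 x u)"
      unfolding r power_add by (simp only: mult.assoc)
    also have "\<dots> = (u (Inl j) * u (Inr l)) ^ q2 * (u (Inl j) * u (Inr l)) ^ q2 * m0 x u"
      unfolding eq by (simp add: power_mult_distrib algebra_simps)
    also have "\<dots> = mon (u \<circ> Inl) (replicate_mset (2 * q2) j + \<gamma>) * mon (u \<circ> Inr) (replicate_mset (2 * q2) l + \<mu>)"
      unfolding m0_def mon_union mon_replicate pw by (simp only: power_mult_distrib comp_apply mult_ac)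
    finally show ?thesis .
  qed
  ultimately show ?thesis by simp
qed

text \<open>Provides the rows of the matrix of \<open>T\<close>: a monomial containing c_j^(e Q) is
  sent by F^Q to a combination over \<open>R\<close> of monomials of the same degree.\<close>

lemma \<tau>_exists:
  assumes j: "j < d" and \<gamma>: "\<gamma> \<in> mexp d M" and N: "N = e * Q + M"
  shows "\<exists>t\<in>Z N. \<forall>x. t x (\<lambda>j. c j x) = F x ^ Q * mon (\<lambda>j. c j x) (replicate_mset (e * Q) j + \<gamma>)"
proof
  show "(\<lambda>x z. \<Theta> j x z ^ Q * mon z \<gamma>) \<in> Z N"
    unfolding N by (rule Z_mult[OF Z_power[OF \<Theta>_Z[OF j]] Z_mon[OF \<gamma>]])
  show "\<forall>x. \<Theta> j x (\<lambda>j. c j x) ^ Q * mon (\<lambda>j. c j x) \<gamma> =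
      F x ^ Q * mon (\<lambda>j. c j x) (replicate_mset (e * Q) j + \<gamma>)"
    by (simp add: \<Theta>_c[OF j] mon_union power_mult_distrib mult_ac del: power_Suc flip: power_mult)
qed

lemma pigeonhole_mexp:
  assumes "\<gamma> \<in> mexp d (d * K)" "K > 0"
  obtains j \<gamma>' where "j < d" "\<gamma> = replicate_mset K j + \<gamma>'" "\<gamma>' \<in> mexp d (d * K - K)"
proof -
  have s: "set_mset \<gamma> \<subseteq> {..<d}" "size \<gamma> = d * K" using assms by (auto simp: multisets_of_size_def)
  have "\<exists>j<d. K \<le> count \<gamma> j"
  proof (rule ccontr)
    assume "\<not> ?thesis"
    then have lt: "count \<gamma> j < K" if "j < d" for j using that by force
    have "size \<gamma> = (\<Sum>j\<in>set_mset \<gamma>. count \<gamma> j)" by (simp add: size_multiset_overloaded_eq)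
    also have "\<dots> = (\<Sum>j<d. count \<gamma> j)"
      using s(1) by (intro sum.mono_neutral_left) (auto simp: count_eq_zero_iff)
    also have "\<dots> < (\<Sum>j<d. K)"
      using lt d_pos by (intro sum_strict_mono) auto
    finally show False using s(2) by simp
  qed
  then obtain j where j: "j < d" "K \<le> count \<gamma> j" by blast
  have sub: "replicate_mset K j \<subseteq># \<gamma>" using j(2) by (simp add: count_le_replicate_mset_subset_eq)
  show thesis
  proof (rule that[OF j(1)])
    show "\<gamma> = replicate_mset K j + (\<gamma> - replicate_mset K j)" using sub by simp
    show "\<gamma> - replicate_mset K j \<in> mexp d (d * K - K)"
      using s sub by (auto simp: multisets_of_size_def size_Diff_submset dest: in_diffD)
  qed
qed

end

lemma sum_fun_apply: "(\<Sum>i\<in>A. f i) x = (\<Sum>i\<in>A. f i x)"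
  for f :: "'i \<Rightarrow> 'x \<Rightarrow> 'b::comm_monoid_add"
  by (induction A rule: infinite_finite_induct) auto

lemma power_fun_apply: "(f ^ m) x = f x ^ m"
  for f :: "'x \<Rightarrow> 'b::comm_semiring_1"
  by (induction m) auto

section \<open>Functionals on the tensor square and a power of F in the lower algebra\<close>

context descent_power
begin

abbreviation v :: "nat multiset \<Rightarrow> (nat \<times> nat \<Rightarrow> 'a) \<Rightarrow> 'a" where
  "v \<gamma> \<equiv> (\<lambda>x. mon (\<lambda>j. c j x) \<gamma>)"

interpretation R: subring_set R
  using falg_subring by unfold_locales

lemma sum_mexp2: "(\<Sum>\<kappa>\<in>mexp2 d N. g \<kappa>) = (\<Sum>\<gamma>\<in>mexp d N. \<Sum>\<mu>\<in>mexp d N. g (pair_exp (\<gamma>, \<mu>)))"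
  by (subst sum.reindex[OF inj_pair_exp]) (simp add: sum.cartesian_product)

text \<open>Comparing coefficients of the monomials in the free vector w yields relations among the
  \<open>v \<gamma>\<close>, which \<open>\<phi>\<close> maps into \<open>I\<close>.\<close>

lemma functional_I1:
  assumes I: "is_ideal R I" and \<phi>: "rel_functional R (mexp d N) v I \<phi>" and \<psi>: "rel_functional R (mexp d N) v I \<psi>"
    and a: "\<And>\<kappa>. \<kappa> \<in> mexp2 d N \<Longrightarrow> a \<kappa> \<in> R"
    and zero: "\<And>x w. (\<Sum>\<kappa>\<in>mexp2 d N. a \<kappa> x * mon (atl x w) \<kappa>) = 0"
  shows "(\<Sum>\<gamma>\<in>mexp d N. \<Sum>\<mu>\<in>mexp d N. a (pair_exp (\<gamma>, \<mu>)) * \<phi> \<gamma> * \<psi> \<mu>) \<in> I"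
proof -
  interpret I: ideal_set R I using I by unfold_locales
  have "(\<Sum>\<gamma>\<in>mexp d N. a (pair_exp (\<gamma>, \<mu>)) * \<phi> \<gamma>) \<in> I" if \<mu>: "\<mu> \<in> mexp d N" for \<mu>
  proof -
    have "(\<Sum>\<gamma>\<in>mexp d N. a (pair_exp (\<gamma>, \<mu>)) x * v \<gamma> x) = 0" for x
    proof (rule mon_independent[OF infinite mexp_finite _ \<mu>])
      fix w
      have "(\<Sum>\<mu>\<in>mexp d N. (\<Sum>\<gamma>\<in>mexp d N. a (pair_exp (\<gamma>, \<mu>)) x * v \<gamma> x) * mon w \<mu>) =
          (\<Sum>\<gamma>\<in>mexp d N. \<Sum>\<mu>\<in>mexp d N. a (pair_exp (\<gamma>, \<mu>)) x * (v \<gamma> x * mon w \<mu>))"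
        by (simp add: sum_distrib_right mult.assoc) (rule sum.swap)
      also have "\<dots> = 0" using zero[of x w] by (simp add: sum_mexp2 mon_pair_exp)
      finally show "(\<Sum>\<mu>\<in>mexp d N. (\<Sum>\<gamma>\<in>mexp d N. a (pair_exp (\<gamma>, \<mu>)) x * v \<gamma> x) * mon w \<mu>) = 0" .
    qed
    then have "(\<Sum>\<gamma>\<in>mexp d N. a (pair_exp (\<gamma>, \<mu>)) * v \<gamma>) = 0"
      by (simp add: fun_eq_iff sum_fun_apply)
    moreover have "\<forall>\<gamma>\<in>mexp d N. a (pair_exp (\<gamma>, \<mu>)) \<in> R" using a \<mu> by blast
    ultimately show ?thesis
      using \<phi>[unfolded rel_functional_def, THEN conjunct2, THEN spec, of "\<lambda>\<gamma>. a (pair_exp (\<gamma>, \<mu>))"] by simp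
  qed
  then have "(\<Sum>\<mu>\<in>mexp d N. (\<Sum>\<gamma>\<in>mexp d N. a (pair_exp (\<gamma>, \<mu>)) * \<phi> \<gamma>) * \<psi> \<mu>) \<in> I"
    using \<psi> by (auto simp: rel_functional_def intro!: I.sum_I[where J = "mexp d N" and f = "\<lambda>\<mu>. (\<Sum>\<gamma>\<in>mexp d N. a (pair_exp (\<gamma>, \<mu>)) * \<phi> \<gamma>) * \<psi> \<mu>"] I.mult_I')
  also have "(\<Sum>\<mu>\<in>mexp d N. (\<Sum>\<gamma>\<in>mexp d N. a (pair_exp (\<gamma>, \<mu>)) * \<phi> \<gamma>) * \<psi> \<mu>) =
      (\<Sum>\<gamma>\<in>mexp d N. \<Sum>\<mu>\<in>mexp d N. a (pair_exp (\<gamma>, \<mu>)) * \<phi> \<gamma> * \<psi> \<mu>)"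
    by (simp add: sum_distrib_right) (rule sum.swap)
  finally show ?thesis .
qed

lemma functional_I2:
  assumes I: "is_ideal R I" and \<phi>: "rel_functional R (mexp d N) v I \<phi>" and \<psi>: "rel_functional R (mexp d N) v I \<psi>"
    and a: "\<And>\<kappa>. \<kappa> \<in> mexp2 d N \<Longrightarrow> a \<kappa> \<in> R"
    and zero: "\<And>x z. (\<Sum>\<kappa>\<in>mexp2 d N. a \<kappa> x * mon (atr x z) \<kappa>) = 0"
  shows "(\<Sum>\<gamma>\<in>mexp d N. \<Sum>\<mu>\<in>mexp d N. a (pair_exp (\<gamma>, \<mu>)) * \<phi> \<gamma> * \<psi> \<mu>) \<in> I"
proof -
  interpret I: ideal_set R I using I by unfold_locales
  have "(\<Sum>\<mu>\<in>mexp d N. a (pair_exp (\<gamma>, \<mu>)) * \<psi> \<mu>) \<in> I" if \<gamma>: "\<gamma> \<in> mexp d N" for \<gamma>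
  proof -
    have "(\<Sum>\<mu>\<in>mexp d N. a (pair_exp (\<gamma>, \<mu>)) x * v \<mu> x) = 0" for x
    proof (rule mon_independent[OF infinite mexp_finite _ \<gamma>])
      fix z
      have "(\<Sum>\<gamma>\<in>mexp d N. (\<Sum>\<mu>\<in>mexp d N. a (pair_exp (\<gamma>, \<mu>)) x * v \<mu> x) * mon z \<gamma>) =
          (\<Sum>\<gamma>\<in>mexp d N. \<Sum>\<mu>\<in>mexp d N. a (pair_exp (\<gamma>, \<mu>)) x * (mon z \<gamma> * v \<mu> x))"
        by (simp add: sum_distrib_left sum_distrib_right mult_ac)
      also have "\<dots> = 0" using zero[of x z] by (simp add: sum_mexp2 mon_pair_exp)
      finally show "(\<Sum>\<gamma>\<in>mexp d N. (\<Sum>\<mu>\<in>mexp d N. a (pair_exp (\<gamma>, \<mu>)) x * v \<mu> x) * mon z \<gamma>) = 0" .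
    qed
    then have "(\<Sum>\<mu>\<in>mexp d N. a (pair_exp (\<gamma>, \<mu>)) * v \<mu>) = 0"
      by (simp add: fun_eq_iff sum_fun_apply)
    moreover have "\<forall>\<mu>\<in>mexp d N. a (pair_exp (\<gamma>, \<mu>)) \<in> R" using a \<gamma> by blast
    ultimately show ?thesis
      using \<psi>[unfolded rel_functional_def, THEN conjunct2, THEN spec, of "\<lambda>\<mu>. a (pair_exp (\<gamma>, \<mu>))"] by simp
  qed
  then have "(\<Sum>\<gamma>\<in>mexp d N. \<phi> \<gamma> * (\<Sum>\<mu>\<in>mexp d N. a (pair_exp (\<gamma>, \<mu>)) * \<psi> \<mu>)) \<in> I"
    using \<phi> by (auto simp: rel_functional_def intro!: I.sum_I[where J = "mexp d N" and f = "\<lambda>\<gamma>. \<phi> \<gamma> * (\<Sum>\<mu>\<in>mexp d N. a (pair_exp (\<gamma>, \<mu>)) * \<psi> \<mu>)"] I.mult_I)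
  also have "(\<Sum>\<gamma>\<in>mexp d N. \<phi> \<gamma> * (\<Sum>\<mu>\<in>mexp d N. a (pair_exp (\<gamma>, \<mu>)) * \<psi> \<mu>)) =
      (\<Sum>\<gamma>\<in>mexp d N. \<Sum>\<mu>\<in>mexp d N. a (pair_exp (\<gamma>, \<mu>)) * \<phi> \<gamma> * \<psi> \<mu>)"
    by (simp add: sum_distrib_left mult_ac)
  finally show ?thesis .
qed

text \<open>A pair of functionals is zero modulo \<open>I\<close> on the kernel \<open>J N\<close>;
  this plays the part of the universal property of the tensor product.\<close>

lemma functional_J:
  assumes I: "is_ideal R I" and \<phi>: "rel_functional R (mexp d N) v I \<phi>" and \<psi>: "rel_functional R (mexp d N) v I \<psi>"
    and J: "(\<lambda>x u. \<Sum>\<kappa>\<in>mexp2 d N. a \<kappa> x * mon u \<kappa>) \<in> J N"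
  shows "(\<Sum>\<gamma>\<in>mexp d N. \<Sum>\<mu>\<in>mexp d N. a (pair_exp (\<gamma>, \<mu>)) * \<phi> \<gamma> * \<psi> \<mu>) \<in> I"
proof -
  interpret I: ideal_set R I using I by unfold_locales
  obtain f g where fg: "(\<lambda>x u. \<Sum>\<kappa>\<in>mexp2 d N. a \<kappa> x * mon u \<kappa>) = (\<lambda>x u. f x u + g x u)"
    and f: "f \<in> B N" "\<And>x w. f x (atl x w) = 0" and g: "g \<in> B N" "\<And>x z. g x (atr x z) = 0"
    using J by (auto simp: J_def I1_def I2_def)
  have fin: "finite (mexp2 d N)" by simp
  obtain b where b: "\<And>\<kappa>. \<kappa> \<in> mexp2 d N \<Longrightarrow> b \<kappa> \<in> R" "f = (\<lambda>x u. \<Sum>\<kappa>\<in>mexp2 d N. b \<kappa> x * mon u \<kappa>)"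
    by (rule gspan_repr[OF f(1) falg_subspace fin]) (erule that)
  obtain b' where b': "\<And>\<kappa>. \<kappa> \<in> mexp2 d N \<Longrightarrow> b' \<kappa> \<in> R" "g = (\<lambda>x u. \<Sum>\<kappa>\<in>mexp2 d N. b' \<kappa> x * mon u \<kappa>)"
    by (rule gspan_repr[OF g(1) falg_subspace fin]) (erule that)
  have "a \<kappa> x - (b \<kappa> x + b' \<kappa> x) = 0" if "\<kappa> \<in> mexp2 d N" for \<kappa> x
  proof (rule mon_independent[OF infinite fin _ that])
    fix u
    have "(\<Sum>\<kappa>\<in>mexp2 d N. a \<kappa> x * mon u \<kappa>) = f x u + g x u" using fun_cong[OF fun_cong[OF fg]] .
    then show "(\<Sum>\<kappa>\<in>mexp2 d N. (a \<kappa> x - (b \<kappa> x + b' \<kappa> x)) * mon u \<kappa>) = 0"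
      by (simp add: b(2) b'(2) algebra_simps sum.distrib sum_subtractf)
  qed
  then have "a \<kappa> = b \<kappa> + b' \<kappa>" if "\<kappa> \<in> mexp2 d N" for \<kappa>
    using that by (simp add: fun_eq_iff)
  then have "(\<Sum>\<gamma>\<in>mexp d N. \<Sum>\<mu>\<in>mexp d N. a (pair_exp (\<gamma>, \<mu>)) * \<phi> \<gamma> * \<psi> \<mu>) =
      (\<Sum>\<gamma>\<in>mexp d N. \<Sum>\<mu>\<in>mexp d N. b (pair_exp (\<gamma>, \<mu>)) * \<phi> \<gamma> * \<psi> \<mu>) +
      (\<Sum>\<gamma>\<in>mexp d N. \<Sum>\<mu>\<in>mexp d N. b' (pair_exp (\<gamma>, \<mu>)) * \<phi> \<gamma> * \<psi> \<mu>)"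
    by (simp add: distrib_right sum.distrib)
  also have "\<dots> \<in> I"
    using f(2) g(2) by (intro I.add_I functional_I1[OF I \<phi> \<psi> b(1)] functional_I2[OF I \<phi> \<psi> b'(1)])
      (auto simp: b(2) b'(2))
  finally show ?thesis .
qed

text \<open>By pigeonhole each of the two monomials contains a high power of one variable, so
  \<open>good_mon\<close> supplies \<open>h1\<close> and \<open>h2\<close>. They link the
  representatives \<open>t\<close> and \<open>s\<close>, which are known only through their values
  at \<open>c\<close>.\<close>

lemma bilinear_J:
  assumes i: "i \<in> mexp d N" and l: "l \<in> mexp d N" and N: "N = d * (2 * q2)"
    and q2: "q2 = p ^ k2" "e * Q \<le> q2"
    and t: "t \<in> Z N" "\<And>x. t x (\<lambda>j. c j x) = F x ^ Q * v i x"
    and s: "s \<in> Z N" "\<And>x. s x (\<lambda>j. c j x) = F x ^ Q * v l x"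
  shows "(\<lambda>x u. t x (u \<circ> Inl) * mon (u \<circ> Inr) l - mon (u \<circ> Inl) i * s x (u \<circ> Inr)) \<in> J N"
proof -
  have K: "2 * q2 > 0" using p_pos[of k2] q2 by simp
  obtain j \<gamma> where j: "j < d" "i = replicate_mset (2 * q2) j + \<gamma>" "\<gamma> \<in> mexp d (N - 2 * q2)"
    using pigeonhole_mexp[OF i[unfolded N] K] unfolding N by metis
  obtain j' \<mu> where j': "j' < d" "l = replicate_mset (2 * q2) j' + \<mu>" "\<mu> \<in> mexp d (N - 2 * q2)"
    using pigeonhole_mexp[OF l[unfolded N] K] unfolding N by metis
  have "N = 2 * q2 + (N - 2 * q2)" using d_pos unfolding N by (cases d) auto
  from good_mon[OF j(1) j'(1) q2 j(3) j'(3) this]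
  obtain h1 h2 where h: "h1 \<in> B N" "h2 \<in> B N" "(\<lambda>x u. h1 x u - h2 x u) \<in> J N"
    "\<And>x w. h1 x (atl x w) = F x ^ Q * (v i x * mon w l)"
    "\<And>x z. h2 x (atr x z) = F x ^ Q * (mon z i * v l x)"
    unfolding good_def j(2)[symmetric] j'(2)[symmetric] atl_atr by blast
  have "(\<lambda>x u. (t x (u \<circ> Inl) * mon (u \<circ> Inr) l - h1 x u) + (h2 x u - mon (u \<circ> Inl) i * s x (u \<circ> Inr))) \<in> J N"
  proof (rule JI)
    show "(\<lambda>x u. t x (u \<circ> Inl) * mon (u \<circ> Inr) l - h1 x u) \<in> I1 N"
      unfolding I1_def using B_diff[OF Z_Z_B[OF t(1) Z_mon[OF l]] h(1)] by (simp add: t(2) h(4) mult_ac)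
    show "(\<lambda>x u. h2 x u - mon (u \<circ> Inl) i * s x (u \<circ> Inr)) \<in> I2 N"
      unfolding I2_def using B_diff[OF h(2) Z_Z_B[OF Z_mon[OF i] s(1)]] by (simp add: s(2) h(5) mult_ac)
  qed
  from J_add[OF this h(3)] show ?thesis by (simp add: algebra_simps)
qed

theorem power_in_R: "\<exists>m. (\<lambda>x. F x ^ (p ^ m)) \<in> R"
proof -
  obtain k2 where k2: "e * Q \<le> p ^ k2"
  proof (rule that)
    have "e * Q < 2 ^ (e * Q)" by (rule less_exp)
    also have "\<dots> \<le> p ^ (e * Q)" using prime_ge_2_nat[OF prime] by (rule power_mono) simp
    finally show "e * Q \<le> p ^ (e * Q)" by simp
  qed
  define q2 where "q2 = p ^ k2"
  have q2: "q2 = p ^ k2" "e * Q \<le> q2" using k2 by (simp_all add: q2_def)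
  \<comment> \<open>In this degree every monomial in \<open>d\<close> variables has an exponent of
    at least 2 q2.\<close>
  define N where "N = d * (2 * q2)"
  let ?G = "mexp d N"
  have K: "2 * q2 > 0" using p_pos[of k2] by (simp add: q2_def)
  have "\<forall>i\<in>?G. \<exists>a. (\<forall>\<gamma>\<in>?G. a \<gamma> \<in> R) \<and> (\<forall>x. (\<Sum>\<gamma>\<in>?G. a \<gamma> x * v \<gamma> x) = F x ^ Q * v i x)"
  proof
    fix i assume i: "i \<in> ?G"
    obtain j \<gamma> where j: "j < d" "i = replicate_mset (2 * q2) j + \<gamma>" "\<gamma> \<in> mexp d (N - 2 * q2)"
      using pigeonhole_mexp[OF i[unfolded N_def] K] unfolding N_def by metis
    define \<gamma>' where "\<gamma>' = replicate_mset (2 * q2 - e * Q) j + \<gamma>"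
    have NK: "N = 2 * q2 + (N - 2 * q2)" using d_pos unfolding N_def by (cases d) auto
    have i': "i = replicate_mset (e * Q) j + \<gamma>'"
    proof -
      have "replicate_mset (e * Q) j + replicate_mset (2 * q2 - e * Q) j = replicate_mset (2 * q2) j"
        using q2(2) by (auto simp: multiset_eq_iff)
      then show ?thesis unfolding j(2) \<gamma>'_def by (simp add: add.assoc[symmetric])
    qed
    have "\<gamma>' \<in> mexp d ((2 * q2 - e * Q) + (N - 2 * q2))"
      unfolding \<gamma>'_def using j(1,3) by (auto simp: multisets_of_size_def split: if_splits)
    moreover have "N = e * Q + ((2 * q2 - e * Q) + (N - 2 * q2))" using q2(2) NK by simp
    ultimately obtain t where t: "t \<in> Z N" "\<forall>x. t x (\<lambda>j. c j x) = F x ^ Q * v i x"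
      using \<tau>_exists[OF j(1), of \<gamma>' _ N] unfolding i' by blast
    obtain a where a: "\<And>\<gamma>. \<gamma> \<in> ?G \<Longrightarrow> a \<gamma> \<in> R" "t = (\<lambda>x z. \<Sum>\<gamma>\<in>?G. a \<gamma> x * mon z \<gamma>)"
      by (rule gspan_repr[OF t(1) falg_subspace mexp_finite]) (erule that)
    have "\<forall>\<gamma>\<in>?G. a \<gamma> \<in> R" using a(1) by blast
    moreover have "\<forall>x. (\<Sum>\<gamma>\<in>?G. a \<gamma> x * v \<gamma> x) = F x ^ Q * v i x" using t(2) unfolding a(2) .
    ultimately show "\<exists>a. (\<forall>\<gamma>\<in>?G. a \<gamma> \<in> R) \<and> (\<forall>x. (\<Sum>\<gamma>\<in>?G. a \<gamma> x * v \<gamma> x) = F x ^ Q * v i x)"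
      by (intro exI conjI)
  qed
  from bchoice[OF this] obtain \<tau> where \<tau>0: "\<forall>i\<in>?G. (\<forall>\<gamma>\<in>?G. \<tau> i \<gamma> \<in> R) \<and>
      (\<forall>x. (\<Sum>\<gamma>\<in>?G. \<tau> i \<gamma> x * v \<gamma> x) = F x ^ Q * v i x)" ..
  then have \<tau>: "\<tau> i \<gamma> \<in> R" if "i \<in> ?G" "\<gamma> \<in> ?G" for i \<gamma> using that by simp
  define t where "t i = (\<lambda>x z. \<Sum>\<gamma>\<in>?G. \<tau> i \<gamma> x * mon z \<gamma>)" for i
  have t: "t i \<in> Z N" "t i x (\<lambda>j. c j x) = F x ^ Q * v i x" if "i \<in> ?G" for i x
    unfolding t_def using that \<tau>0 by (auto intro!: gspanI)
  have RP: "R \<subseteq> pol (box n d)" using invs_pol[OF R_invs] by blast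
  interpret S: scalar_descent "pol (box n d)" R ?G v p "\<lambda>x. F x ^ Q" \<tau>
  proof unfold_locales
    show "is_subring (pol (box n d) :: ((nat \<times> nat \<Rightarrow> 'a) \<Rightarrow> 'a) set)" by (rule pol_subring)
    show "finite ?G" by simp
    \<comment> \<open>Faithfulness: the family contains the \<open>N\<close>-th power of some
      nonzero c_j, and polynomial functions form a domain.\<close>
    fix s assume s: "s \<in> pol (box n d)" "\<And>i. i \<in> ?G \<Longrightarrow> s * v i = 0"
    obtain j x0 where j: "j < d" "c j x0 \<noteq> 0" using c_nonzero by blast
    have "replicate_mset N j \<in> ?G" using j by (auto simp: multisets_of_size_def)
    then have "s * v (replicate_mset N j) = 0" by (rule s(2))
    then have "c j x ^ N * s x = 0" for x
      by (auto simp: fun_eq_iff mult.commute)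
    then have "s y = 0" for y
      using pol_domain[OF infinite pol_power[OF c_pol] s(1), of j N x0 y] j(2) by simp
    then show "s = 0" by (simp add: fun_eq_iff)
  next
    show "of_nat p = (0 :: (nat \<times> nat \<Rightarrow> 'a) \<Rightarrow> 'a)" using char by (simp add: fun_eq_iff)
    show "R \<subseteq> pol (box n d)" by (rule RP)
    show "(\<lambda>x. F x ^ Q) \<in> pol (box n d)" by (rule pol_power[OF invs_pol[OF F_inv]])
    fix i assume i: "i \<in> ?G"
    show "(\<lambda>x. F x ^ Q) * v i = (\<Sum>j\<in>?G. \<tau> i j * v j)"
      using t(2)[OF i] unfolding t_def by (simp add: fun_eq_iff sum_fun_apply)
    show "\<tau> i j \<in> R" if "j \<in> ?G" for j using \<tau>[OF i that] .
    fix I \<phi> \<psi> l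
    assume I: "is_ideal R I" and \<phi>: "rel_functional R ?G v I \<phi>" and \<psi>: "rel_functional R ?G v I \<psi>"
      and l: "l \<in> ?G"
    \<comment> \<open>The coefficients of T tensor 1 - 1 tensor T on the pair of monomials
      \<open>i\<close>, \<open>l\<close>, indexed through the inverse of
      \<open>pair_exp\<close>.\<close>
    define a where "a \<kappa> = (\<lambda>x :: nat \<times> nat \<Rightarrow> 'a. let (\<gamma>, \<mu>) = the_inv_into (?G \<times> ?G) pair_exp \<kappa> in
        (if \<mu> = l then \<tau> i \<gamma> x else 0) - (if \<gamma> = i then \<tau> l \<mu> x else 0))" for \<kappa>
    have a: "a (pair_exp (\<gamma>, \<mu>)) = (\<lambda>x. (if \<mu> = l then \<tau> i \<gamma> x else 0) - (if \<gamma> = i then \<tau> l \<mu> x else 0))"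
      if "\<gamma> \<in> ?G" "\<mu> \<in> ?G" for \<gamma> \<mu>
      unfolding a_def using that by (subst the_inv_into_f_f[OF inj_pair_exp]) auto
    have "(\<lambda>x u. \<Sum>\<kappa>\<in>mexp2 d N. a \<kappa> x * mon u \<kappa>) =
      (\<lambda>x u. t i x (u \<circ> Inl) * mon (u \<circ> Inr) l - mon (u \<circ> Inl) i * t l x (u \<circ> Inr))"
    proof (intro ext)
      fix x and u :: "nat + nat \<Rightarrow> 'a"
      have mon: "mon u (pair_exp (\<gamma>, \<mu>)) = mon (u \<circ> Inl) \<gamma> * mon (u \<circ> Inr) \<mu>" for \<gamma> \<mu>
        by (simp add: pair_exp_def mon_union mon_image comp_def)
      have "(\<Sum>\<kappa>\<in>mexp2 d N. a \<kappa> x * mon u \<kappa>) =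
          (\<Sum>\<gamma>\<in>?G. \<Sum>\<mu>\<in>?G. (if \<mu> = l then \<tau> i \<gamma> x * (mon (u \<circ> Inl) \<gamma> * mon (u \<circ> Inr) l) else 0)
            - (if \<gamma> = i then \<tau> l \<mu> x * (mon (u \<circ> Inl) i * mon (u \<circ> Inr) \<mu>) else 0))"
        unfolding sum_mexp2 by (intro sum.cong refl) (auto simp: a mon left_diff_distrib)
      also have "\<dots> = (\<Sum>\<gamma>\<in>?G. \<tau> i \<gamma> x * (mon (u \<circ> Inl) \<gamma> * mon (u \<circ> Inr) l))
          - (\<Sum>\<mu>\<in>?G. \<tau> l \<mu> x * (mon (u \<circ> Inl) i * mon (u \<circ> Inr) \<mu>))"
      proof -
        have "(\<Sum>\<gamma>\<in>?G. \<Sum>\<mu>\<in>?G. if \<gamma> = i then \<tau> l \<mu> x * (mon (u \<circ> Inl) i * mon (u \<circ> Inr) \<mu>) else 0) =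
            (\<Sum>\<mu>\<in>?G. \<tau> l \<mu> x * (mon (u \<circ> Inl) i * mon (u \<circ> Inr) \<mu>))"
          using i by (subst sum.swap) simp
        then show ?thesis using l by (simp add: sum_subtractf)
      qed
      finally show "(\<Sum>\<kappa>\<in>mexp2 d N. a \<kappa> x * mon u \<kappa>) =
          t i x (u \<circ> Inl) * mon (u \<circ> Inr) l - mon (u \<circ> Inl) i * t l x (u \<circ> Inr)"
        unfolding t_def by (simp add: sum_distrib_left sum_distrib_right mult_ac)
    qed
    also have "\<dots> \<in> J N"
      by (rule bilinear_J[OF i l N_def q2]) (use t i l in auto)
    finally have "(\<Sum>\<gamma>\<in>?G. \<Sum>\<mu>\<in>?G. a (pair_exp (\<gamma>, \<mu>)) * \<phi> \<gamma> * \<psi> \<mu>) \<in> I"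
      by (rule functional_J[OF I \<phi> \<psi>])
    also have "(\<Sum>\<gamma>\<in>?G. \<Sum>\<mu>\<in>?G. a (pair_exp (\<gamma>, \<mu>)) * \<phi> \<gamma> * \<psi> \<mu>) =
        (\<Sum>\<gamma>\<in>?G. \<Sum>\<mu>\<in>?G. (if \<mu> = l then \<tau> i \<gamma> * \<phi> \<gamma> * \<psi> l else 0) - (if \<gamma> = i then \<phi> i * (\<tau> l \<mu> * \<psi> \<mu>) else 0))"
      by (intro sum.cong refl) (auto simp: a fun_eq_iff algebra_simps)
    also have "\<dots> = (\<Sum>j\<in>?G. \<tau> i j * \<phi> j) * \<psi> l - \<phi> i * (\<Sum>j\<in>?G. \<tau> l j * \<psi> j)"
    proof -
      have "(\<Sum>\<gamma>\<in>?G. \<Sum>\<mu>\<in>?G. if \<gamma> = i then \<phi> i * (\<tau> l \<mu> * \<psi> \<mu>) else 0) = (\<Sum>\<mu>\<in>?G. \<phi> i * (\<tau> l \<mu> * \<psi> \<mu>))"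
        using i by (subst sum.swap) simp
      then show ?thesis using l by (simp add: sum_subtractf sum_distrib_left sum_distrib_right)
    qed
    finally show "(\<Sum>j\<in>?G. \<tau> i j * \<phi> j) * \<psi> l - \<phi> i * (\<Sum>j\<in>?G. \<tau> l j * \<psi> j) \<in> I" .
  qed (use prime falg_subring in auto)
  obtain m where "(\<lambda>x. F x ^ Q) ^ (p ^ m) \<in> R" using S.power_in_subring by blast
  moreover have "(\<lambda>x. F x ^ Q) ^ (p ^ m) = (\<lambda>x. F x ^ (p ^ (Suc k + m)))"
    by (simp add: fun_eq_iff power_fun_apply power_add mult.assoc flip: power_mult)
  ultimately show ?thesis by metis
qed

end

section \<open>Induction on the number of columns\<close>

lemma power_in_lower_rank:
  fixes H :: "(nat \<times> nat \<Rightarrow> 'a::field) set"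
  assumes inf: "infinite (UNIV :: 'a set)" and p: "prime p" "of_nat p = (0 :: 'a)"
    and nd: "n < d" and F: "F \<in> invs n d H"
  shows "\<exists>m. (\<lambda>x. F x ^ (p ^ m)) \<in> falg (gens n d (d - 1) H)"
proof -
  let ?R = "falg (gens n d (d - 1) H)"
  obtain c :: "nat \<Rightarrow> (nat \<times> nat \<Rightarrow> 'a) \<Rightarrow> 'a" and j x where c: "\<And>j. c j \<in> pol (box n d)"
    "\<And>i x. i < n \<Longrightarrow> (\<Sum>j<d. x (i, j) * c j x) = 0" "j < d" "c j x \<noteq> 0"
    by (rule kernel_polynomials[OF nd]) (rule that)
  have hom: "\<exists>m. (\<lambda>x. G x ^ (p ^ m)) \<in> ?R" if G: "G \<in> invs n d H" "G \<in> hpol (box n d) e" for G e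
  proof -
    have "e < 2 ^ e" by (rule less_exp)
    also have "\<dots> \<le> p ^ e" using prime_ge_2_nat[OF p(1)] by (rule power_mono) simp
    finally have "e \<le> p ^ e" by simp
    interpret descent_power n d e p H G c e
    proof unfold_locales
      show "\<exists>j<d. \<exists>x. c j x \<noteq> 0" using c(3,4) by blast
    qed (fact inf p G c(1) c(2) \<open>e \<le> p ^ e\<close>)+
    show ?thesis using power_in_R by simp
  qed
  obtain D g where g: "\<And>e. e \<le> D \<Longrightarrow> g e \<in> invs n d H \<inter> hpol (box n d) e" "F = (\<lambda>z. \<Sum>e\<le>D. g e z)"
    by (rule invs_homogeneous_parts[OF F inf]) (erule that)
  have "\<forall>e\<in>{..D}. \<exists>m. (\<lambda>x. g e x ^ (p ^ m)) \<in> ?R" using hom g(1) by blast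
  then obtain m where m: "\<And>e. e \<le> D \<Longrightarrow> (\<lambda>x. g e x ^ (p ^ m e)) \<in> ?R" by (metis atMost_iff)
  \<comment> \<open>Frobenius adds up the homogeneous parts only for an exponent common to all of
    them.\<close>
  define M where "M = (\<Sum>e\<le>D. m e)"
  have "(\<lambda>x. g e x ^ (p ^ M)) \<in> ?R" if "e \<le> D" for e
  proof -
    have "m e \<le> M" unfolding M_def using that by (intro member_le_sum) auto
    then obtain r where "M = m e + r" using le_Suc_ex by blast
    then show ?thesis using falg_power[OF m[OF that], of "p ^ r"] by (simp add: power_add flip: power_mult)
  qed
  then have "(\<lambda>x. \<Sum>e\<le>D. g e x ^ (p ^ M)) \<in> ?R" by (intro falg_sum) auto
  moreover have "F x ^ (p ^ M) = (\<Sum>e\<le>D. g e x ^ (p ^ M))" for x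
    unfolding g(2) by (rule freshman[OF p])
  ultimately have "(\<lambda>x. F x ^ (p ^ M)) \<in> ?R" by simp
  then show ?thesis by blast
qed

lemma falg_power_closed:
  fixes G :: "('x \<Rightarrow> 'a::field) set"
  assumes p: "prime p" "of_nat p = (0 :: 'a)" and G: "\<And>f. f \<in> G \<Longrightarrow> \<exists>m. (\<lambda>x. f x ^ (p ^ m)) \<in> falg G'"
    and F: "F \<in> falg G"
  shows "\<exists>m. (\<lambda>x. F x ^ (p ^ m)) \<in> falg G'"
  using F
proof (induction F rule: falg.induct)
  case (const c)
  show ?case by (rule exI, rule falg.const)
next
  case (incl f)
  then show ?case by (rule G)
next
  case (add f g)
  then obtain a b where ab: "(\<lambda>x. f x ^ (p ^ a)) \<in> falg G'" "(\<lambda>x. g x ^ (p ^ b)) \<in> falg G'" by blast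
  have "(\<lambda>x. (f x ^ (p ^ a)) ^ (p ^ b) + (g x ^ (p ^ b)) ^ (p ^ a)) \<in> falg G'"
    by (intro falg.add falg_power ab)
  moreover have "(f x ^ (p ^ a)) ^ (p ^ b) + (g x ^ (p ^ b)) ^ (p ^ a) = (f x + g x) ^ (p ^ (a + b))" for x
    unfolding freshman(1)[OF p] by (simp add: power_add mult.commute flip: power_mult)
  ultimately have "(\<lambda>x. (f x + g x) ^ (p ^ (a + b))) \<in> falg G'" by simp
  then show ?case by blast
next
  case (mult f g)
  then obtain a b where ab: "(\<lambda>x. f x ^ (p ^ a)) \<in> falg G'" "(\<lambda>x. g x ^ (p ^ b)) \<in> falg G'" by blast
  have "(\<lambda>x. (f x ^ (p ^ a)) ^ (p ^ b) * (g x ^ (p ^ b)) ^ (p ^ a)) \<in> falg G'"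
    by (intro falg.mult falg_power ab)
  moreover have "(f x ^ (p ^ a)) ^ (p ^ b) * (g x ^ (p ^ b)) ^ (p ^ a) = (f x * g x) ^ (p ^ (a + b))" for x
    by (simp add: power_add power_mult_distrib mult.commute flip: power_mult)
  ultimately have "(\<lambda>x. (f x * g x) ^ (p ^ (a + b))) \<in> falg G'" by simp
  then show ?case by blast
qed

theorem power_in_polarization:
  fixes H :: "(nat \<times> nat \<Rightarrow> 'a::field) set"
  assumes inf: "infinite (UNIV :: 'a set)" and p: "prime p" "of_nat p = (0 :: 'a)"
    and "n \<le> d"
  shows "F \<in> invs n d H \<Longrightarrow> \<exists>m. (\<lambda>x. F x ^ (p ^ m)) \<in> falg (gens n d n H)"
  using \<open>n \<le> d\<close>
proof (induction d arbitrary: F rule: dec_induct)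
  case base
  have "F (rmul n (\<lambda>(i, j). if i = j then 1 else 0) x) = F x" for x
    by (rule pol_cong[OF invs_pol[OF base]])
      (auto simp: rmul_def if_distrib[of "\<lambda>a. _ * a"] cong: if_cong)
  then have "F = (\<lambda>x. F (rmul n (\<lambda>(i, j). if i = j then 1 else 0) x))" by simp
  then have "F \<in> gens n n n H" using base unfolding gens_def by blast
  then have "(\<lambda>x. F x ^ (p ^ 0)) \<in> falg (gens n n n H)" by (simp add: falg.incl)
  then show ?case by blast
next
  case (step d)
  obtain m where m: "(\<lambda>x. F x ^ (p ^ m)) \<in> falg (gens n (Suc d) d H)"
    using power_in_lower_rank[OF inf p _ step.prems] step.hyps by auto
  have "\<exists>m. (\<lambda>x. f x ^ (p ^ m)) \<in> falg (gens n (Suc d) n H)" if f: "f \<in> gens n (Suc d) d H" for f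
  proof -
    obtain g A where g: "f = (\<lambda>x. g (rmul (Suc d) A x))" "g \<in> invs n d H" using f by (auto simp: gens_def)
    then obtain m where "(\<lambda>x. g x ^ (p ^ m)) \<in> falg (gens n d n H)" using step.IH by blast
    from falg_gens_rmul[OF this, of "Suc d" A] show ?thesis unfolding g(1) by blast
  qed
  from falg_power_closed[OF p this m] obtain k where
    "(\<lambda>x. (F x ^ (p ^ m)) ^ (p ^ k)) \<in> falg (gens n (Suc d) n H)" by blast
  then have "(\<lambda>x. F x ^ (p ^ (m + k))) \<in> falg (gens n (Suc d) n H)"
    by (simp add: power_add flip: power_mult)
  then show ?case by blast
qed

section \<open>Weyl's theorem in characteristic zero\<close>

text \<open>The sum is the iterated finite difference of the \<open>m\<close>-th power in the
  directions \<open>\<theta> s\<close>. Each difference lowers the degree, so a nonzero value needs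
  \<open>m = card S\<close>. The induction runs over all base points \<open>a\<close> and all
  smaller exponents, since one difference moves the base point and produces lower powers.\<close>

lemma polarization_identity:
  fixes \<theta> :: "'s \<Rightarrow> 'b::{comm_ring_1, semiring_char_0}"
  assumes "finite S"
  shows "m \<le> card S \<Longrightarrow> (\<Sum>T\<in>Pow S. (- 1) ^ (card S - card T) * (a + sum \<theta> T) ^ m) =
    (if m = card S then fact m * prod \<theta> S else 0)"
  using assms
proof (induction S arbitrary: a m rule: finite_induct)
  case empty
  then show ?case by simp
next
  case (insert s S)
  let ?f = "\<lambda>a m. \<Sum>T\<in>Pow S. (- 1) ^ (card S - card T) * (a + sum \<theta> T) ^ m"
  have finT: "finite T" "s \<notin> T" "card T \<le> card S" if "T \<in> Pow S" for T
    using that insert.hyps finite_subset card_mono by blast+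
  have "(\<Sum>T\<in>Pow (insert s S). (- 1) ^ (card (insert s S) - card T) * (a + sum \<theta> T) ^ m) =
      (\<Sum>T\<in>Pow S. (- 1) ^ (card (insert s S) - card T) * (a + sum \<theta> T) ^ m) +
      (\<Sum>T\<in>insert s ` Pow S. (- 1) ^ (card (insert s S) - card T) * (a + sum \<theta> T) ^ m)"
    unfolding Pow_insert using insert.hyps by (intro sum.union_disjoint) auto
  also have "(\<Sum>T\<in>insert s ` Pow S. (- 1) ^ (card (insert s S) - card T) * (a + sum \<theta> T) ^ m) =
      (\<Sum>T\<in>Pow S. (- 1) ^ (card S - card T) * (a + \<theta> s + sum \<theta> T) ^ m)"
  proof (subst sum.reindex)
    show "inj_on (insert s) (Pow S)" using insert.hyps by (auto simp: inj_on_def)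
    show "(\<Sum>T\<in>Pow S. ((\<lambda>T. (- 1) ^ (card (insert s S) - card T) * (a + sum \<theta> T) ^ m) \<circ> insert s) T) =
        (\<Sum>T\<in>Pow S. (- 1) ^ (card S - card T) * (a + \<theta> s + sum \<theta> T) ^ m)"
      using insert.hyps finT by (intro sum.cong refl) (auto simp: add.assoc)
  qed
  also have "(\<Sum>T\<in>Pow S. (- 1) ^ (card (insert s S) - card T) * (a + sum \<theta> T) ^ m) = - ?f a m"
    unfolding sum_negf[symmetric]
    using insert.hyps finT by (intro sum.cong refl) (auto simp: Suc_diff_le)
  also have "- ?f a m + (\<Sum>T\<in>Pow S. (- 1) ^ (card S - card T) * (a + \<theta> s + sum \<theta> T) ^ m) =
      (\<Sum>T\<in>Pow S. (- 1) ^ (card S - card T) * ((a + \<theta> s + sum \<theta> T) ^ m - (a + sum \<theta> T) ^ m))"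
    by (simp add: right_diff_distrib sum_subtractf)
  also have "\<dots> = (\<Sum>T\<in>Pow S. (- 1) ^ (card S - card T) *
      (\<Sum>i<m. of_nat (m choose i) * (a + sum \<theta> T) ^ i * \<theta> s ^ (m - i)))"
  proof (intro sum.cong refl arg_cong2[of _ _ _ _ "(*)"])
    fix T
    have "(a + \<theta> s + sum \<theta> T) ^ m = ((a + sum \<theta> T) + \<theta> s) ^ m" by (simp add: add_ac)
    also have "\<dots> = (\<Sum>i\<le>m. of_nat (m choose i) * (a + sum \<theta> T) ^ i * \<theta> s ^ (m - i))"
      by (rule binomial_ring)
    finally show "(a + \<theta> s + sum \<theta> T) ^ m - (a + sum \<theta> T) ^ m =
        (\<Sum>i<m. of_nat (m choose i) * (a + sum \<theta> T) ^ i * \<theta> s ^ (m - i))"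
      by (simp add: lessThan_Suc_atMost[symmetric])
  qed
  also have "\<dots> = (\<Sum>i<m. of_nat (m choose i) * \<theta> s ^ (m - i) * ?f a i)"
    by (simp add: sum_distrib_left mult_ac) (rule sum.swap)
  also have "\<dots> = (\<Sum>i<m. if i = card S then of_nat (m choose i) * \<theta> s ^ (m - i) * (fact i * prod \<theta> S) else 0)"
  proof (intro sum.cong refl)
    fix i assume "i \<in> {..<m}"
    then have "i \<le> card S" using insert.prems insert.hyps by simp
    from insert.IH[OF this, of a]
    show "of_nat (m choose i) * \<theta> s ^ (m - i) * ?f a i =
        (if i = card S then of_nat (m choose i) * \<theta> s ^ (m - i) * (fact i * prod \<theta> S) else 0)"
      by simp
  qed
  also have "\<dots> = (if m = card (insert s S) then fact m * prod \<theta> (insert s S) else 0)"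
    using insert.prems insert.hyps by (auto simp: algebra_simps)
  finally show ?case .
qed

text \<open>Elimination: some \<open>g\<close> with nonzero entry at \<open>u0\<close> serves as
  pivot and removes this coordinate from all other conditions.\<close>

lemma orthogonal_finite_test_set:
  fixes V :: "('u \<Rightarrow> 'b::field) set"
  assumes "finite U"
  shows "\<exists>A\<subseteq>V. finite A \<and> (\<forall>w. (\<forall>f\<in>A. (\<Sum>u\<in>U. w u * f u) = 0) \<longrightarrow> (\<forall>f\<in>V. (\<Sum>u\<in>U. w u * f u) = 0))"
  using assms
proof (induction U arbitrary: V rule: finite_induct)
  case empty
  then show ?case by auto
next
  case (insert u0 U)
  show ?case
  proof (cases "\<forall>f\<in>V. f u0 = 0")
    case True
    obtain A where A: "A \<subseteq> V" "finite A"
      "\<And>w. (\<forall>f\<in>A. (\<Sum>u\<in>U. w u * f u) = 0) \<Longrightarrow> (\<forall>f\<in>V. (\<Sum>u\<in>U. w u * f u) = 0)"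
      using insert.IH[of V] by blast
    have eq: "(\<Sum>u\<in>insert u0 U. w u * f u) = (\<Sum>u\<in>U. w u * f u)" if "f \<in> V" for w f
      using True insert.hyps that by simp
    show ?thesis
    proof (intro exI[of _ A] conjI allI impI ballI A(1,2))
      fix w f assume w: "\<forall>f\<in>A. (\<Sum>u\<in>insert u0 U. w u * f u) = 0" and f: "f \<in> V"
      have "\<forall>f\<in>A. (\<Sum>u\<in>U. w u * f u) = 0" using w eq A(1) by (metis subsetD)
      then have "(\<Sum>u\<in>U. w u * f u) = 0" using A(3) f by blast
      then show "(\<Sum>u\<in>insert u0 U. w u * f u) = 0" using eq[OF f] by simp
    qed
  next
    case False
    then obtain g where g: "g \<in> V" "g u0 \<noteq> 0" by blast
    define r where "r f = (\<lambda>u. f u - f u0 / g u0 * g u)" for f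
    obtain A' where A': "A' \<subseteq> r ` V" "finite A'"
      "\<And>w. (\<forall>f\<in>A'. (\<Sum>u\<in>U. w u * f u) = 0) \<Longrightarrow> (\<forall>f\<in>r ` V. (\<Sum>u\<in>U. w u * f u) = 0)"
      using insert.IH[of "r ` V"] by blast
    obtain A where A: "A \<subseteq> V" "finite A" "A' = r ` A"
      using finite_subset_image[OF A'(2,1)] by blast
    have sum_r: "(\<Sum>u\<in>U. w u * r f u) = (\<Sum>u\<in>insert u0 U. w u * f u) - f u0 / g u0 * (\<Sum>u\<in>insert u0 U. w u * g u)" for w f
    proof -
      have "(\<Sum>u\<in>insert u0 U. w u * f u) - f u0 / g u0 * (\<Sum>u\<in>insert u0 U. w u * g u) =
          (\<Sum>u\<in>insert u0 U. w u * r f u)"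
        by (simp add: r_def right_diff_distrib sum_subtractf sum_distrib_left mult_ac)
      then show ?thesis using insert.hyps g by (simp add: r_def)
    qed
    show ?thesis
    proof (intro exI[of _ "insert g A"] conjI allI impI ballI)
      fix w f assume w: "\<forall>f\<in>insert g A. (\<Sum>u\<in>insert u0 U. w u * f u) = 0" and f: "f \<in> V"
      then have "\<forall>f\<in>A'. (\<Sum>u\<in>U. w u * f u) = 0" unfolding A(3) by (simp add: sum_r)
      then have "(\<Sum>u\<in>U. w u * r f u) = 0" using A'(3) f by blast
      then show "(\<Sum>u\<in>insert u0 U. w u * f u) = 0" using w by (simp add: sum_r)
    qed (use A g in auto)
  qed
qed

text \<open>Gram-Schmidt for a possibly dependent family: if the residue h' of \<open>h\<close> has
  norm zero, positivity makes it vanish on \<open>U\<close>, so that the coefficient 0 is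
  correct.\<close>

lemma orthogonal_projection_finite:
  fixes w :: "'u \<Rightarrow> 'b::linordered_field"
  assumes "finite U" "finite A"
  shows "\<exists>a. \<forall>f\<in>A. (\<Sum>u\<in>U. (w u - (\<Sum>g\<in>A. a g * g u)) * f u) = 0"
  using assms(2)
proof (induction A arbitrary: w rule: finite_induct)
  case empty
  then show ?case by simp
next
  case (insert h A)
  let ?ip = "\<lambda>f g. \<Sum>u\<in>U. f u * g u"
  obtain a where a: "\<forall>f\<in>A. ?ip (\<lambda>u. w u - (\<Sum>g\<in>A. a g * g u)) f = 0" using insert.IH by blast
  obtain b where b: "\<forall>f\<in>A. ?ip (\<lambda>u. h u - (\<Sum>g\<in>A. b g * g u)) f = 0" using insert.IH by blast
  define w' where "w' u = w u - (\<Sum>g\<in>A. a g * g u)" for u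
  define h' where "h' u = h u - (\<Sum>g\<in>A. b g * g u)" for u
  have ortho: "?ip w' f = 0" "?ip h' f = 0" if "f \<in> A" for f
    using a b that by (auto simp: w'_def h'_def)
  have h'A: "?ip v h' = ?ip v h" if "\<And>f. f \<in> A \<Longrightarrow> ?ip v f = 0" for v
  proof -
    have "?ip v h' = ?ip v h - (\<Sum>g\<in>A. b g * ?ip v g)"
      by (simp add: h'_def right_diff_distrib sum_subtractf sum_distrib_left mult_ac) (rule sum.swap)
    then show ?thesis using that by simp
  qed
  define c where "c = (if ?ip h' h' = 0 then 0 else ?ip w' h' / ?ip h' h')"
  have wh: "?ip w' h' = c * ?ip h' h'"
  proof (cases "?ip h' h' = 0")
    case True
    then have "\<forall>u\<in>U. h' u * h' u = 0"
      using sum_nonneg_eq_0_iff[OF assms(1), of "\<lambda>u. h' u * h' u"] by simp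
    then show ?thesis using True by (simp add: c_def)
  qed (simp add: c_def)
  define d where "d g = (if g = h then c else a g - c * b g)" for g
  have res: "w u - (\<Sum>g\<in>insert h A. d g * g u) = w' u - c * h' u" for u
  proof -
    have "(\<Sum>g\<in>A. d g * g u) = (\<Sum>g\<in>A. (a g - c * b g) * g u)"
      using insert.hyps by (intro sum.cong) (auto simp: d_def)
    then show ?thesis
      using insert.hyps
      by (simp add: d_def w'_def h'_def algebra_simps sum_subtractf sum_distrib_left)
  qed
  have lin: "?ip (\<lambda>u. w' u - c * h' u) f = ?ip w' f - c * ?ip h' f" for f
    by (simp add: left_diff_distrib sum_subtractf sum_distrib_left mult.assoc)
  show ?case
  proof (intro exI[of _ d] ballI)
    fix f assume f: "f \<in> insert h A"
    have "?ip w' h = ?ip w' h'" "?ip h' h = ?ip h' h'"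
      using h'A[of w'] h'A[of h'] ortho by simp_all
    then show "(\<Sum>u\<in>U. (w u - (\<Sum>g\<in>insert h A. d g * g u)) * f u) = 0"
      unfolding res lin using f ortho wh by auto
  qed
qed

lemma orthogonal_projection:
  fixes V :: "('u \<Rightarrow> 'b::linordered_field) set"
  assumes "finite U"
  obtains A a where "A \<subseteq> V" "finite A" "\<And>f. f \<in> V \<Longrightarrow> (\<Sum>u\<in>U. (w u - (\<Sum>g\<in>A. a g * g u)) * f u) = 0"
proof -
  obtain A where A: "A \<subseteq> V" "finite A"
    "\<And>w. (\<forall>f\<in>A. (\<Sum>u\<in>U. w u * f u) = 0) \<Longrightarrow> (\<forall>f\<in>V. (\<Sum>u\<in>U. w u * f u) = 0)"
    using orthogonal_finite_test_set[OF assms, of V] by blast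
  obtain a where a: "\<forall>f\<in>A. (\<Sum>u\<in>U. (w u - (\<Sum>g\<in>A. a g * g u)) * f u) = 0"
    using orthogonal_projection_finite[OF assms A(2)] by blast
  show thesis by (rule that[OF A(1,2), of a]) (use A(3)[OF a] in blast)
qed

section \<open>Tensor powers of matrices of small rank\<close>

abbreviation words :: "'u set \<Rightarrow> nat \<Rightarrow> 'u list set" where
  "words P e \<equiv> {us. set us \<subseteq> P \<and> length us = e}"

text \<open>Words index the entries of the tensor power of degree \<open>e\<close>; the left side is
  the scalar product of the tensor powers of \<open>A\<close> and \<open>Y\<close>.\<close>

lemma sum_words_power:
  fixes A Y :: "'u \<Rightarrow> 'b::comm_semiring_1"
  assumes "finite P"
  shows "(\<Sum>us\<in>words P e. prod_list (map A us) * prod_list (map Y us)) = (\<Sum>p\<in>P. A p * Y p) ^ e"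
proof (induction e)
  case 0
  have "words P 0 = {[]}" by auto
  then show ?case by simp
next
  case (Suc e)
  have "words P (Suc e) = (\<lambda>x. fst x # snd x) ` (P \<times> words P e)"
    by (auto simp: image_iff length_Suc_conv)
  moreover have "inj_on (\<lambda>x. fst x # snd x) (P \<times> words P e)" by (auto simp: inj_on_def)
  ultimately have "(\<Sum>us\<in>words P (Suc e). prod_list (map A us) * prod_list (map Y us)) =
      (\<Sum>(p, us)\<in>P \<times> words P e. (A p * Y p) * (prod_list (map A us) * prod_list (map Y us)))"
    by (simp add: sum.reindex case_prod_beta mult_ac)
  also have "\<dots> = (\<Sum>p\<in>P. A p * Y p) * (\<Sum>us\<in>words P e. prod_list (map A us) * prod_list (map Y us))"
    by (simp add: sum_product sum.cartesian_product)
  finally show ?case using Suc by simp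
qed

lemma common_denominator:
  fixes a :: "'g \<Rightarrow> rat"
  assumes "finite A"
  shows "\<exists>N::int. N \<noteq> 0 \<and> (\<forall>g\<in>A. \<exists>z::int. of_int N * a g = of_int z)"
  using assms
proof (induction A rule: finite_induct)
  case empty
  then show ?case by (intro exI[of _ 1]) simp
next
  case (insert h A)
  then obtain N where N: "N \<noteq> 0" "\<forall>g\<in>A. \<exists>z::int. of_int N * a g = of_int z" by blast
  obtain u v where uv: "v > 0" "a h = of_int u / of_int v"
    by (metis quotient_of_denom_pos quotient_of_div surj_pair)
  show ?case
  proof (rule exI[of _ "v * N"], intro conjI ballI)
    show "v * N \<noteq> 0" using N uv by simp
    fix g assume g: "g \<in> insert h A"
    show "\<exists>z::int. of_int (v * N) * a g = of_int z"
    proof (cases "g = h")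
      case True
      then have "of_int (v * N) * a g = of_int (N * u)" using uv by simp
      then show ?thesis by blast
    next
      case False
      then obtain z :: int where "of_int N * a g = of_int z" using g N by blast
      then have "of_int (v * N) * a g = of_int (v * z)" by (simp add: mult.assoc)
      then show ?thesis by blast
    qed
  qed
qed

lemma mon_mset: "mon y (mset ps) = (\<Prod>s<length ps. y (ps ! s))"
proof -
  have "mon y (mset ps) = prod_list (map y ps)" by (induction ps) simp_all
  then show ?thesis by (simp add: prod.list_conv_set_nth atLeast0LessThan)
qed

text \<open>
  The identity matrix, seen through polynomials of degree \<open>e\<close> in \<open>x A\<close> with \<open>x\<close> an \<open>n \<times> d\<close> matrix, is
  an integral combination of matrices of rank at most \<open>n\<close>: with respect to the scalar product
  \<open>tr (A\<^sup>t Y)\<^sup>e\<close> its orthogonal projection to the span of all \<open>A\<close> of rank at most \<open>n\<close> has the same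
  products with all \<open>Y\<close> of rank at most \<open>n\<close>.
\<close>

lemma integral_polarization:
  fixes n d e :: nat
  obtains I :: "(nat \<times> nat \<Rightarrow> int) set" and N :: int and z B C where "finite I" "N \<noteq> 0"
    "\<And>A t j. A \<in> I \<Longrightarrow> A (t, j) = (\<Sum>l<n. B A (t, l) * C A (l, j))"
    "\<And>\<kappa> x. \<kappa> \<in> multisets_of_size (box n d) e \<Longrightarrow>
      N * mon x \<kappa> = (\<Sum>A\<in>I. z A * mon (\<lambda>(i, j). \<Sum>t<d. x (i, t) * A (t, j)) \<kappa>)"
proof -
  define D :: "(nat \<times> nat \<Rightarrow> int) set"
    where "D = {A. \<exists>B C. \<forall>t j. A (t, j) = (\<Sum>l<n. B (t, l) * C (l, j))}"
  define tens :: "(nat \<times> nat \<Rightarrow> int) \<Rightarrow> (nat \<times> nat) list \<Rightarrow> rat"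
    where "tens A us = prod_list (map (\<lambda>p. of_int (A p)) us)" for A us
  define ip :: "(nat \<times> nat \<Rightarrow> int) \<Rightarrow> (nat \<times> nat \<Rightarrow> int) \<Rightarrow> int"
    where "ip A Y = (\<Sum>p\<in>box d d. A p * Y p)" for A Y
  define one :: "nat \<times> nat \<Rightarrow> int" where "one = (\<lambda>(i, j). if i = j then 1 else 0)"
  let ?U = "words (box d d) e"
  have finU: "finite ?U" using finite_lists_length_eq[of "box d d" e] by simp
  have tens_ip: "(\<Sum>us\<in>?U. tens A us * tens Y us) = of_int (ip A Y) ^ e" for A Y
    unfolding tens_def by (subst sum_words_power) (simp_all add: ip_def)
  obtain T a where T: "T \<subseteq> tens ` D" "finite T"
    and orth: "\<And>f. f \<in> tens ` D \<Longrightarrow> (\<Sum>us\<in>?U. (tens one us - (\<Sum>g\<in>T. a g * g us)) * f us) = 0"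
    by (rule orthogonal_projection[OF finU]) (rule that)
  obtain I0 where I0: "I0 \<subseteq> D" "finite I0" "T = tens ` I0"
    using finite_subset_image[OF T(2,1)] by blast
  \<comment> \<open>Different matrices may have the same tensor power; one matrix is kept for each
    tensor.\<close>
  obtain I where I: "I \<subseteq> I0" "inj_on tens I" "T = tens ` I"
    using subset_image_inj[of T tens I0] I0(3) by auto
  have finI: "finite I" using I(1) I0(2) finite_subset by blast
  define b where "b A = a (tens A)" for A
  have powers: "of_int (ip one Y) ^ e = (\<Sum>A\<in>I. b A * of_int (ip A Y) ^ e)" if Y: "Y \<in> D" for Y
  proof -
    have "0 = (\<Sum>us\<in>?U. (tens one us - (\<Sum>A\<in>I. b A * tens A us)) * tens Y us)"
      using orth[of "tens Y"] Y by (simp add: I(3) sum.reindex[OF I(2)] b_def)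
    also have "\<dots> = (\<Sum>us\<in>?U. tens one us * tens Y us) - (\<Sum>us\<in>?U. \<Sum>A\<in>I. b A * (tens A us * tens Y us))"
      by (simp add: left_diff_distrib sum_subtractf sum_distrib_right mult.assoc)
    also have "(\<Sum>us\<in>?U. \<Sum>A\<in>I. b A * (tens A us * tens Y us)) = (\<Sum>A\<in>I. b A * (\<Sum>us\<in>?U. tens A us * tens Y us))"
      unfolding sum_distrib_left by (rule sum.swap)
    finally show ?thesis by (simp add: tens_ip)
  qed
  obtain N :: int where N: "N \<noteq> 0" "\<forall>A\<in>I. \<exists>z::int. of_int N * b A = of_int z"
    using common_denominator[OF finI] by blast
  then obtain z where z: "\<And>A. A \<in> I \<Longrightarrow> of_int N * b A = of_int (z A)" by metis
  have powers_int: "N * ip one Y ^ e = (\<Sum>A\<in>I. z A * ip A Y ^ e)" if Y: "Y \<in> D" for Y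
  proof -
    have "of_int N * of_int (ip one Y) ^ e = (\<Sum>A\<in>I. of_int N * b A * of_int (ip A Y) ^ e)"
      unfolding powers[OF Y] by (simp add: sum_distrib_left mult.assoc)
    also have "\<dots> = (\<Sum>A\<in>I. of_int (z A) * of_int (ip A Y) ^ e)"
      by (intro sum.cong refl) (simp add: z)
    finally have "(of_int (N * ip one Y ^ e) :: rat) = of_int (\<Sum>A\<in>I. z A * ip A Y ^ e)" by simp
    then show ?thesis by (simp only: of_int_eq_iff)
  qed
  have "\<forall>A\<in>I. \<exists>B C. \<forall>t j. A (t, j) = (\<Sum>l<n. B (t, l) * C (l, j))"
    using I(1) I0(1) by (auto simp: D_def)
  then obtain B C where BC: "\<And>A t j. A \<in> I \<Longrightarrow> A (t, j) = (\<Sum>l<n. B A (t, l) * C A (l, j))" by metis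
  have "N * fact e * mon x \<kappa> = (\<Sum>A\<in>I. z A * fact e * mon (\<lambda>(i, j). \<Sum>t<d. x (i, t) * A (t, j)) \<kappa>)"
    if \<kappa>: "\<kappa> \<in> multisets_of_size (box n d) e" for \<kappa> x
  proof -
    obtain ps where ps: "mset ps = \<kappa>" using ex_mset by blast
    then have ps': "set ps \<subseteq> box n d" "length ps = e"
      using \<kappa> by (auto simp: multisets_of_size_def)
    \<comment> \<open>\<open>Y S\<close> factors through the transpose of \<open>x\<close>, so its
      rank is at most \<open>n\<close>. Its product with \<open>A\<close> is the sum of the entries
      of x A at the positions in \<open>S\<close>; polarization recovers from the e-th powers of
      these sums the product of all the entries.\<close>
    define Y where "Y S = (\<lambda>(t, j). \<Sum>s\<in>S. x (fst (ps ! s), t) * (if j = snd (ps ! s) then 1 else 0))" for S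
    define \<theta> where "\<theta> A s = (\<Sum>t<d. x (fst (ps ! s), t) * A (t, snd (ps ! s)))" for A :: "nat \<times> nat \<Rightarrow> int" and s
    have nth: "fst (ps ! s) < n" "snd (ps ! s) < d" if "s < e" for s
    proof -
      have "ps ! s \<in> box n d" using ps' that nth_mem[of s ps] by blast
      then show "fst (ps ! s) < n" "snd (ps ! s) < d" by (auto simp: mem_Times_iff)
    qed
    have ipY: "ip A (Y S) = sum (\<theta> A) S" if "S \<subseteq> {..<e}" for A S
    proof -
      have "ip A (Y S) = (\<Sum>t<d. \<Sum>j<d. \<Sum>s\<in>S. A (t, j) * (x (fst (ps ! s), t) * (if j = snd (ps ! s) then 1 else 0)))"
        unfolding ip_def Y_def sum.cartesian_product' sum_distrib_left prod.case ..
      also have "\<dots> = (\<Sum>t<d. \<Sum>s\<in>S. \<Sum>j<d. A (t, j) * (x (fst (ps ! s), t) * (if j = snd (ps ! s) then 1 else 0)))"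
        by (intro sum.cong refl sum.swap)
      also have "\<dots> = (\<Sum>s\<in>S. \<Sum>t<d. \<Sum>j<d. A (t, j) * (x (fst (ps ! s), t) * (if j = snd (ps ! s) then 1 else 0)))"
        by (rule sum.swap)
      also have "\<dots> = sum (\<theta> A) S"
        unfolding \<theta>_def using nth that
        by (intro sum.cong refl) (auto simp: if_distrib[of "\<lambda>x. _ * x"] mult.commute cong: if_cong)
      finally show ?thesis .
    qed
    have YD: "Y S \<in> D" if S: "S \<subseteq> {..<e}" for S
    proof -
      have "Y S (t, j) = (\<Sum>l<n. x (l, t) * (\<Sum>s\<in>S. if l = fst (ps ! s) \<and> j = snd (ps ! s) then 1 else 0))" for t j
      proof -
        have "(\<Sum>l<n. x (l, t) * (\<Sum>s\<in>S. if l = fst (ps ! s) \<and> j = snd (ps ! s) then 1 else 0)) =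
            (\<Sum>s\<in>S. \<Sum>l<n. if l = fst (ps ! s) then x (l, t) * (if j = snd (ps ! s) then 1 else 0) else 0)"
          unfolding sum_distrib_left by (subst sum.swap) (intro sum.cong refl, auto)
        also have "\<dots> = Y S (t, j)"
          unfolding Y_def prod.case using nth S by (intro sum.cong refl) auto
        finally show ?thesis by simp
      qed
      then show ?thesis unfolding D_def
        by (intro CollectI exI[of _ "\<lambda>(t, l). x (l, t)"]
            exI[of _ "\<lambda>(l, j). \<Sum>s\<in>S. if l = fst (ps ! s) \<and> j = snd (ps ! s) then 1 else 0"]) simp
    qed
    have pol: "(\<Sum>S\<in>Pow {..<e}. (- 1) ^ (e - card S) * sum (\<theta> A) S ^ e) = fact e * prod (\<theta> A) {..<e}" for A
      using polarization_identity[of "{..<e}" e 0 "\<theta> A"] by simp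
    have mon_\<theta>: "prod (\<theta> A) {..<e} = mon (\<lambda>(i, j). \<Sum>t<d. x (i, t) * A (t, j)) \<kappa>" for A
    proof -
      have "mon y \<kappa> = (\<Prod>s<e. y (ps ! s))" for y :: "nat \<times> nat \<Rightarrow> int"
        unfolding ps[symmetric] mon_mset ps'(2) ..
      then show ?thesis by (simp add: \<theta>_def case_prod_beta)
    qed
    have "\<theta> one s = x (ps ! s)" if "s < e" for s
      using nth(2)[OF that] by (simp add: \<theta>_def one_def if_distrib[of "\<lambda>x. _ * x"] cong: if_cong)
    then have one: "prod (\<theta> one) {..<e} = mon x \<kappa>"
      unfolding ps[symmetric] mon_mset ps'(2) by simp
    have "N * fact e * mon x \<kappa> = (\<Sum>S\<in>Pow {..<e}. (- 1) ^ (e - card S) * (N * ip one (Y S) ^ e))"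
      by (simp add: one[symmetric] mult.assoc pol[symmetric] ipY sum_distrib_left mult.left_commute)
    also have "\<dots> = (\<Sum>S\<in>Pow {..<e}. (- 1) ^ (e - card S) * (\<Sum>A\<in>I. z A * sum (\<theta> A) S ^ e))"
    proof (intro sum.cong refl arg_cong2[of _ _ _ _ "(*)"])
      fix S assume "S \<in> Pow {..<e}"
      then have S: "S \<subseteq> {..<e}" by simp
      show "N * ip one (Y S) ^ e = (\<Sum>A\<in>I. z A * sum (\<theta> A) S ^ e)"
        using powers_int[OF YD[OF S]] by (simp add: ipY[OF S])
    qed
    also have "\<dots> = (\<Sum>A\<in>I. z A * (\<Sum>S\<in>Pow {..<e}. (- 1) ^ (e - card S) * sum (\<theta> A) S ^ e))"
      by (simp add: sum_distrib_left mult_ac) (rule sum.swap)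
    finally show ?thesis by (simp add: pol mon_\<theta> mult.assoc)
  qed
  then show thesis
    using that[of I "N * fact e" B C "\<lambda>A. z A * fact e"] finI N(1) BC by simp
qed

section \<open>Transfer of the integral identity to characteristic zero\<close>

lemma mon_of_int: "mon (\<lambda>i. of_int (x i)) \<kappa> = of_int (mon x \<kappa>)"
  by (induction \<kappa>) auto

text \<open>Coordinates are released from \<open>Z\<close> one at a time, each by a polynomial in
  one variable with infinitely many zeros. Coordinates outside \<open>I\<close> are first replaced
  by an element of \<open>Z\<close>.\<close>

lemma pol_vanish:
  fixes F :: "('i \<Rightarrow> 'a::field) \<Rightarrow> 'a"
  assumes F: "F \<in> pol I" and I: "finite I" and Z: "infinite Z" and zero: "\<And>x. range x \<subseteq> Z \<Longrightarrow> F x = 0"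
  shows "F x = 0"
proof -
  obtain z0 where z0: "z0 \<in> Z" using Z by fastforce
  have "F x = 0" if "finite E" "\<And>i. i \<notin> E \<Longrightarrow> x i \<in> Z" for E x
    using that
  proof (induction E arbitrary: x rule: finite_induct)
    case empty
    then show ?case using zero by auto
  next
    case (insert i E)
    obtain p where "\<forall>t. F (\<lambda>j. (x(i := 0)) j + t * (if j = i then 1 else 0)) = poly p t"
      using pol_line[OF F, of "x(i := 0)" "\<lambda>j. if j = i then 1 else 0"] by auto
    moreover have "(\<lambda>j. (x(i := 0)) j + t * (if j = i then 1 else 0)) = x(i := t)" for t by auto
    ultimately have p: "F (x(i := t)) = poly p t" for t by simp
    have "Z \<subseteq> {t. poly p t = 0}"
    proof
      fix t assume "t \<in> Z"
      then have "F (x(i := t)) = 0" using insert.prems by (intro insert.IH) auto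
      then show "t \<in> {t. poly p t = 0}" by (simp add: p)
    qed
    then have "p = 0" using Z poly_roots_finite finite_subset by blast
    then show ?case using p[of "x i"] by simp
  qed
  from this[OF I, of "\<lambda>i. if i \<in> I then x i else z0"] z0
  have "F (\<lambda>i. if i \<in> I then x i else z0) = 0" by simp
  moreover have "F x = F (\<lambda>i. if i \<in> I then x i else z0)" by (rule pol_cong[OF F]) simp
  ultimately show ?thesis by simp
qed

theorem polarization_char_0:
  fixes H :: "(nat \<times> nat \<Rightarrow> 'a::field) set"
  assumes char: "CHAR('a) = 0" and F: "F \<in> invs n d H"
  shows "F \<in> falg (gens n d n H)"
proof -
  have int0: "(of_int k :: 'a) = 0 \<longleftrightarrow> k = 0" for k
    using of_int_eq_0_iff_char_dvd[where 'a = 'a, of k] char by simp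
  have inj: "inj (of_int :: int \<Rightarrow> 'a)"
  proof (rule injI)
    fix a b assume "(of_int a :: 'a) = of_int b"
    then have "(of_int (a - b) :: 'a) = 0" by simp
    then show "a = b" by (simp only: int0)
  qed
  have infZ: "infinite (range (of_int :: int \<Rightarrow> 'a))"
    using finite_imageD[OF _ inj] infinite_UNIV_int by blast
  then have inf: "infinite (UNIV :: 'a set)" using finite_subset[OF subset_UNIV] by (rule contrapos_nn)
  have hom: "G \<in> falg (gens n d n H)" if G: "G \<in> invs n d H" "G \<in> hpol (box n d) e" for G e
  proof -
    obtain I :: "(nat \<times> nat \<Rightarrow> int) set" and N z B C where I: "finite I" and N: "N \<noteq> 0"
      and BC: "\<And>A t j. A \<in> I \<Longrightarrow> A (t, j) = (\<Sum>l<n. B A (t, l) * C A (l, j))"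
      and id: "\<And>\<kappa> x. \<kappa> \<in> multisets_of_size (box n d) e \<Longrightarrow>
        N * mon x \<kappa> = (\<Sum>A\<in>I. z A * mon (\<lambda>(i, j). \<Sum>t<d. x (i, t) * A (t, j)) \<kappa>)"
      by (rule integral_polarization[of n d e]) (rule that)
    define M :: "(nat \<times> nat \<Rightarrow> int) \<Rightarrow> nat \<times> nat \<Rightarrow> 'a" where "M A p = of_int (A p)" for A p
    have mon_id: "of_int N * mon x \<kappa> = (\<Sum>A\<in>I. of_int (z A) * mon (rmul d (M A) x) \<kappa>)"
      if \<kappa>: "\<kappa> \<in> multisets_of_size (box n d) e" for \<kappa> x
    proof -
      have mp: "(\<lambda>x. mon x \<kappa>) \<in> pol (box n d)"
        using pspan.mono[of \<kappa> "{\<kappa>. set_mset \<kappa> \<subseteq> box n d}" 1] \<kappa> by (simp add: multisets_of_size_def)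
      have "of_int N * mon x \<kappa> - (\<Sum>A\<in>I. of_int (z A) * mon (rmul d (M A) x) \<kappa>) = 0"
      \<comment> \<open>At matrices with entries from the image of the integers this is the integral
        identity; in characteristic 0 that image is infinite.\<close>
      proof (rule pol_vanish[where I = "box n d" and Z = "range of_int" and x = x
          and F = "\<lambda>x. of_int N * mon x \<kappa> - (\<Sum>A\<in>I. of_int (z A) * mon (rmul d (M A) x) \<kappa>)"])
        show "(\<lambda>x. of_int N * mon x \<kappa> - (\<Sum>A\<in>I. of_int (z A) * mon (rmul d (M A) x) \<kappa>)) \<in> pol (box n d)"
          by (intro pol_diff pol_sum pspan_scale mp rmul_pol[OF mp])
        fix x :: "nat \<times> nat \<Rightarrow> 'a" assume "range x \<subseteq> range of_int"
        then have range: "x p \<in> range of_int" for p by (rule subsetD) (rule rangeI)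
        have "\<forall>p. \<exists>k. x p = of_int k"
        proof
          fix p show "\<exists>k. x p = of_int k" using range[of p] by (elim rangeE) (rule exI)
        qed
        then obtain y where "\<forall>p. x p = of_int (y p)" by (rule choice[THEN exE])
        then have y: "x = (\<lambda>p. of_int (y p))" by (intro ext) (rule spec)
        have "rmul d (M A) x = (\<lambda>p. of_int ((\<lambda>(i, j). \<Sum>t<d. y (i, t) * A (t, j)) p))" for A
          by (auto simp: y rmul_def M_def fun_eq_iff)
        then have "of_int N * mon x \<kappa> - (\<Sum>A\<in>I. of_int (z A) * mon (rmul d (M A) x) \<kappa>) =
            of_int (N * mon y \<kappa> - (\<Sum>A\<in>I. z A * mon (\<lambda>(i, j). \<Sum>t<d. y (i, t) * A (t, j)) \<kappa>))"
          by (simp add: y mon_of_int)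
        then show "of_int N * mon x \<kappa> - (\<Sum>A\<in>I. of_int (z A) * mon (rmul d (M A) x) \<kappa>) = 0"
          by (simp add: id[OF \<kappa>])
      qed (use infZ in simp_all)
      then show ?thesis by simp
    qed
    have "of_int N * G x = (\<Sum>A\<in>I. of_int (z A) * G (rmul d (M A) x))" for x
      using G(2)
    proof (induction G rule: pspan.induct)
      case (add f g)
      then show ?case by (simp add: distrib_left sum.distrib)
    next
      case (mono \<kappa> c)
      have "of_int N * (c * mon x \<kappa>) = c * (of_int N * mon x \<kappa>)" by simp
      also have "\<dots> = (\<Sum>A\<in>I. of_int (z A) * (c * mon (rmul d (M A) x) \<kappa>))"
        unfolding mon_id[OF mono]
        by (simp add: sum_distrib_left mult_ac)
      finally show ?case .
    qed simp
    note avg = this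
    have nz: "(of_int N :: 'a) \<noteq> 0" using N int0 by simp
    have G_eq: "G = (\<lambda>x. inverse (of_int N) * (\<Sum>A\<in>I. of_int (z A) * G (rmul d (M A) x)))"
    proof
      fix x
      have "G x = inverse (of_int N) * (of_int N * G x)"
        using nz by (simp only: mult.assoc[symmetric] left_inverse mult_1_left not_False_eq_True)
      then show "G x = inverse (of_int N) * (\<Sum>A\<in>I. of_int (z A) * G (rmul d (M A) x))"
        by (subst (asm) avg)
    qed
    have "(\<lambda>x. G (rmul d (M A) x)) \<in> gens n d n H" if A: "A \<in> I" for A
    proof -
      have "M A = rmul n (M (C A)) (M (B A))"
        by (simp add: M_def rmul_def fun_eq_iff BC[OF A])
      then have "(\<lambda>x. G (rmul d (M A) x)) = (\<lambda>x. G (rmul n (M (C A)) (rmul d (M (B A)) x)))"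
        by (simp add: rmul_rmul)
      then show ?thesis unfolding gens_def
        by (intro CollectI exI[of _ "\<lambda>x. G (rmul n (M (C A)) x)"] exI[of _ "M (B A)"] conjI)
          (assumption, rule invs_rmul[OF G(1)])
    qed
    then have "(\<lambda>x. inverse (of_int N) * (\<Sum>A\<in>I. of_int (z A) * G (rmul d (M A) x))) \<in> falg (gens n d n H)"
      by (intro falg_scale falg_sum falg.incl)
    then show ?thesis by (subst G_eq)
  qed
  obtain D g where g: "\<And>e. e \<le> D \<Longrightarrow> g e \<in> invs n d H \<inter> hpol (box n d) e" "F = (\<lambda>z. \<Sum>e\<le>D. g e z)"
    by (rule invs_homogeneous_parts[OF F inf]) (erule that)
  show ?thesis unfolding g(2) using hom g(1) by (intro falg_sum) auto
qed

section \<open>Polynomial functions on matrices\<close>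

text \<open>
  The function \<open>($$) x\<close> of the entries of a matrix \<open>x\<close> is arbitrary outside the index range, but
  polynomials in \<open>pol (box n d)\<close> do not see this.
\<close>

definition mat_fun :: "nat \<Rightarrow> nat \<Rightarrow> ((nat \<times> nat \<Rightarrow> 'a) \<Rightarrow> 'a) \<Rightarrow> 'a mat \<Rightarrow> 'a" where
  "mat_fun n d F = (\<lambda>x\<in>carrier_mat n d. F (($$) x))"

lemma mat_fun_apply: "x \<in> carrier_mat n d \<Longrightarrow> mat_fun n d F x = F (($$) x)"
  by (simp add: mat_fun_def)

lemma fun_ring_mat_fun:
  "mat_fun n d F \<otimes>\<^bsub>fun_ring (carrier_mat n d)\<^esub> mat_fun n d G = mat_fun n d (\<lambda>x. F x * G x)"
  "mat_fun n d F \<oplus>\<^bsub>fun_ring (carrier_mat n d)\<^esub> mat_fun n d G = mat_fun n d (\<lambda>x. F x + G x)"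
  "\<one>\<^bsub>fun_ring (carrier_mat n d)\<^esub> = mat_fun n d (\<lambda>x. 1)"
  "\<zero>\<^bsub>fun_ring (carrier_mat n d)\<^esub> = mat_fun n d (\<lambda>x. 0)"
  by (auto simp: fun_ring_def mat_fun_def fun_eq_iff restrict_def)

lemma fun_ring_minus_mat_fun:
  "\<ominus>\<^bsub>fun_ring (carrier_mat n d)\<^esub> mat_fun n d F = mat_fun n d (\<lambda>x. - 1 * F x)"
proof -
  interpret cring "fun_ring (carrier_mat n d) :: ('a mat \<Rightarrow> 'a) ring" by (rule fun_ring_cring)
  have "mat_fun n d G \<in> carrier (fun_ring (carrier_mat n d))" for G :: "(nat \<times> nat \<Rightarrow> 'a) \<Rightarrow> 'a"
    by (auto simp: mat_fun_def fun_ring_def)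
  then show ?thesis by (intro minus_equality) (simp_all add: fun_ring_mat_fun)
qed

lemma mat_fun_eq_iff:
  fixes F G :: "(nat \<times> nat \<Rightarrow> 'a::field) \<Rightarrow> 'a"
  assumes "F \<in> pol (box n d)" "G \<in> pol (box n d)"
  shows "mat_fun n d F = mat_fun n d G \<longleftrightarrow> F = G"
proof
  assume eq: "mat_fun n d F = mat_fun n d G"
  show "F = G"
  proof
    fix y :: "nat \<times> nat \<Rightarrow> 'a"
    let ?x = "mat n d y"
    have x: "?x \<in> carrier_mat n d" by simp
    have "F y = F (($$) ?x)" by (rule pol_cong[OF assms(1)]) auto
    also have "\<dots> = G (($$) ?x)"
      using fun_cong[OF eq, of ?x] unfolding mat_fun_apply[OF x] .
    also have "\<dots> = G y" by (rule pol_cong[OF assms(2)]) auto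
    finally show "F y = G y" .
  qed
qed simp

lemma generated_alg_mat_fun:
  "generated_alg (carrier_mat n d) (mat_fun n d ` B) = mat_fun n d ` falg B"
proof (intro equalityI subsetI)
  fix f assume "f \<in> generated_alg (carrier_mat n d) (mat_fun n d ` B)"
  then show "f \<in> mat_fun n d ` falg B"
    unfolding generated_alg_def
  proof (induction f rule: generate_ring.induct)
    case one
    then show ?case unfolding fun_ring_mat_fun by (intro imageI falg.const)
  next
    case (incl h)
    then consider c where "h = mat_fun n d (\<lambda>x. c)" | "h \<in> mat_fun n d ` B"
      unfolding mat_fun_def[of n d "\<lambda>x. _"] by blast
    then show ?case by cases (auto intro: falg.intros)
  next
    case (a_inv h)
    then obtain F where F: "F \<in> falg B" "h = mat_fun n d F" by blast
    show ?case unfolding F(2) fun_ring_minus_mat_fun by (intro imageI falg_scale F(1))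
  next
    case (eng_add h1 h2)
    then obtain F G where "F \<in> falg B" "h1 = mat_fun n d F" "G \<in> falg B" "h2 = mat_fun n d G" by blast
    then show ?case by (simp only: fun_ring_mat_fun) (intro imageI falg.add)
  next
    case (eng_mult h1 h2)
    then obtain F G where "F \<in> falg B" "h1 = mat_fun n d F" "G \<in> falg B" "h2 = mat_fun n d G" by blast
    then show ?case by (simp only: fun_ring_mat_fun) (intro imageI falg.mult)
  qed
next
  fix f assume "f \<in> mat_fun n d ` falg B"
  then obtain F where F: "F \<in> falg B" "f = mat_fun n d F" by blast
  show "f \<in> generated_alg (carrier_mat n d) (mat_fun n d ` B)"
    unfolding F(2) generated_alg_def using F(1)
  proof (induction F rule: falg.induct)
    case (const c)
    show ?case by (rule generate_ring.incl) (auto simp: mat_fun_def)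
  next
    case (incl F)
    then show ?case by (intro generate_ring.incl) blast
  next
    case (add F G)
    then show ?case using generate_ring.eng_add[OF add.IH] by (simp only: fun_ring_mat_fun)
  next
    case (mult F G)
    then show ?case using generate_ring.eng_mult[OF mult.IH] by (simp only: fun_ring_mat_fun)
  qed
qed

lemma falg_vars: "falg {\<lambda>x. x i | i. i \<in> I} = (pol I :: (('i \<Rightarrow> 'a::field) \<Rightarrow> 'a) set)"
proof (intro equalityI subsetI)
  fix F :: "('i \<Rightarrow> 'a) \<Rightarrow> 'a" assume "F \<in> falg {\<lambda>x. x i | i. i \<in> I}"
  then show "F \<in> pol I"
  proof (induction F rule: falg.induct)
    case (incl f)
    then show ?case using pol_var by auto
  qed (auto intro: pol_const pspan.add pol_mult)
next
  fix F :: "('i \<Rightarrow> 'a) \<Rightarrow> 'a" assume "F \<in> pol I"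
  then show "F \<in> falg {\<lambda>x. x i | i. i \<in> I}"
  proof (induction F rule: pspan.induct)
    case (mono \<kappa> c)
    have "(\<lambda>z. mon z \<kappa>) \<in> falg {\<lambda>x. x i | i. i \<in> I}"
      using mono
    proof (induction \<kappa>)
      case (add i \<kappa>)
      then have "(\<lambda>x. x i) \<in> falg {\<lambda>x. x i | i. i \<in> I}" by (intro falg.incl) auto
      with add show ?case by (auto intro: falg.mult)
    qed (auto intro: falg.const)
    then show ?case by (rule falg_scale)
  qed (auto intro: falg.const falg.add)
qed

lemma mat_polys_eq: "mat_polys n d = mat_fun n d ` (pol (box n d) :: ((nat \<times> nat \<Rightarrow> 'a::field) \<Rightarrow> 'a) set)"
proof -
  have "{\<lambda>x\<in>carrier_mat n d. x $$ (i, j) | i j. i < n \<and> j < d} = (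
      mat_fun n d ` {\<lambda>x. x i | i. i \<in> box n d} :: ('a mat \<Rightarrow> 'a) set)"
    by (auto simp: mat_fun_def image_def)
  then show ?thesis by (simp only: mat_polys_def generated_alg_mat_fun falg_vars)
qed

lemma mat_mult_entries:
  assumes "x \<in> carrier_mat n m" "y \<in> carrier_mat m d" "p \<in> box n d"
  shows "(x * y) $$ p = lmul m (($$) x) (($$) y) p" "(x * y) $$ p = rmul m (($$) y) (($$) x) p"
  using assms by (auto simp: lmul_def rmul_def scalar_prod_def atLeast0LessThan)

lemma lmul_pol: "F \<in> pol (box n d) \<Longrightarrow> (\<lambda>x. F (lmul n h x)) \<in> pol (box n d)"
  by (erule pol_subst) (auto simp: lmul_def intro!: pol_sum pspan_scale pol_var)

text \<open>The action of \<open>h\<close> involves its inverse. As \<open>H\<close> is closed under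
  inverses, invariance may be tested on the inverses, where the action becomes plain left
  multiplication by \<open>h\<close>.\<close>

lemma vector_invariants_eq:
  fixes H :: "'a::field mat set"
  assumes H: "subgroup H (GL n)"
  shows "vector_invariants n d H = mat_fun n d ` invs n d ((\<lambda>h. ($$) h) ` H)"
proof -
  interpret GL: group "GL n :: 'a mat monoid" by (rule GL_group)
  have HG: "h \<in> carrier (GL n)" if "h \<in> H" for h using subgroup.mem_carrier[OF H that] .
  have act: "left_act n d (inv\<^bsub>GL n\<^esub> h) (mat_fun n d F) = mat_fun n d (\<lambda>x. F (lmul n (($$) h) x))"
    if h: "h \<in> H" and F: "F \<in> pol (box n d)" for h F
  proof -
    have hm: "h \<in> carrier_mat n n" using HG[OF h] by (simp add: carrier_GL)
    have "F (($$) (h * x)) = F (lmul n (($$) h) (($$) x))" if "x \<in> carrier_mat n d" for x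
      by (rule pol_cong[OF F]) (rule mat_mult_entries(1)[OF hm that])
    then show ?thesis using hm HG[OF h]
      unfolding left_act_def mat_fun_def by (intro restrict_ext) simp
  qed
  have iff: "(\<forall>h\<in>H. left_act n d h (mat_fun n d F) = mat_fun n d F) \<longleftrightarrow> F \<in> invs n d ((\<lambda>h. ($$) h) ` H)"
    if F: "F \<in> pol (box n d)" for F
  proof -
    have "(\<forall>h\<in>H. left_act n d h (mat_fun n d F) = mat_fun n d F) \<longleftrightarrow>
        (\<forall>h\<in>H. left_act n d (inv\<^bsub>GL n\<^esub> h) (mat_fun n d F) = mat_fun n d F)"
    proof (intro iffI ballI)
      fix h assume "\<forall>h\<in>H. left_act n d h (mat_fun n d F) = mat_fun n d F" "h \<in> H"
      then show "left_act n d (inv\<^bsub>GL n\<^esub> h) (mat_fun n d F) = mat_fun n d F"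
        using subgroup.m_inv_closed[OF H] by simp
    next
      fix h assume "\<forall>h\<in>H. left_act n d (inv\<^bsub>GL n\<^esub> h) (mat_fun n d F) = mat_fun n d F" "h \<in> H"
      then have "left_act n d (inv\<^bsub>GL n\<^esub> (inv\<^bsub>GL n\<^esub> h)) (mat_fun n d F) = mat_fun n d F"
        using subgroup.m_inv_closed[OF H] by simp
      then show "left_act n d h (mat_fun n d F) = mat_fun n d F"
        using HG[OF \<open>h \<in> H\<close>] by simp
    qed
    also have "\<dots> \<longleftrightarrow> (\<forall>h\<in>H. (\<lambda>x. F (lmul n (($$) h) x)) = F)"
      by (intro ball_cong refl) (simp add: act F mat_fun_eq_iff lmul_pol)
    also have "\<dots> \<longleftrightarrow> F \<in> invs n d ((\<lambda>h. ($$) h) ` H)"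
      using F by (simp add: invs_def fun_eq_iff)
    finally show ?thesis .
  qed
  show ?thesis
  proof (intro equalityI subsetI)
    fix f assume "f \<in> vector_invariants n d H"
    then have "f \<in> mat_fun n d ` pol (box n d) \<and> (\<forall>h\<in>H. left_act n d h f = f)"
      unfolding vector_invariants_def mat_polys_eq mem_Collect_eq .
    note f = conjunct1[OF this] and inv = conjunct2[OF this]
    from f obtain F where F: "f = mat_fun n d F" "F \<in> pol (box n d)" by (elim imageE)
    show "f \<in> mat_fun n d ` invs n d ((\<lambda>h. ($$) h) ` H)"
      unfolding F(1) using iff[OF F(2)] inv F(1) by (intro imageI) simp
  next
    fix f assume "f \<in> mat_fun n d ` invs n d ((\<lambda>h. ($$) h) ` H)"
    then obtain F where F: "f = mat_fun n d F" "F \<in> invs n d ((\<lambda>h. ($$) h) ` H)" by (elim imageE)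
    show "f \<in> vector_invariants n d H"
      unfolding vector_invariants_def mat_polys_eq F(1) mem_Collect_eq
      using iff[OF invs_pol[OF F(2)]] F(2) by (intro conjI imageI invs_pol[OF F(2)]) simp
  qed
qed

lemma falg_closure:
  assumes "\<And>f. f \<in> B \<Longrightarrow> f \<in> falg C" "F \<in> falg B"
  shows "F \<in> falg C"
  using assms(2) by (induction F rule: falg.induct) (auto intro: falg.intros assms(1))

text \<open>Every matrix \<open>A\<close> lies on the line of the \<open>A - t I\<close>, of which all but finitely many are invertible.\<close>

lemma invertible_gens:
  fixes H :: "(nat \<times> nat \<Rightarrow> 'a::field) set"
  assumes inf: "infinite (UNIV :: 'a set)" and nd: "n \<le> d"
  shows "falg {\<lambda>x. f (rmul d (($$) g) x) | f g. f \<in> invs n n H \<and> g \<in> carrier (GL d)} = falg (gens n d n H)"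
    (is "falg ?G = _")
proof (intro equalityI subsetI)
  fix F assume "F \<in> falg ?G"
  then show "F \<in> falg (gens n d n H)" by (rule falg_closure[rotated]) (auto simp: gens_def intro: falg.incl)
next
  fix F assume "F \<in> falg (gens n d n H)"
  then show "F \<in> falg ?G"
  proof (rule falg_closure[rotated])
    fix f' assume "f' \<in> gens n d n H"
    then obtain f B where f: "f \<in> invs n n H" "f' = (\<lambda>x. f (rmul d B x))" by (auto simp: gens_def)
    \<comment> \<open>\<open>J\<close> is minus the identity and \<open>A\<close> pads
      \<open>B\<close> with zero columns, so \<open>P x\<close> is the polynomial in t given by
      \<open>f\<close> on the first \<open>n\<close> columns of x (A - t I). Its constant
      coefficient is f' x.\<close>
    define J :: "nat \<times> nat \<Rightarrow> 'a" where "J = (\<lambda>(i, j). if i = j then - 1 else 0)"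
    define A where "A = mat d d (\<lambda>(i, j). if j < n then B (i, j) else 0)"
    have A: "A \<in> carrier_mat d d" by (simp add: A_def)
    define T where "T = {t. poly (char_poly A) t \<noteq> 0}"
    have "char_poly A \<noteq> 0" using degree_monic_char_poly[OF A] by auto
    then have "finite (- T)" using poly_roots_finite by (auto simp: T_def Compl_eq)
    then have T: "infinite T" using inf finite_Un[of T "- T"] by auto
    obtain D where "\<forall>x y. \<exists>p. degree p \<le> D \<and> (\<forall>t. f (\<lambda>i. x i + t * y i) = poly p t)"
      using pol_line_degree[OF invs_pol[OF f(1)]] by blast
    then have "\<forall>x. \<exists>p. degree p \<le> D \<and> (\<forall>t. f (\<lambda>i. rmul d B x i + t * rmul d J x i) = poly p t)" by blast
    then obtain P where P: "\<And>x. degree (P x) \<le> D"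
      "\<And>x t. f (\<lambda>i. rmul d B x i + t * rmul d J x i) = poly (P x) t" by metis
    have "(\<lambda>x. poly.coeff (P x) 0) \<in> falg ?G"
    proof (rule poly_coeff_in_subspace[OF falg_subspace T P(1)])
      fix t assume t: "t \<in> T"
      define g where "g = char_matrix A t"
      have "det g \<noteq> 0"
        using t eigenvalue_det[OF A] eigenvalue_root_char_poly[OF A] by (auto simp: T_def g_def)
      then have g: "g \<in> carrier (GL d)" using A by (simp add: carrier_GL g_def)
      have "poly (P x) t = f (rmul d (($$) g) x)" for x
        unfolding P(2)[symmetric]
      proof (rule pol_cong[OF invs_pol[OF f(1)]])
        fix p assume p: "p \<in> box n n"
        obtain i j where p': "p = (i, j)" by (cases p)
        have "x (i, s) * B (s, j) + t * (x (i, s) * J (s, j)) = x (i, s) * g $$ (s, j)" if "s < d" for s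
          using p p' that nd A by (auto simp: g_def char_matrix_def A_def J_def algebra_simps)
        then have "(\<Sum>s<d. x (i, s) * B (s, j) + t * (x (i, s) * J (s, j))) = (\<Sum>s<d. x (i, s) * g $$ (s, j))"
          by (intro sum.cong) auto
        then show "rmul d B x p + t * rmul d J x p = rmul d (($$) g) x p"
          by (simp add: p' rmul_def sum.distrib sum_distrib_left)
      qed
      then show "(\<lambda>x. poly (P x) t) \<in> falg ?G"
        using f(1) g by (intro falg.incl) auto
    qed
    moreover have "poly.coeff (P x) 0 = f' x" for x
      using P(2)[of x 0] by (simp add: f(2) poly_0_coeff_0)
    ultimately show "f' \<in> falg ?G" by simp
  qed
qed

lemma polarization_alg_eq:
  fixes H :: "'a::field mat set"
  assumes inf: "infinite (UNIV :: 'a set)" and nd: "n \<le> d" and H: "subgroup H (GL n)"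
  shows "polarization_alg n d H = mat_fun n d ` falg (gens n d n ((\<lambda>h. ($$) h) ` H))"
proof -
  let ?H = "(\<lambda>h. ($$) h) ` H"
  have "right_act n d g (first_cols n d (mat_fun n n f)) = mat_fun n d (\<lambda>x. f (rmul d (($$) g) x))"
    if f: "f \<in> invs n n ?H" and g: "g \<in> carrier (GL d)" for f g
  proof -
    have gm: "g \<in> carrier_mat d d" using g by (simp add: carrier_GL)
    have "f (($$) (mat_of_cols n (map (col (x * g)) [0..<n]))) = f (rmul d (($$) g) (($$) x))"
      if x: "x \<in> carrier_mat n d" for x
    proof (rule pol_cong[OF invs_pol[OF f]])
      fix p assume p: "p \<in> box n n"
      obtain i j where p': "p = (i, j)" by (cases p)
      have "mat_of_cols n (map (col (x * g)) [0..<n]) $$ p = (x * g) $$ p"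
        using p p' nd x gm by (auto simp: mat_of_cols_def)
      also have "\<dots> = rmul d (($$) g) (($$) x) p"
        by (rule mat_mult_entries(2)[OF x gm]) (use p nd in auto)
      finally show "mat_of_cols n (map (col (x * g)) [0..<n]) $$ p = rmul d (($$) g) (($$) x) p" .
    qed
    then show ?thesis using gm
      by (auto simp: right_act_def first_cols_def mat_fun_def fun_eq_iff restrict_def)
  qed
  moreover have "{right_act n d g (first_cols n d f) | g f. g \<in> carrier (GL d) \<and> f \<in> vector_invariants n n H} =
      mat_fun n d ` {\<lambda>x. f (rmul d (($$) g) x) | f g. f \<in> invs n n ?H \<and> g \<in> carrier (GL d)}"
    (is "?A = mat_fun n d ` ?B")
    if gens: "\<And>f g. f \<in> invs n n ?H \<Longrightarrow> g \<in> carrier (GL d) \<Longrightarrow>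
      right_act n d g (first_cols n d (mat_fun n n f)) = mat_fun n d (\<lambda>x. f (rmul d (($$) g) x))"
  proof (intro equalityI subsetI)
    fix F assume "F \<in> ?A"
    then obtain g f where "g \<in> carrier (GL d)" "f \<in> invs n n ?H"
      "F = right_act n d g (first_cols n d (mat_fun n n f))"
      unfolding vector_invariants_eq[OF H] by blast
    then show "F \<in> mat_fun n d ` ?B" using gens by blast
  next
    fix F assume "F \<in> mat_fun n d ` ?B"
    then obtain g f where gf: "g \<in> carrier (GL d)" "f \<in> invs n n ?H"
      "F = mat_fun n d (\<lambda>x. f (rmul d (($$) g) x))" by blast
    have "F = right_act n d g (first_cols n d (mat_fun n n f))" using gens[OF gf(2,1)] gf(3) by simp
    then show "F \<in> ?A" using gf(1,2) unfolding vector_invariants_eq[OF H] by blast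
  qed
  ultimately show ?thesis
    by (simp only: polarization_alg_def generated_alg_mat_fun invertible_gens[OF inf nd])
qed

lemma mat_poly_ring_ops:
  "mat_fun n d F \<otimes>\<^bsub>mat_poly_ring n d\<^esub> mat_fun n d G = mat_fun n d (\<lambda>x. F x * G x)"
  "\<one>\<^bsub>mat_poly_ring n d\<^esub> = mat_fun n d (\<lambda>x. 1)"
  "\<zero>\<^bsub>mat_poly_ring n d\<^esub> = mat_fun n d (\<lambda>x. 0)"
  "carrier (mat_poly_ring n d) = mat_fun n d ` pol (box n d)"
  by (simp_all add: mat_poly_ring_def fun_ring_mat_fun mat_polys_eq)

lemma mat_poly_ring_power:
  "mat_fun n d F [^]\<^bsub>mat_poly_ring n d\<^esub> (m::nat) = mat_fun n d (\<lambda>x. F x ^ m)"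
  by (induction m) (simp_all add: nat_pow_def mat_poly_ring_ops mult.commute)

theorem vector_invariants_in_p_root_closure:
  fixes H :: "'a::alg_closed_field mat set"
  assumes nd: "n \<le> d" and H: "subgroup H (GL n)"
  shows "in_p_root_closure CHAR('a) (mat_poly_ring n d) (polarization_alg n d H) (vector_invariants n d H)"
proof -
  note inf = alg_closed_field_infinite[where 'a = 'a]
  let ?H = "(\<lambda>h. ($$) h) ` H"
  note eqs = vector_invariants_eq[OF H] polarization_alg_eq[OF inf nd H]
  have sub: "falg (gens n d n ?H) \<subseteq> invs n d ?H" using falg_gens_invs by blast
  show ?thesis
  proof (cases "CHAR('a) = 0")
    case True
    then have "falg (gens n d n ?H) = invs n d ?H" using sub polarization_char_0 by blast
    then show ?thesis using True by (simp add: in_p_root_closure_def eqs)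
  next
    case False
    then have p: "prime CHAR('a)" "of_nat CHAR('a) = (0 :: 'a)" by (auto intro: prime_CHAR_semidom)
    show ?thesis
      unfolding in_p_root_closure_def eqs if_not_P[OF False]
    proof (intro conjI image_mono sub ballI)
      fix s assume "s \<in> mat_fun n d ` invs n d ?H"
      then obtain F where F: "F \<in> invs n d ?H" "s = mat_fun n d F" by blast
      obtain m where "(\<lambda>x. F x ^ (CHAR('a) ^ m)) \<in> falg (gens n d n ?H)"
        using power_in_polarization[OF inf p nd F(1)] by blast
      then show "\<exists>m. s [^]\<^bsub>mat_poly_ring n d\<^esub> (CHAR('a) ^ m) \<in> mat_fun n d ` falg (gens n d n ?H)"
        unfolding F(2) mat_poly_ring_power by (intro exI[of _ m] imageI)
    qed
  qed
qed

section \<open>Invariants of subgroups of the special linear group\<close>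

lemma det_pol: "(\<lambda>y. det (mat n n y)) \<in> pol (box n n)"
proof -
  have "det (mat n n y) = (\<Sum>p\<in>{p. p permutes {0..<n}}. signof p * (\<Prod>i=0..<n. y (i, p i)))" for y :: "nat \<times> nat \<Rightarrow> 'a"
  proof -
    have "det (mat n n y) = (\<Sum>p\<in>{p. p permutes {0..<n}}. signof p * (\<Prod>i=0..<n. mat n n y $$ (i, p i)))"
      by (rule det_def') simp
    also have "\<dots> = (\<Sum>p\<in>{p. p permutes {0..<n}}. signof p * (\<Prod>i=0..<n. y (i, p i)))"
    proof (intro sum.cong refl arg_cong2[of _ _ _ _ "(*)"] prod.cong)
      fix p i assume "p \<in> {p. p permutes {0..<n}}" "i \<in> {0..<n}"
      then show "mat n n y $$ (i, p i) = y (i, p i)"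
        using permutes_in_image[of p "{0..<n}" i] by simp
    qed
    finally show ?thesis .
  qed
  moreover have "(\<lambda>y. \<Sum>p\<in>{p. p permutes {0..<n}}. signof p * (\<Prod>i=0..<n. y (i, p i))) \<in> pol (box n n)"
  proof (intro pol_sum pspan_scale pol_prod pol_var)
    fix p i assume "p \<in> {p. p permutes {0..<n}}" "i \<in> {0..<n}"
    then show "(i, p i) \<in> box n n"
      using permutes_in_image[of p "{0..<n}" i] by simp
  qed
  ultimately show ?thesis by simp
qed

lemma det_lmul: "det (mat n n (lmul n h y)) = det (mat n n h) * det (mat n n y)"
proof -
  have "mat n n (lmul n h y) = mat n n h * mat n n y"
    by (rule eq_matI) (auto simp: lmul_def scalar_prod_def atLeast0LessThan)
  then show ?thesis by (simp add: det_mult[of _ n])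
qed

lemma minor_in_gens:
  assumes "\<And>h. h \<in> H \<Longrightarrow> det (mat n n h) = 1"
  shows "(\<lambda>x. det (mat n n (rmul d B x))) \<in> gens n d n H"
proof -
  have "(\<lambda>y. det (mat n n y)) \<in> invs n n H"
    using assms by (simp add: invs_def det_pol det_lmul)
  then show ?thesis unfolding gens_def
    by (intro CollectI exI[of _ "\<lambda>y. det (mat n n y)"] exI[of _ B] conjI refl)
qed

text \<open>Cramer's rule for column \<open>j\<close> against the first \<open>n\<close> columns:
  each minor is expanded along the replaced column, whose cofactors do not see the
  replacement.\<close>

lemma minor_expansion:
  fixes x :: "nat \<times> nat \<Rightarrow> 'a::field"
  assumes i: "i < n"
  shows "det (mat n n x) * x (i, j) =
    (\<Sum>l<n. x (i, l) * det (mat n n (\<lambda>(r, s). if s = l then x (r, j) else x (r, s))))"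
proof -
  define A where "A = mat n n x"
  have A: "A \<in> carrier_mat n n" by (simp add: A_def)
  have col: "det (mat n n (\<lambda>(r, s). if s = l then x (r, j) else x (r, s))) =
      (\<Sum>r<n. x (r, j) * cofactor A r l)" if l: "l < n" for l
  proof -
    define A' where "A' = mat n n (\<lambda>(r, s). if s = l then x (r, j) else x (r, s))"
    have "mat_delete A' r l = mat_delete A r l" for r
      by (rule eq_matI) (auto simp: mat_delete_def A'_def A_def)
    then have "cofactor A' r l = cofactor A r l" for r by (simp add: cofactor_def)
    moreover have "det A' = (\<Sum>r<n. A' $$ (r, l) * cofactor A' r l)"
      by (rule laplace_expansion_column[OF _ l]) (simp add: A'_def)
    ultimately show ?thesis using l by (simp add: A'_def)
  qed
  have adj: "(\<Sum>l<n. x (i, l) * cofactor A r l) = (if i = r then det A else 0)" if r: "r < n" for r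
  proof -
    have "(A * adj_mat A) $$ (i, r) = (\<Sum>l<n. x (i, l) * cofactor A r l)"
      using i r A by (simp add: adj_mat_def scalar_prod_def atLeast0LessThan) (simp add: A_def i)
    then show ?thesis using i r unfolding adj_mat(2)[OF A] by (cases "i = r") simp_all
  qed
  have "(\<Sum>l<n. x (i, l) * det (mat n n (\<lambda>(r, s). if s = l then x (r, j) else x (r, s)))) =
      (\<Sum>l<n. \<Sum>r<n. x (i, l) * (x (r, j) * cofactor A r l))"
    by (simp add: col sum_distrib_left)
  also have "\<dots> = (\<Sum>r<n. \<Sum>l<n. x (i, l) * (x (r, j) * cofactor A r l))" by (rule sum.swap)
  also have "\<dots> = (\<Sum>r<n. x (r, j) * (\<Sum>l<n. x (i, l) * cofactor A r l))"
    by (simp add: sum_distrib_left mult.left_commute)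
  also have "\<dots> = (\<Sum>r<n. x (r, j) * (if i = r then det A else 0))" by (simp add: adj)
  also have "\<dots> = det A * x (i, j)"
    using i by (simp add: if_distrib[of "\<lambda>a. _ * a"] mult.commute cong: if_cong)
  finally show ?thesis by (simp add: A_def)
qed

lemma rmul_selection:
  "\<sigma> s < d \<Longrightarrow> rmul d (\<lambda>(t, s). if t = \<sigma> s then 1 else 0) x (r, s) = x (r, \<sigma> s)"
  by (simp add: rmul_def if_distrib[of "\<lambda>a. _ * a"] cong: if_cong)

text \<open>
  If \<open>y\<close> consists of the first \<open>n\<close> columns of \<open>x\<close>, then \<open>det y \<cdot> x = y (adj y \<cdot> x)\<close>, and the entries of
  \<open>adj y \<cdot> x\<close> are maximal minors of \<open>x\<close>.
\<close>

lemma polarization_denominator: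
  fixes H :: "(nat \<times> nat \<Rightarrow> 'a::field) set"
  assumes inf: "infinite (UNIV :: 'a set)" and nd: "n \<le> d"
    and H: "\<And>h. h \<in> H \<Longrightarrow> det (mat n n h) = 1" and F: "F \<in> invs n d H"
  obtains D where "D \<in> falg (gens n d n H)" "D \<noteq> (\<lambda>x. 0)" "(\<lambda>x. D x * F x) \<in> falg (gens n d n H)"
proof -
  let ?R = "falg (gens n d n H)"
  define \<delta> :: "(nat \<times> nat \<Rightarrow> 'a) \<Rightarrow> 'a" where "\<delta> x = det (mat n n x)" for x
  define c :: "(nat \<times> nat \<Rightarrow> 'a) \<Rightarrow> nat \<times> nat \<Rightarrow> 'a"
    where "c x = (\<lambda>(l, j). det (mat n n (\<lambda>(r, s). if s = l then x (r, j) else x (r, s))))" for x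
  define sel :: "(nat \<Rightarrow> nat) \<Rightarrow> nat \<times> nat \<Rightarrow> 'a" where "sel \<sigma> = (\<lambda>(t, s). if t = \<sigma> s then 1 else 0)" for \<sigma>
  have cR: "(\<lambda>x. c x (l, j)) \<in> ?R" if j: "j < d" for l j
  proof -
    define \<sigma> where "\<sigma> s = (if s = l then j else s)" for s
    have "mat n n (\<lambda>(r, s). if s = l then x (r, j) else x (r, s)) = mat n n (rmul d (sel \<sigma>) x)"
      for x :: "nat \<times> nat \<Rightarrow> 'a"
      using j nd by (intro eq_matI) (auto simp: sel_def rmul_selection \<sigma>_def)
    then have "(\<lambda>x. c x (l, j)) = (\<lambda>x. det (mat n n (rmul d (sel \<sigma>) x)))" by (simp add: c_def)
    then show ?thesis using falg.incl[OF minor_in_gens[OF H]] by simp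
  qed
  \<comment> \<open>Selecting the first \<open>n\<close> columns is right multiplication by a
    constant matrix; invariants of square matrices thereby become elements of
    \<open>?R\<close>.\<close>
  have restrict: "a (rmul d (sel (\<lambda>s. s)) x) = a x" if "a \<in> pol (box n n)" for a x
    by (rule pol_cong[OF that]) (use nd in \<open>auto simp: sel_def rmul_selection\<close>)
  have incl: "a \<in> ?R" if a: "a \<in> invs n n H" for a
  proof -
    have "a = (\<lambda>x. a (rmul d (sel (\<lambda>s. s)) x))" using restrict[OF invs_pol[OF a]] by simp
    then have "a \<in> gens n d n H" unfolding gens_def using a by blast
    then show ?thesis by (rule falg.incl)
  qed
  have \<delta>R: "\<delta> \<in> ?R"
    using H by (intro incl) (simp add: invs_def det_pol det_lmul \<delta>_def[abs_def])
  have hom: "(\<lambda>x. \<delta> x ^ e * g x) \<in> ?R" if g: "g \<in> invs n d H" "g \<in> hpol (box n d) e" for g e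
  proof -
    let ?K = "multisets_of_size (box n d)"
    \<comment> \<open>For square x the coefficients in z of g(x z) are invariants of x. Substituting
      for z the matrix of minors gives delta^e g.\<close>
    have "(\<lambda>x z. g (rmul n z x)) \<in> gspan UNIV (?K e)"
    proof (rule pspan_subst[OF g(2)])
      fix p assume "p \<in> box n d"
      then obtain i j where p: "p = (i, j)" "j < d" by auto
      have "(\<lambda>x z. \<Sum>l<n. x (i, l) * z (l, j)) \<in> gspan UNIV (?K 1)"
      proof (rule gspan_sum)
        fix l assume "l \<in> {..<n}"
        then have "{#(l, j)#} \<in> ?K 1" using p by (simp add: multisets_of_size_def)
        from gspan.mono[OF UNIV_I this, of "\<lambda>x. x (i, l)"]
        show "(\<lambda>x z. x (i, l) * z (l, j)) \<in> gspan UNIV (?K 1)" by simp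
      qed
      then show "(\<lambda>x z. rmul n z x p) \<in> gspan UNIV (?K 1)" by (simp add: rmul_def p)
    qed (auto simp: multisets_of_size_def)
    moreover have fin: "finite (?K e)" by (rule finite_multisets_of_size) simp
    ultimately have "(\<lambda>x z. g (rmul n z x)) \<in> gspan (invs n n H) (?K e)"
      using invs_rmul[OF g(1)] by (intro gspan_coeffs[OF _ _ invs_subspace inf])
    then obtain a where a: "\<And>\<kappa>. \<kappa> \<in> ?K e \<Longrightarrow> a \<kappa> \<in> invs n n H"
      "(\<lambda>x z. g (rmul n z x)) = (\<lambda>x z. \<Sum>\<kappa>\<in>?K e. a \<kappa> x * mon z \<kappa>)"
      by (rule gspan_repr[OF _ invs_subspace fin]) (rule that)
    have monR: "(\<lambda>x. mon (c x) \<kappa>) \<in> ?R" if "set_mset \<kappa> \<subseteq> box n d" for \<kappa>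
      using that
    proof (induction \<kappa>)
      case (add p \<kappa>)
      obtain l j where "p = (l, j)" "j < d" using add.prems by auto
      then show ?case using add cR[of j l] by (simp add: falg.mult)
    qed (simp add: falg.const)
    have "\<delta> x ^ e * g x = (\<Sum>\<kappa>\<in>?K e. a \<kappa> x * mon (c x) \<kappa>)" for x
    proof -
      have "\<delta> x ^ e * g x = g (\<lambda>p. \<delta> x * x p)" using hpol_scale[OF g(2)] by simp
      also have "\<dots> = g (rmul n (c x) x)"
      proof (rule pol_cong[OF invs_pol[OF g(1)]])
        fix p assume "p \<in> box n d"
        then obtain i j where "p = (i, j)" "i < n" by auto
        then show "\<delta> x * x p = rmul n (c x) x p"
          by (simp add: \<delta>_def minor_expansion rmul_def c_def)
      qed
      also have "\<dots> = (\<Sum>\<kappa>\<in>?K e. a \<kappa> x * mon (c x) \<kappa>)" using fun_cong[OF fun_cong[OF a(2)]] .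
      finally show ?thesis .
    qed
    moreover have "(\<lambda>x. \<Sum>\<kappa>\<in>?K e. a \<kappa> x * mon (c x) \<kappa>) \<in> ?R"
      using incl a(1) monR by (intro falg_sum falg.mult) (auto simp: multisets_of_size_def)
    ultimately show ?thesis by simp
  qed
  obtain D g where g: "\<And>e. e \<le> D \<Longrightarrow> g e \<in> invs n d H \<inter> hpol (box n d) e" "F = (\<lambda>z. \<Sum>e\<le>D. g e z)"
    by (rule invs_homogeneous_parts[OF F inf]) (erule that)
  show thesis
  \<comment> \<open>The top degree serves as exponent for all homogeneous parts; a surplus factor of
    delta is itself in \<open>?R\<close>.\<close>
  proof (rule that[of "\<lambda>x. \<delta> x ^ D"])
    show "(\<lambda>x. \<delta> x ^ D) \<in> ?R" by (rule falg_power[OF \<delta>R])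
    have "mat n n (\<lambda>(i, j). if i = j then 1 else 0 :: 'a) = 1\<^sub>m n" by (rule eq_matI) auto
    then have "\<delta> (\<lambda>(i, j). if i = j then 1 else 0) = 1" by (simp add: \<delta>_def)
    then have "\<delta> (\<lambda>(i, j). if i = j then 1 else 0) ^ D \<noteq> 0" by simp
    then show "(\<lambda>x. \<delta> x ^ D) \<noteq> (\<lambda>x. 0)" by (meson fun_cong)
    have "\<delta> x ^ D * F x = (\<Sum>e\<le>D. \<delta> x ^ (D - e) * (\<delta> x ^ e * g e x))" for x
      unfolding g(2) sum_distrib_left
      by (intro sum.cong refl) (simp flip: power_add mult.assoc)
    moreover have "(\<lambda>x. \<Sum>e\<le>D. \<delta> x ^ (D - e) * (\<delta> x ^ e * g e x)) \<in> ?R"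
      using g(1) by (intro falg_sum falg.mult falg_power \<delta>R hom) auto
    ultimately show "(\<lambda>x. \<delta> x ^ D * F x) \<in> ?R" by simp
  qed
qed

section \<open>Radical closedness of polynomial rings\<close>

lemma mon_repeat_mset: "mon z (repeat_mset q \<kappa>) = mon z \<kappa> ^ q"
  by (induction q) (simp_all add: mon_union)

lemma repeat_mset_cases:
  assumes "\<And>i. q dvd count \<kappa> i" "q > 0"
  obtains \<kappa>' where "\<kappa> = repeat_mset q \<kappa>'"
proof -
  have "{i. 0 < count \<kappa> i div q} \<subseteq> set_mset \<kappa>" by (auto simp: div_greater_zero_iff intro: count_inI)
  then have "finite {i. 0 < count \<kappa> i div q}" by (rule finite_subset) simp
  then have "count (Abs_multiset (\<lambda>i. count \<kappa> i div q)) i = count \<kappa> i div q" for i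
    by (simp add: count_Abs_multiset)
  then have "\<kappa> = repeat_mset q (Abs_multiset (\<lambda>i. count \<kappa> i div q))"
    using assms(1) by (intro multiset_eqI) simp
  then show thesis by (rule that)
qed

lemma pol_power_q:
  assumes p: "prime p" "of_nat p = (0 :: 'a::field)" and "g \<in> pol I"
  shows "(\<lambda>z. g z ^ (p ^ m) :: 'a) \<in> pspan {\<kappa>. \<forall>i. p ^ m dvd count \<kappa> i}"
  using assms(3)
proof (induction g rule: pspan.induct)
  case zero
  have "(0 :: 'a) ^ (p ^ m) = 0" using prime_gt_0_nat[OF p(1)] by (intro zero_power) simp
  then show ?case by (simp only: pspan.zero)
next
  case (add f g)
  then show ?case by (simp add: freshman(1)[OF p] pspan.add)
next
  case (mono \<kappa> c)
  show ?case
    using pspan.mono[of "repeat_mset (p ^ m) \<kappa>" "{\<kappa>. \<forall>i. p ^ m dvd count \<kappa> i}" "c ^ (p ^ m)"]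
    by (simp add: power_mult_distrib mon_repeat_mset)
qed

lemma alg_closed_root:
  fixes c :: "'a::alg_closed_field"
  assumes "q > 0"
  obtains s where "s ^ q = c"
proof -
  let ?P = "Polynomial.monom 1 q + [:- c:]"
  have "degree ?P = q" using assms
    by (subst degree_add_eq_left) (auto simp: degree_monom_eq)
  then obtain s where "poly ?P s = 0" using alg_closed_imp_poly_has_root[of ?P] assms by auto
  then show thesis by (intro that[of s]) (simp add: poly_monom)
qed

text \<open>Coefficients have roots in an algebraically closed field, the exponents are divisible,
  and Frobenius joins the roots of the single terms.\<close>

lemma pol_root:
  fixes r :: "('i \<Rightarrow> 'a::alg_closed_field) \<Rightarrow> 'a"
  assumes p: "prime p" "of_nat p = (0 :: 'a)"
    and "r \<in> pspan {\<kappa>. set_mset \<kappa> \<subseteq> I \<and> (\<forall>i. p ^ m dvd count \<kappa> i)}"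
  shows "\<exists>f\<in>pol I. r = (\<lambda>z. f z ^ (p ^ m))"
proof -
  have q: "p ^ m > 0" using prime_gt_0_nat[OF p(1)] by simp
  show ?thesis using assms(3)
  proof (induction r rule: pspan.induct)
    case zero
    then show ?case using q by (intro bexI[of _ "\<lambda>z. 0"]) (auto simp: power_0_left intro: pspan.zero)
  next
    case (add r s)
    then obtain f g where "f \<in> pol I" "r = (\<lambda>z. f z ^ (p ^ m))" "g \<in> pol I" "s = (\<lambda>z. g z ^ (p ^ m))" by blast
    then show ?case
      by (intro bexI[of _ "\<lambda>z. f z + g z"]) (auto simp: freshman(1)[OF p] intro: pspan.add)
  next
    case (mono \<kappa> c)
    then obtain \<kappa>' where \<kappa>': "\<kappa> = repeat_mset (p ^ m) \<kappa>'" using repeat_mset_cases[OF _ q, of \<kappa>] by blast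
    obtain s where s: "s ^ (p ^ m) = c" by (rule alg_closed_root[OF q])
    have "set_mset \<kappa>' \<subseteq> I" using mono q by (auto simp: \<kappa>' subset_iff simp flip: count_greater_zero_iff)
    then show ?case using s
      by (intro bexI[of _ "\<lambda>z. s * mon z \<kappa>'"]) (auto simp: \<kappa>' mon_repeat_mset power_mult_distrib intro: pspan.mono)
  qed
qed

lemma pspan_split:
  assumes "r \<in> pspan K"
  shows "\<exists>r0\<in>pspan (K \<inter> P). \<exists>r1\<in>pspan (K - P). \<forall>z. r z = r0 z + r1 z"
  using assms
proof (induction r rule: pspan.induct)
  case zero
  then show ?case by (intro bexI[of _ "\<lambda>z. 0"]) (auto intro: pspan.zero)
next
  case (add r s)
  then obtain r0 r1 s0 s1 where rs: "r0 \<in> pspan (K \<inter> P)" "r1 \<in> pspan (K - P)" "\<forall>z. r z = r0 z + r1 z"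
    "s0 \<in> pspan (K \<inter> P)" "s1 \<in> pspan (K - P)" "\<forall>z. s z = s0 z + s1 z" by blast
  then show ?case
    by (intro bexI[of _ "\<lambda>z. r0 z + s0 z"] bexI[of _ "\<lambda>z. r1 z + s1 z"]) (auto intro: pspan.add)
next
  case (mono \<kappa> c)
  show ?case
  proof (cases "\<kappa> \<in> P")
    case True
    then show ?thesis using mono
      by (intro bexI[of _ "\<lambda>z. c * mon z \<kappa>"] bexI[of _ "\<lambda>z. 0"]) (auto intro: pspan.zero pspan.mono)
  next
    case False
    then show ?thesis using mono
      by (intro bexI[of _ "\<lambda>z. 0"] bexI[of _ "\<lambda>z. c * mon z \<kappa>"]) (auto intro: pspan.zero pspan.mono)
  qed
qed

text \<open>
  The part of \<open>r\<close> consisting of \<open>q\<close>-th powers of monomials is a \<open>q\<close>-th power \<open>f\<^sup>q\<close>, so the remaining part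
  times \<open>b\<^sup>q\<close> equals \<open>(a - f b)\<^sup>q\<close>. No monomial occurs on both sides.
\<close>

lemma pol_quotient:
  fixes a b r :: "('i \<Rightarrow> 'a::alg_closed_field) \<Rightarrow> 'a"
  assumes p: "prime p" "of_nat p = (0 :: 'a)"
    and ab: "a \<in> pol I" "b \<in> pol I" and r: "r \<in> pol I"
    and eq: "\<And>z. a z ^ (p ^ m) = r z * b z ^ (p ^ m)"
  shows "\<exists>f\<in>pol I. \<forall>z. a z = f z * b z"
proof -
  define q where "q = p ^ m"
  have q: "q > 0" using prime_gt_0_nat[OF p(1)] by (simp add: q_def)
  let ?P = "{\<kappa>. \<forall>i::'i. q dvd count \<kappa> i}"
  let ?K = "{\<kappa>. set_mset \<kappa> \<subseteq> I}"
  obtain r0 r1 where r0: "r0 \<in> pspan (?K \<inter> ?P)" and r1: "r1 \<in> pspan (?K - ?P)" and r01: "\<And>z. r z = r0 z + r1 z"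
    using pspan_split[OF r, of ?P] by blast
  have "r0 \<in> pspan {\<kappa>. set_mset \<kappa> \<subseteq> I \<and> (\<forall>i. p ^ m dvd count \<kappa> i)}"
    using r0 by (rule pspan_subset) (auto simp: q_def)
  then obtain f where f: "f \<in> pol I" "r0 = (\<lambda>z. f z ^ q)" using pol_root[OF p] unfolding q_def by blast
  have pow: "(\<lambda>z. g z ^ q) \<in> pspan ?P" if "g \<in> pol I" for g :: "('i \<Rightarrow> 'a) \<Rightarrow> 'a"
    using pol_power_q[OF p that] by (simp add: q_def)
  have diff: "r1 z * b z ^ q = (a z - f z * b z) ^ q" for z
    using eq[of z] by (simp add: q_def freshman(3)[OF p] r01 f(2) power_mult_distrib algebra_simps)
  have "(\<lambda>z. (a z - f z * b z) ^ q) \<in> pspan ?P"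
    by (intro pow pol_diff pol_mult ab f(1))
  moreover have "(\<lambda>z. r1 z * b z ^ q) \<in> pspan (- ?P)"
  proof (rule pspan_mult[OF r1 pow[OF ab(2)]])
    fix \<kappa> \<mu> assume \<kappa>: "\<kappa> \<in> ?K - ?P" and \<mu>: "\<mu> \<in> ?P"
    then obtain i where "\<not> q dvd count \<kappa> i" by blast
    moreover have "q dvd count \<mu> i" using \<mu> by blast
    ultimately have "\<not> q dvd count (\<kappa> + \<mu>) i" by (simp add: dvd_add_left_iff)
    then show "\<kappa> + \<mu> \<in> - ?P" by blast
  qed
  ultimately have "(\<lambda>z. (a z - f z * b z) ^ q) = (\<lambda>z. 0)"
    unfolding diff by (intro pspan_disjoint[OF alg_closed_field_infinite, of _ ?P "- ?P"]) auto
  then have "(a z - f z * b z) ^ q = 0" for z by (rule fun_cong)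
  then have "\<forall>z. a z = f z * b z" by simp
  then show ?thesis using f(1) by blast
qed

text \<open>The difference of \<open>f\<close> and its translate is killed by the nonzero polynomial
  \<open>b\<close>, and polynomial functions form a domain.\<close>

lemma invs_quotient:
  fixes a b :: "(nat \<times> nat \<Rightarrow> 'a::field) \<Rightarrow> 'a"
  assumes inf: "infinite (UNIV :: 'a set)" and ab: "a \<in> invs n d H" "b \<in> invs n d H"
    and f: "f \<in> pol (box n d)" and b: "b \<noteq> (\<lambda>z. 0)" and eq: "\<And>z. a z = f z * b z"
  shows "f \<in> invs n d H"
proof -
  obtain x where x: "b x \<noteq> 0" using b by blast
  have "f (lmul n h y) - f y = 0" if h: "h \<in> H" for h y
  proof (rule pol_domain[where G = "\<lambda>y. f (lmul n h y) - f y", OF inf invs_pol[OF ab(2)] _ _ x])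
    show "(\<lambda>y. f (lmul n h y) - f y) \<in> pol (box n d)" by (intro pol_diff lmul_pol f)
    fix z
    have "a (lmul n h z) = a z" "b (lmul n h z) = b z" using ab h by (auto simp: invs_def)
    then show "b z * (f (lmul n h z) - f z) = 0"
      using eq[of z] eq[of "lmul n h z"] by (simp add: algebra_simps)
  qed
  then show ?thesis using f by (simp add: invs_def)
qed

section \<open>Quotient fields\<close>

lemma (in domain) pow_nonzero: "b \<in> carrier R - {\<zero>} \<Longrightarrow> b [^] (m::nat) \<in> carrier R - {\<zero>}"
  by (induction m) (auto simp: integral_iff)

lemma (in domain) fraction_power:
  assumes "a \<in> carrier R" "b \<in> carrier R - {\<zero>}"
  shows "fraction R a b [^]\<^bsub>Frac R\<^esub> (m::nat) = fraction R (a [^] m) (b [^] m)"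
proof -
  interpret F: field "Frac R" by (rule field_Frac)
  show ?thesis
    using assms
  proof (induction m)
    case 0
    then show ?case by (simp add: Frac_one)
  next
    case (Suc m)
    then show ?case using pow_nonzero[OF assms(2), of m] by (simp add: fraction_mult)
  qed
qed

lemma SL_subgroup: "subgroup (carrier (SL n)) (GL n :: 'a::field mat monoid)"
proof -
  interpret GL: group "GL n :: 'a mat monoid" by (rule GL_group)
  have mult: "x \<otimes>\<^bsub>GL n\<^esub> y = x * y" and one: "\<one>\<^bsub>GL n\<^esub> = 1\<^sub>m n" for x y :: "'a mat"
    by (simp_all add: GL_def units_of_def ring_mat_def)
  show ?thesis
  proof (rule GL.subgroupI)
    show "carrier (SL n) \<subseteq> carrier (GL n :: 'a mat monoid)" by (auto simp: SL_def)
    show "carrier (SL n :: 'a mat monoid) \<noteq> {}"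
      using GL.one_closed by (auto simp: SL_def one intro!: exI[of _ "1\<^sub>m n"])
  next
    fix a :: "'a mat" assume a: "a \<in> carrier (SL n)"
    then have aG: "a \<in> carrier (GL n)" and det: "det a = 1" by (auto simp: SL_def)
    have "inv\<^bsub>GL n\<^esub> a * a = 1\<^sub>m n" using GL.l_inv[OF aG] by (simp add: mult one)
    moreover have "inv\<^bsub>GL n\<^esub> a \<in> carrier_mat n n" "a \<in> carrier_mat n n"
      using GL.inv_closed[OF aG] aG by (auto simp: carrier_GL)
    ultimately have "det (inv\<^bsub>GL n\<^esub> a) * det a = 1" by (metis det_mult det_one)
    then show "inv\<^bsub>GL n\<^esub> a \<in> carrier (SL n)"
      using GL.inv_closed[OF aG] det by (simp add: SL_def)
  next
    fix a b :: "'a mat" assume ab: "a \<in> carrier (SL n)" "b \<in> carrier (SL n)"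
    then have G: "a \<in> carrier (GL n)" "b \<in> carrier (GL n)" and det: "det a = 1" "det b = 1"
      by (auto simp: SL_def)
    have "det (a * b) = det a * det b" using G by (intro det_mult[of _ n]) (auto simp: carrier_GL)
    then show "a \<otimes>\<^bsub>GL n\<^esub> b \<in> carrier (SL n)"
      using GL.m_closed[OF G] det by (simp add: SL_def mult)
  qed
qed

theorem vector_invariants_p_root_closure:
  fixes H :: "'a::alg_closed_field mat set"
  assumes nd: "n \<le> d" and H: "subgroup H (SL n)"
  shows "to_Frac (mat_poly_ring n d) ` vector_invariants n d H =
    p_root_closure CHAR('a) (Frac (mat_poly_ring n d))
      (to_Frac (mat_poly_ring n d) ` polarization_alg n d H)
      (quotient_field (mat_poly_ring n d) (polarization_alg n d H))"
proof -
  note inf = alg_closed_field_infinite[where 'a = 'a]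
  let ?H = "(\<lambda>h. ($$) h) ` H"
  let ?A = "mat_poly_ring n d :: ('a mat \<Rightarrow> 'a) ring"
  let ?G = "falg (gens n d n ?H)"
  interpret GL: group "GL n :: 'a mat monoid" by (rule GL_group)
  interpret A: domain ?A by (rule mat_poly_ring_domain)
  have "subgroup H (GL n\<lparr>carrier := carrier (SL n)\<rparr>)" using H by (simp add: SL_def)
  then have HG: "subgroup H (GL n)" by (rule GL.incl_subgroup[OF SL_subgroup])
  note eqs = vector_invariants_eq[OF HG] polarization_alg_eq[OF inf nd HG]
  have closure: "in_p_root_closure CHAR('a) ?A (mat_fun n d ` ?G) (mat_fun n d ` invs n d ?H)"
    using vector_invariants_in_p_root_closure[OF nd HG] unfolding eqs .
  show ?thesis
  proof (cases "CHAR('a) = 0")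
    case True
    then show ?thesis using closure by (simp add: in_p_root_closure_def p_root_closure_def eqs)
  next
    case False
    then have p: "prime CHAR('a)" "of_nat CHAR('a) = (0 :: 'a)" by (auto intro: prime_CHAR_semidom)
    have detH: "det (mat n n h) = 1" if "h \<in> ?H" for h
    proof -
      from that obtain g where g: "g \<in> H" "h = ($$) g" by blast
      have "g \<in> carrier (SL n)" using subgroup.mem_carrier[OF H g(1)] .
      then have "g \<in> carrier_mat n n" "det g = 1" by (auto simp: SL_def carrier_GL)
      moreover from this have "mat n n h = g" by (intro eq_matI) (auto simp: g(2))
      ultimately show ?thesis by simp
    qed
    have pol: "F \<in> pol (box n d)" if "F \<in> ?G" for F using invs_pol[OF falg_gens_invs[OF that]] .
    have carrier: "mat_fun n d F \<in> carrier ?A" if "F \<in> pol (box n d)" for F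
      using that by (simp add: mat_poly_ring_ops)
    have nonzero: "mat_fun n d F \<noteq> \<zero>\<^bsub>?A\<^esub>" if "F \<in> pol (box n d)" "F \<noteq> (\<lambda>x. 0)" for F
      using that by (simp add: mat_poly_ring_ops mat_fun_eq_iff pspan.zero)
    have power: "to_Frac ?A s [^]\<^bsub>Frac ?A\<^esub> (m::nat) = to_Frac ?A (s [^]\<^bsub>?A\<^esub> m)" if "s \<in> carrier ?A" for s m
      using that by (simp add: to_Frac_def A.fraction_power)
    show ?thesis
      unfolding p_root_closure_def if_not_P[OF False] eqs
    proof (intro equalityI subsetI)
      fix s assume "s \<in> to_Frac ?A ` mat_fun n d ` invs n d ?H"
      then obtain F where F: "F \<in> invs n d ?H" "s = to_Frac ?A (mat_fun n d F)" by blast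
      note FA = carrier[OF invs_pol[OF F(1)]]
      obtain D where D: "D \<in> ?G" "D \<noteq> (\<lambda>x. 0)" "(\<lambda>x. D x * F x) \<in> ?G"
        by (rule polarization_denominator[OF inf nd detH F(1)]) (assumption, rule that)
      have DA: "mat_fun n d D \<in> carrier ?A - {\<zero>\<^bsub>?A\<^esub>}"
        using carrier[OF pol[OF D(1)]] nonzero[OF pol[OF D(1)] D(2)] by simp
      have "mat_fun n d (\<lambda>x. D x * F x) = mat_fun n d D \<otimes>\<^bsub>?A\<^esub> mat_fun n d F"
        by (simp add: mat_poly_ring_ops)
      then have "s = fraction ?A (mat_fun n d (\<lambda>x. D x * F x)) (mat_fun n d D)"
        unfolding F(2) to_Frac_def using FA DA
        by (subst A.fraction_eq_iff) (auto simp: A.m_comm)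
      then have "s \<in> quotient_field ?A (mat_fun n d ` ?G)"
        unfolding quotient_field_def using D(1,3) DA by blast
      moreover obtain m where "mat_fun n d F [^]\<^bsub>?A\<^esub> (CHAR('a) ^ m) \<in> mat_fun n d ` ?G"
        using closure F(1) False unfolding in_p_root_closure_def by (simp only: if_False) blast
      then have "s [^]\<^bsub>Frac ?A\<^esub> (CHAR('a) ^ m) \<in> to_Frac ?A ` mat_fun n d ` ?G"
        unfolding F(2) power[OF FA] by (rule imageI)
      ultimately show "s \<in> {s \<in> quotient_field ?A (mat_fun n d ` ?G).
          \<exists>m. s [^]\<^bsub>Frac ?A\<^esub> (CHAR('a) ^ m) \<in> to_Frac ?A ` mat_fun n d ` ?G}" by blast
    next
      fix s assume "s \<in> {s \<in> quotient_field ?A (mat_fun n d ` ?G).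
          \<exists>m. s [^]\<^bsub>Frac ?A\<^esub> (CHAR('a) ^ m) \<in> to_Frac ?A ` mat_fun n d ` ?G}"
      then obtain a b r m where ab: "a \<in> ?G" "b \<in> ?G" "mat_fun n d b \<noteq> \<zero>\<^bsub>?A\<^esub>"
        and s: "s = fraction ?A (mat_fun n d a) (mat_fun n d b)"
        and r: "r \<in> ?G" "s [^]\<^bsub>Frac ?A\<^esub> (CHAR('a) ^ m) = to_Frac ?A (mat_fun n d r)"
        unfolding quotient_field_def by blast
      note polab = pol[OF ab(1)] pol[OF ab(2)] pol[OF r(1)]
      note car = carrier[OF polab(1)] carrier[OF polab(2)] carrier[OF polab(3)]
      let ?q = "CHAR('a) ^ m"
      have bA: "mat_fun n d b \<in> carrier ?A - {\<zero>\<^bsub>?A\<^esub>}" using car(2) ab(3) by simp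
      have b0: "b \<noteq> (\<lambda>x. 0)" using ab(3) by (auto simp: mat_poly_ring_ops)
      \<comment> \<open>Clearing denominators turns the condition on \<open>s\<close> into the
        polynomial identity a^q = r b^q required by \<open>pol_quotient\<close>.\<close>
      have "fraction ?A (mat_fun n d a [^]\<^bsub>?A\<^esub> ?q) (mat_fun n d b [^]\<^bsub>?A\<^esub> ?q) =
          fraction ?A (mat_fun n d r) \<one>\<^bsub>?A\<^esub>"
        using r(2) unfolding s to_Frac_def A.fraction_power[OF car(1) bA] .
      then have "mat_fun n d a [^]\<^bsub>?A\<^esub> ?q \<otimes>\<^bsub>?A\<^esub> \<one>\<^bsub>?A\<^esub> = mat_fun n d r \<otimes>\<^bsub>?A\<^esub> mat_fun n d b [^]\<^bsub>?A\<^esub> ?q"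
        using A.pow_nonzero[OF bA] car by (subst (asm) A.fraction_eq_iff) auto
      then have "mat_fun n d (\<lambda>x. a x ^ ?q) = mat_fun n d (\<lambda>x. r x * b x ^ ?q)"
        by (simp add: mat_poly_ring_ops mat_poly_ring_power)
      then have "(\<lambda>x. a x ^ ?q) = (\<lambda>x. r x * b x ^ ?q)"
        using polab by (subst (asm) mat_fun_eq_iff) (auto intro: pol_power pol_mult)
      then have "a x ^ ?q = r x * b x ^ ?q" for x by (rule fun_cong)
      then obtain f where f: "f \<in> pol (box n d)" "\<forall>z. a z = f z * b z"
        using pol_quotient[OF p polab] by blast
      have "f \<in> invs n d ?H"
        by (rule invs_quotient[OF inf falg_gens_invs[OF ab(1)] falg_gens_invs[OF ab(2)] f(1) b0])
          (use f(2) in blast)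
      moreover have "s = to_Frac ?A (mat_fun n d f)"
      proof -
        have "mat_fun n d a = mat_fun n d f \<otimes>\<^bsub>?A\<^esub> mat_fun n d b"
          unfolding mat_poly_ring_ops using f(2) by (simp add: mat_fun_def)
        then show ?thesis
          unfolding s to_Frac_def using car carrier[OF f(1)] bA by (subst A.fraction_eq_iff) auto
      qed
      ultimately show "s \<in> to_Frac ?A ` mat_fun n d ` invs n d ?H" by blast
    qed
  qed
qed

theorem theorem10:
  fixes n d :: nat and H :: "'a::alg_closed_field mat set"
  assumes "d \<ge> n"
  shows
    "(grosshans_subgroup n (GL n) H \<longrightarrow>
        in_p_root_closure CHAR('a) (mat_poly_ring n d)
          (polarization_alg n d H) (vector_invariants n d H)) \<and>
     (grosshans_subgroup n (SL n) H \<longrightarrow>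
        to_Frac (mat_poly_ring n d) ` vector_invariants n d H =
        p_root_closure CHAR('a) (Frac (mat_poly_ring n d))
          (to_Frac (mat_poly_ring n d) ` polarization_alg n d H)
          (quotient_field (mat_poly_ring n d) (polarization_alg n d H)))"
proof (intro conjI impI)
  assume "grosshans_subgroup n (GL n) H"
  then have "subgroup H (GL n)" by (simp add: grosshans_subgroup_def closed_subgroup_def)
  then show "in_p_root_closure CHAR('a) (mat_poly_ring n d)
      (polarization_alg n d H) (vector_invariants n d H)"
    by (rule vector_invariants_in_p_root_closure[OF assms])
next
  assume "grosshans_subgroup n (SL n) H"
  then have "subgroup H (SL n)" by (simp add: grosshans_subgroup_def closed_subgroup_def)
  then show "to_Frac (mat_poly_ring n d) ` vector_invariants n d H =
      p_root_closure CHAR('a) (Frac (mat_poly_ring n d))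
        (to_Frac (mat_poly_ring n d) ` polarization_alg n d H)
        (quotient_field (mat_poly_ring n d) (polarization_alg n d H))"
    by (rule vector_invariants_p_root_closure[OF assms])
qed

end
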